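(* Let $\hat H$ be an infinite-dimensional symplectic Hilbert space whose symplectic form is $\omega(\xi,\eta)=\langle J\xi,\eta\rangle$ with $J$ a skew-adjoint unitary operator. Let $X$ be a topological space and let $\Gamma_x,M_x\subset\hat H$ and $L_x\subset\mathcal V_x$, $x\in X$, be continuous families of closed subspaces, where $\Gamma_x$ is isotropic with $\omega$-annihilator $\Gamma_x^*$ and $\mathcal V_x=\Gamma_x^*/\Gamma_x$ with quotient map $\gamma_x:\Gamma_x^*\to\mathcal V_x$. Suppose that, for each $x$, $M_x$ is Lagrangian and transversal to $(\Gamma_x,\Gamma_x^* )$, and $L_x$ is Lagrangian in $\mathcal V_x$ and Fredholm with respect to $\gamma_!M_x=\gamma_x(M_x\cap\Gamma_x^* )$. Then $$\operatorname{ind}_{\hat H}(\gamma^{-1}L,M)=\operatorname{ind}_{\mathcal V}(L,\gamma_!M)\in K^1(X),$$ where $\gamma^{-1}L$ is the family $(\gamma_x^{-1}(L_x))_{x\in X}$.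
   Context: All Hilbert spaces are complex and separable. The $\omega$-annihilator of a subspace $L$ is $L^*=\{\xi:\omega(\xi,\eta)=0\ \forall\eta\in L\}$; $L$ is isotropic if $L\subset L^*$ and Lagrangian if $L=L^*$. For closed isotropic $\Gamma$, the quotient $\mathcal V=\Gamma^*/\Gamma$ carries the induced symplectic form $\omega(\xi+\Gamma,\eta+\Gamma)=\omega(\xi,\eta)$; identifying $\mathcal V$ with $\Gamma^*\ominus\Gamma\subset\hat H$, this is the restriction of $\omega$, and $J$ preserves $\Gamma^*\ominus\Gamma$. $M$ is transversal to $(\Gamma,\Gamma^* )$ if $M+\Gamma$ is closed, $M\cap\Gamma=0$, and $M+\Gamma^*=\hat H$. A pair $(L,M)$ of closed subspaces is Fredholm if $L+M$ is closed and $\dim(L\cap M)$, $\operatorname{codim}(L+M)$ are finite. Families of closed subspaces are continuous when the orthogonal projections are norm continuous; $\mathcal V_x\cong\Gamma_x^*\ominus\Gamma_x$ depends continuously on $x$ and continuity of $L_x\subset\mathcal V_x$ is understood in $\hat H$. Under the hypotheses, $\gamma_!M_x$ is Lagrangian in $\mathcal V_x$ and depends continuously on $x$. $K^1$ index. For a Hilbert space $W$ let $\mathcal U(W)$ be the unitary group with the norm topology, $\mathcal U_K(W)=\{u\in\mathcal U(W): u-1\text{ compact}\}$ and $\mathcal U_F(W)=\{u\in\mathcal U(W): u+1\text{ Fredholm}\}$. For an infinite-dimensional separable Hilbert space $H$ and arbitrary $X$, $K^1(X):=[X,\mathcal U_K(H)]=[X,\mathcal U_F(H)]$ (the inclusion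 is a homotopy equivalence), with addition given by direct sum and zero element the constant map $1$. The index of a continuous $f:X\to\mathcal U_F(W)$ is the class of $f\oplus1:X\to\mathcal U_F(W\oplus H')$, $H'$ an auxiliary infinite-dimensional separable Hilbert space. For a Hilbert space $\Lambda$ with skew-adjoint unitary $J$ and $\omega(\xi,\eta)=\langle J\xi,\eta\rangle$, put $\Lambda^\pm=\ker(J\mp i)$. Each Lagrangian subspace $L$ is the graph of a unitary $u_L:\Lambda^+\to\Lambda^-$; a Lagrangian pair $(L,M)$ is Fredholm iff $-u_M^{-1}u_L\in\mathcal U_F(\Lambda^+)$. For a continuous family $(L_x,M_x)$ of Fredholm Lagrangian pairs in $\Lambda_x$ (where $\Lambda_x$ may be a continuous family of $J$-invariant closed subspaces of a fixed symplectic space), the index $\operatorname{ind}_\Lambda(L,M)\in K^1(X)$ is the index of the family $x\mapsto-u_{M_x}^{-1}u_{L_x}\in\mathcal U_F(\Lambda_x^+)$, where, if $\Lambda_x^+$ depends on $x$, one first stabilizes (adding the identity of an auxiliary infinite-dimensional Hilbert space) and trivializes the resulting family of Hilbert spaces by a norm continuous family of unitaries onto a fixed Hilbert space (the result does not depend on the trivialization). *)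

theory Defs
  imports "HOL-Analysis.Analysis"
begin

section \<open>Complex separable Hilbert spaces\<close>

text \<open>
  The underlying real Hilbert space carries the real part of the complex inner product, so that
  norm, topology and completeness are those of the library.  The complex inner product is linear in
  its first argument.  For metric spaces, separability is second countability.
\<close>

class sep_chilbert = real_inner + banach + second_countable_topology +
  fixes scaleC :: "complex \<Rightarrow> 'a \<Rightarrow> 'a"  (infixr "*\<^sub>C" 75)
    and cinner :: "'a \<Rightarrow> 'a \<Rightarrow> complex"
  assumes scaleC_add_right: "a *\<^sub>C (x + y) = a *\<^sub>C x + a *\<^sub>C y"
    and scaleC_add_left: "(a + b) *\<^sub>C x = a *\<^sub>C x + b *\<^sub>C x"
    and scaleC_scaleC: "a *\<^sub>C (b *\<^sub>C x) = (a * b) *\<^sub>C x"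
    and scaleC_of_real: "complex_of_real r *\<^sub>C x = scaleR r x"
    and cinner_add_left: "cinner (x + y) z = cinner x z + cinner y z"
    and cinner_scaleC_left: "cinner (a *\<^sub>C x) y = a * cinner x y"
    and cinner_commute: "cinner y x = cnj (cinner x y)"
    and Re_cinner: "Re (cinner x y) = inner x y"

global_interpretation cvec: vector_space "scaleC :: complex \<Rightarrow> 'a::sep_chilbert \<Rightarrow> 'a"
proof
  show "1 *\<^sub>C x = x" for x :: 'a
    using scaleC_of_real[of 1 x] by simp
qed (simp_all add: scaleC_add_right scaleC_add_left scaleC_scaleC)

instantiation prod :: (sep_chilbert, sep_chilbert) sep_chilbert
begin

definition scaleC_prod_def: "a *\<^sub>C p = (a *\<^sub>C fst p, a *\<^sub>C snd p)"

definition cinner_prod_def: "cinner p q = cinner (fst p) (fst q) + cinner (snd p) (snd q)"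

instance
proof
  fix a b :: complex and r :: real and x y z :: "'a \<times> 'b"
  show "a *\<^sub>C (x + y) = a *\<^sub>C x + a *\<^sub>C y"
    and "(a + b) *\<^sub>C x = a *\<^sub>C x + b *\<^sub>C x"
    and "a *\<^sub>C (b *\<^sub>C x) = (a * b) *\<^sub>C x"
    by (simp_all add: scaleC_prod_def scaleC_add_right scaleC_add_left scaleC_scaleC)
  show "complex_of_real r *\<^sub>C x = scaleR r x"
    by (simp add: scaleC_prod_def scaleC_of_real scaleR_prod_def)
  show "cinner (x + y) z = cinner x z + cinner y z"
    and "cinner (a *\<^sub>C x) y = a * cinner x y"
    by (simp_all add: cinner_prod_def scaleC_prod_def cinner_add_left cinner_scaleC_left
        distrib_left)
  show "cinner y x = cnj (cinner x y)"
    unfolding cinner_prod_def complex_cnj_add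
    using cinner_commute[of "fst y" "fst x"] cinner_commute[of "snd y" "snd x"] by simp
  show "Re (cinner x y) = inner x y"
    by (simp add: cinner_prod_def Re_cinner inner_prod_def)
qed

end

definition finite_dim :: "'a::sep_chilbert set \<Rightarrow> bool" where
  "finite_dim S \<longleftrightarrow> (\<exists>B. finite B \<and> S \<subseteq> cvec.span B)"

text \<open>For subspaces \<open>S \<subseteq> W\<close>; sums of sets are pointwise.\<close>

definition finite_codim_in :: "'a::sep_chilbert set \<Rightarrow> 'a set \<Rightarrow> bool" where
  "finite_codim_in W S \<longleftrightarrow> (\<exists>B. finite B \<and> B \<subseteq> W \<and> W = S + cvec.span B)"

definition orth_comp :: "'a::sep_chilbert set \<Rightarrow> 'a set" where
  "orth_comp S = {x. \<forall>y\<in>S. cinner x y = 0}"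

text \<open>The orthogonal projection onto a closed complex subspace.\<close>

definition Proj :: "'a::sep_chilbert set \<Rightarrow> 'a \<Rightarrow>\<^sub>L 'a" where
  "Proj S = Blinfun (\<lambda>x. THE y. y \<in> S \<and> x - y \<in> orth_comp S)"

definition continuous_family :: "'x topology \<Rightarrow> ('x \<Rightarrow> 'a::sep_chilbert set) \<Rightarrow> bool" where
  "continuous_family X S \<longleftrightarrow>
     (\<forall>x\<in>topspace X. cvec.subspace (S x) \<and> closed (S x)) \<and>
     continuous_map X euclidean (\<lambda>x. Proj (S x))"

section \<open>Unitary and Fredholm operators\<close>

text \<open>
  The type of bounded operators consists of the real-linear ones, with the operator norm;
  complex linearity is therefore demanded explicitly.
\<close>

definition unitary_op :: "('a::sep_chilbert \<Rightarrow>\<^sub>L 'b::sep_chilbert) \<Rightarrow> bool" where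
  "unitary_op u \<longleftrightarrow> Vector_Spaces.linear scaleC scaleC (blinfun_apply u) \<and>
     (\<forall>x y. cinner (u x) (u y) = cinner x y) \<and> surj (blinfun_apply u)"

definition skew_adjoint_op :: "('a::sep_chilbert \<Rightarrow>\<^sub>L 'a) \<Rightarrow> bool" where
  "skew_adjoint_op A \<longleftrightarrow> Vector_Spaces.linear scaleC scaleC (blinfun_apply A) \<and>
     (\<forall>x y. cinner (A x) y = - cinner x (A y))"

definition fredholm_op :: "('a::sep_chilbert \<Rightarrow>\<^sub>L 'b::sep_chilbert) \<Rightarrow> bool" where
  "fredholm_op A \<longleftrightarrow> Vector_Spaces.linear scaleC scaleC (blinfun_apply A) \<and>
     finite_dim {x. A x = 0} \<and> closed (range (blinfun_apply A)) \<and>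
     finite_codim_in UNIV (range (blinfun_apply A))"

definition U_F :: "('k::sep_chilbert \<Rightarrow>\<^sub>L 'k) set" where
  "U_F = {u. unitary_op u \<and> fredholm_op (u + id_blinfun)}"

section \<open>The set $K^1(X)$ and the index of a family of unitaries\<close>

definition homotopy_rel :: "'x topology \<Rightarrow> (('x \<Rightarrow> 'k::sep_chilbert \<Rightarrow>\<^sub>L 'k) \<times> ('x \<Rightarrow> 'k \<Rightarrow>\<^sub>L 'k)) set" where
  "homotopy_rel X = {(f, g). homotopic_with (\<lambda>_. True) X (top_of_set U_F) f g}"

text \<open>
  $K^1(X) = [X, \mathcal{U}_F(H)]$, where \<open>'k\<close> is the (infinite-dimensional) Hilbert space $H$.
\<close>

definition K1 :: "'x topology \<Rightarrow> ('x \<Rightarrow> 'k::sep_chilbert \<Rightarrow>\<^sub>L 'k) set set" where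
  "K1 X = {f. continuous_map X (top_of_set U_F) f} // homotopy_rel X"

text \<open>
  Norm continuous families of unitaries $T_x : W_x \oplus H' \to H$.  Since the domain depends on
  $x$, each $T_x$ is extended by zero to the orthogonal complement of $W_x \oplus H'$, and continuity
  refers to this extension.
\<close>

definition trivialization ::
  "'x topology \<Rightarrow> ('x \<Rightarrow> 'a::sep_chilbert set) \<Rightarrow>
   ('x \<Rightarrow> ('a \<times> 'h::sep_chilbert) \<Rightarrow>\<^sub>L 'k::sep_chilbert) \<Rightarrow> bool" where
  "trivialization X W T \<longleftrightarrow>
     continuous_map X euclidean T \<and>
     (\<forall>x\<in>topspace X.
        Vector_Spaces.linear scaleC scaleC (blinfun_apply (T x)) \<and>
        (\<forall>v \<in> W x \<times> UNIV. \<forall>w \<in> W x \<times> UNIV. cinner (T x v) (T x w) = cinner v w) \<and>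
        T x ` (W x \<times> UNIV) = UNIV \<and>
        (\<forall>v \<in> orth_comp (W x \<times> UNIV). T x v = 0))"

text \<open>$T (f \oplus 1) T^{-1}$ for a map $f : W \to W$ and $T : W \oplus H' \to H$.\<close>

definition stabilize ::
  "(('a::sep_chilbert \<times> 'h::sep_chilbert) \<Rightarrow>\<^sub>L 'k::sep_chilbert) \<Rightarrow> 'a set \<Rightarrow> ('a \<Rightarrow> 'a) \<Rightarrow> 'k \<Rightarrow>\<^sub>L 'k" where
  "stabilize T W f =
     Blinfun (\<lambda>k. T (map_prod f id (inv_into (W \<times> UNIV) (blinfun_apply T) k)))"

text \<open>
  The index of a family of unitaries $f_x$ of $W_x$; the space $H'$ is the type \<open>'h\<close>.
  The class does not depend on the trivialization, so it does not matter which one is chosen.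
\<close>

definition K1_index ::
  "'h::sep_chilbert itself \<Rightarrow> 'x topology \<Rightarrow> ('x \<Rightarrow> 'a::sep_chilbert set) \<Rightarrow> ('x \<Rightarrow> 'a \<Rightarrow> 'a) \<Rightarrow>
   ('x \<Rightarrow> 'k::sep_chilbert \<Rightarrow>\<^sub>L 'k) set" where
  "K1_index H' X W f =
     (SOME c. \<exists>T :: 'x \<Rightarrow> ('a \<times> 'h) \<Rightarrow>\<^sub>L 'k.
        trivialization X W T \<and> c = homotopy_rel X `` {\<lambda>x. stabilize (T x) (W x) (f x)})"

section \<open>Lagrangian subspaces and the index of Lagrangian pairs\<close>

definition symp :: "('a::sep_chilbert \<Rightarrow>\<^sub>L 'a) \<Rightarrow> 'a \<Rightarrow> 'a \<Rightarrow> complex" where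
  "symp J \<xi> \<eta> = cinner (J \<xi>) \<eta>"

text \<open>
  The following notions are relative to a closed \<open>J\<close>-invariant subspace \<open>\<Lambda>\<close> with the restricted form;
  the whole space is the case \<open>\<Lambda> = UNIV\<close>.
\<close>

definition annihilator :: "('a::sep_chilbert \<Rightarrow>\<^sub>L 'a) \<Rightarrow> 'a set \<Rightarrow> 'a set \<Rightarrow> 'a set" where
  "annihilator J \<Lambda> L = {\<xi>\<in>\<Lambda>. \<forall>\<eta>\<in>L. symp J \<xi> \<eta> = 0}"

definition isotropic :: "('a::sep_chilbert \<Rightarrow>\<^sub>L 'a) \<Rightarrow> 'a set \<Rightarrow> 'a set \<Rightarrow> bool" where
  "isotropic J \<Lambda> L \<longleftrightarrow> cvec.subspace L \<and> L \<subseteq> annihilator J \<Lambda> L"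

definition lagrangian :: "('a::sep_chilbert \<Rightarrow>\<^sub>L 'a) \<Rightarrow> 'a set \<Rightarrow> 'a set \<Rightarrow> bool" where
  "lagrangian J \<Lambda> L \<longleftrightarrow> cvec.subspace L \<and> L = annihilator J \<Lambda> L"

definition fredholm_pair :: "'a::sep_chilbert set \<Rightarrow> 'a set \<Rightarrow> 'a set \<Rightarrow> bool" where
  "fredholm_pair \<Lambda> L M \<longleftrightarrow>
     closed (L + M) \<and> finite_dim (L \<inter> M) \<and> finite_codim_in \<Lambda> (L + M)"

definition pos_part :: "('a::sep_chilbert \<Rightarrow>\<^sub>L 'a) \<Rightarrow> 'a set \<Rightarrow> 'a set" where
  "pos_part J \<Lambda> = {\<xi>\<in>\<Lambda>. J \<xi> = \<i> *\<^sub>C \<xi>}"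

definition neg_part :: "('a::sep_chilbert \<Rightarrow>\<^sub>L 'a) \<Rightarrow> 'a set \<Rightarrow> 'a set" where
  "neg_part J \<Lambda> = {\<xi>\<in>\<Lambda>. J \<xi> = (- \<i>) *\<^sub>C \<xi>}"

text \<open>The unitary $u_L : \Lambda^+ \to \Lambda^-$ with graph $L = \{\xi + u_L\xi\}$.\<close>

definition graph_unitary :: "('a::sep_chilbert \<Rightarrow>\<^sub>L 'a) \<Rightarrow> 'a set \<Rightarrow> 'a set \<Rightarrow> 'a \<Rightarrow> 'a" where
  "graph_unitary J \<Lambda> L \<xi> = (THE \<eta>. \<eta> \<in> neg_part J \<Lambda> \<and> \<xi> + \<eta> \<in> L)"

text \<open>The index in $\Lambda_x$ of a family of Fredholm Lagrangian pairs $(L_x, M_x)$.\<close>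

definition lagr_index ::
  "'h::sep_chilbert itself \<Rightarrow> 'x topology \<Rightarrow> ('a::sep_chilbert \<Rightarrow>\<^sub>L 'a) \<Rightarrow> ('x \<Rightarrow> 'a set) \<Rightarrow>
   ('x \<Rightarrow> 'a set) \<Rightarrow> ('x \<Rightarrow> 'a set) \<Rightarrow> ('x \<Rightarrow> 'k::sep_chilbert \<Rightarrow>\<^sub>L 'k) set" where
  "lagr_index H' X J \<Lambda> L M =
     K1_index H' X (\<lambda>x. pos_part J (\<Lambda> x))
       (\<lambda>x \<xi>. - inv_into (pos_part J (\<Lambda> x)) (graph_unitary J (\<Lambda> x) (M x))
                 (graph_unitary J (\<Lambda> x) (L x) \<xi>))"

section \<open>Symplectic reduction\<close>

definition transversal_to :: "('a::sep_chilbert \<Rightarrow>\<^sub>L 'a) \<Rightarrow> 'a set \<Rightarrow> 'a set \<Rightarrow> bool" where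
  "transversal_to J \<Gamma> M \<longleftrightarrow>
     closed (M + \<Gamma>) \<and> M \<inter> \<Gamma> = {0} \<and> M + annihilator J UNIV \<Gamma> = UNIV"

text \<open>
  $\mathcal{V} = \Gamma^*/\Gamma$ is identified with $\Gamma^* \ominus \Gamma$: each coset is represented by its
  unique element orthogonal to $\Gamma$.  The induced symplectic form is then the restriction of
  \<open>symp J\<close>, and the quotient map sends $\xi$ to the representative of $\xi + \Gamma$.
\<close>

definition reduced_space :: "('a::sep_chilbert \<Rightarrow>\<^sub>L 'a) \<Rightarrow> 'a set \<Rightarrow> 'a set" where
  "reduced_space J \<Gamma> = annihilator J UNIV \<Gamma> \<inter> orth_comp \<Gamma>"

definition reduction_map :: "('a::sep_chilbert \<Rightarrow>\<^sub>L 'a) \<Rightarrow> 'a set \<Rightarrow> 'a \<Rightarrow> 'a" where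
  "reduction_map J \<Gamma> \<xi> = (THE v. v \<in> reduced_space J \<Gamma> \<and> \<xi> - v \<in> \<Gamma>)"

definition reduction_preimage :: "('a::sep_chilbert \<Rightarrow>\<^sub>L 'a) \<Rightarrow> 'a set \<Rightarrow> 'a set \<Rightarrow> 'a set" where
  "reduction_preimage J \<Gamma> L = {\<xi> \<in> annihilator J UNIV \<Gamma>. reduction_map J \<Gamma> \<xi> \<in> L}"

definition reduction_image :: "('a::sep_chilbert \<Rightarrow>\<^sub>L 'a) \<Rightarrow> 'a set \<Rightarrow> 'a set \<Rightarrow> 'a set" where
  "reduction_image J \<Gamma> M = reduction_map J \<Gamma> ` (M \<inter> annihilator J UNIV \<Gamma>)"

end

theory Submission
  imports Defs
begin

text \<open>
  Let \<open>F\<close> be the unitary of the pair $(\gamma^{-1}L, M)$ on $\hat H^+$ and let \<open>W\<close> be $\mathcal V^+$.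
  Transversality makes the compression of \<open>F + 1\<close> to the complement of \<open>W\<close> invertible, and the unitary
  \<open>G\<close> of $(L, \gamma_!M)$ is determined by the fact that \<open>G + 1\<close> is the Schur complement of \<open>F + 1\<close>.
  Scaling the off-diagonal part of the Schur factorization to zero connects \<open>F\<close> with $G \oplus 1$
  through unitaries whose sum with 1 is Fredholm.

  It remains to see that the class of $T (G \oplus 1) T^{-1}$ does not depend on how the isometries \<open>T\<close>
  vary with \<open>x\<close>.  A Cayley rescaling pushes the essential spectrum of a family close to 1, where the
  family is almost concentrated on finite-dimensional subspaces.  There an isometry \<open>R\<close> of infinite
  corank can be approximated strongly along a norm-continuous path of unitaries starting at 1, so that
  a family \<open>f\<close> is homotopic to $R f R^* + 1 - R R^*$.  The new room permits rotating any two families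
  of isometries into each other.
\<close>

section \<open>Riesz representation, adjoints and coercive operators\<close>

text \<open>Each of the two indices is formed with its own trivialization, picked by
  \<open>SOME\<close>, so the equality of the classes contains the assertion that this choice is
  immaterial, over an arbitrary space. The obstacle is that a non-surjective isometry is not a norm
  limit of unitaries: a path of unitaries can reach it only strongly, and conjugation along such a
  path converges in norm only on operators that are nearly 1 off a finite-dimensional subspace. A
  family in \<open>U_F\<close> need not be of this kind, hence the Cayley rescaling. Since the
  parameter space need not be compact, the amount of rescaling must be a continuous function of the
  operator; \<open>rad\<close> supplies it. The constant 1/2 in the scaled Schur factor comes from
  unitarity: twice the real part of \<open>r\<close> is 1 plus a positive operator, so the scaled
  block never falls below 1/2, and at t = 0 it is the inverse of 1 + 1. Fredholm properties are
  carried along as lower bounds on subspaces of finite codimension, so that norm estimates suffice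
  to propagate them.\<close>

lemma quadratic_nonneg_imp_zero:
  fixes a b :: real
  assumes "\<And>t. 0 \<le> 2 * t * a + t\<^sup>2 * b" "0 \<le> b"
  shows "a = 0"
proof (rule ccontr)
  assume "a \<noteq> 0"
  \<comment> \<open>The minimiser would be \<open>- a / b\<close>; the summand 1 keeps the
    denominator positive when \<open>b = 0\<close>.\<close>
  define t where "t = - a / (b + 1)"
  have "2 * t * a + t\<^sup>2 * b = a\<^sup>2 / (b + 1) * (b / (b + 1) - 2)"
  proof -
    have "b + 1 \<noteq> 0" using \<open>0 \<le> b\<close> by simp
    then show ?thesis unfolding t_def by (simp add: divide_simps power2_eq_square) algebra
  qed
  moreover have "b / (b + 1) - 2 < 0"
    using \<open>0 \<le> b\<close> by (simp add: field_simps)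
  moreover have "0 < a\<^sup>2 / (b + 1)"
    using \<open>0 \<le> b\<close> \<open>a \<noteq> 0\<close> by simp
  ultimately have "2 * t * a + t\<^sup>2 * b < 0"
    using mult_pos_neg by metis
  then show False using assms(1)[of t] by simp
qed

text \<open>Direct method: a minimising sequence of \<open>q\<close> on \<open>S\<close> is Cauchy,
  and the first variation at the minimiser is the claim. The version relative to a closed subspace
  serves for orthogonal projections (\<open>f\<close> an inner product) as well as for adjoints
  (\<open>S = UNIV\<close>).\<close>

lemma riesz_subspace:
  fixes S :: "'a::{real_inner,banach} set" and f :: "'a \<Rightarrow> real"
  assumes S: "subspace S" "closed S" and f: "bounded_linear f"
  shows "\<exists>y\<in>S. \<forall>z\<in>S. f z = y \<bullet> z"
proof -
  interpret f: bounded_linear f by fact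
  define q where "q x = x \<bullet> x - 2 * f x" for x
  obtain K where K: "\<And>x. \<bar>f x\<bar> \<le> norm x * K"
    using f.bounded by auto
  have low: "- (K\<^sup>2) \<le> q x" for x
  proof -
    have "0 \<le> (norm x - K)\<^sup>2" by simp
    then have "2 * (norm x * K) \<le> (norm x)\<^sup>2 + K\<^sup>2"
      by (simp add: power2_diff algebra_simps)
    then show ?thesis
      using K[of x] unfolding q_def power2_norm_eq_inner[symmetric] by linarith
  qed
  define m where "m = Inf (q ` S)"
  have bdd: "bdd_below (q ` S)" using low by (auto intro!: bdd_belowI2)
  have mle: "m \<le> q x" if "x \<in> S" for x
    unfolding m_def using that bdd by (auto intro: cInf_lower)
  have "\<exists>x\<in>S. q x < m + 1 / real (Suc n)" for n
  proof -
    have "q ` S \<noteq> {}" using subspace_0[OF S(1)] by blast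
    then have "\<exists>y\<in>q ` S. y < m + 1 / real (Suc n)"
      using cInf_lessD[of "q ` S" "m + 1 / real (Suc n)"] unfolding m_def by auto
    then show ?thesis by blast
  qed
  then obtain x where x: "\<And>n. x n \<in> S" "\<And>n. q (x n) < m + 1 / real (Suc n)" by metis
  \<comment> \<open>Parallelogram identity for \<open>q\<close>: the linear terms cancel, and the
    midpoint has value at least \<open>m\<close>.\<close>
  have par: "(norm (u - v))\<^sup>2 \<le> 2 * (q u - m) + 2 * (q v - m)" if "u \<in> S" "v \<in> S" for u v
  proof -
    have "(1/2) *\<^sub>R (u + v) \<in> S" using that S(1) by (simp add: subspace_add subspace_scale)
    then have "m \<le> q ((1/2) *\<^sub>R (u + v))" by (rule mle)
    moreover have "(norm (u - v))\<^sup>2 = 2 * q u + 2 * q v - 4 * q ((1/2) *\<^sub>R (u + v))"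
      unfolding q_def by (simp add: power2_norm_eq_inner f.add f.scaleR inner_add_left inner_add_right
          inner_diff_left inner_diff_right inner_commute field_simps)
    ultimately show ?thesis by argo
  qed
  have "Cauchy x"
  proof (rule metric_CauchyI)
    fix e :: real assume "0 < e"
    then obtain N where N: "4 / e\<^sup>2 < real N" using reals_Archimedean2 by blast
    have "dist (x i) (x j) < e" if "i \<ge> N" "j \<ge> N" for i j
    proof -
      have N4: "4 * (1 / real (Suc N)) < e\<^sup>2"
        using N \<open>0 < e\<close> by (simp add: field_simps) (smt (verit) zero_le_power2)
      have "1 / real (Suc i) \<le> 1 / real (Suc N)" "1 / real (Suc j) \<le> 1 / real (Suc N)"
        using that by (auto simp: frac_le)
      then have "(norm (x i - x j))\<^sup>2 < e\<^sup>2"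
        using par[OF x(1) x(1), of i j] x(2)[of i] x(2)[of j] N4 by argo
      then show ?thesis
        unfolding dist_norm using \<open>0 < e\<close> by (simp add: power2_less_imp_less)
    qed
    then show "\<exists>M. \<forall>m\<ge>M. \<forall>n\<ge>M. dist (x m) (x n) < e" by blast
  qed
  then obtain y where y: "x \<longlonglongrightarrow> y" using Cauchy_convergent convergentD by blast
  have yS: "y \<in> S" using closed_sequentially[OF S(2) x(1) y] .
  have "(\<lambda>n. q (x n)) \<longlonglongrightarrow> q y"
    unfolding q_def by (intro tendsto_intros y f.tendsto)
  moreover have "(\<lambda>n. m + 1 / real (Suc n)) \<longlonglongrightarrow> m + 0"
    by (intro tendsto_intros LIMSEQ_Suc lim_1_over_n)
  ultimately have "q y \<le> m + 0"
    by (rule LIMSEQ_le) (use x(2) less_imp_le in blast)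
  then have qy: "q y = m" using mle[OF yS] by simp
  have "f z = y \<bullet> z" if "z \<in> S" for z
  proof -
    have "0 \<le> 2 * t * (y \<bullet> z - f z) + t\<^sup>2 * (z \<bullet> z)" for t
    proof -
      have "y + t *\<^sub>R z \<in> S" using yS that S(1) by (simp add: subspace_add subspace_scale)
      then have "q y \<le> q (y + t *\<^sub>R z)" using mle qy by simp
      then show ?thesis unfolding q_def
        by (simp add: f.add f.scaleR inner_add_left inner_add_right inner_commute algebra_simps
            power2_eq_square)
    qed
    then have "y \<bullet> z - f z = 0" by (rule quadratic_nonneg_imp_zero) simp
    then show ?thesis by simp
  qed
  then show ?thesis using yS by blast
qed

lemma orthogonal_decomposition:
  fixes S :: "'a::{real_inner,banach} set"
  assumes "subspace S" "closed S"
  obtains y where "y \<in> S" "\<And>z. z \<in> S \<Longrightarrow> (x - y) \<bullet> z = 0"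
  using riesz_subspace[OF assms bounded_linear_inner_right[of x]] that
  by (auto simp: inner_diff_left)

lemma closed_subspace_eq_UNIV:
  fixes S :: "'a::{real_inner,banach} set"
  assumes S: "subspace S" "closed S" and "\<And>x. (\<And>z. z \<in> S \<Longrightarrow> x \<bullet> z = 0) \<Longrightarrow> x = 0"
  shows "S = UNIV"
  by (metis S assms(3) eq_iff_diff_eq_0 orthogonal_decomposition UNIV_eq_I)

text \<open>The adjoint for the real inner product. For complex-linear operators it is also the
  complex adjoint (\<open>cinner_adj\<close>), so most of the operator theory can be done over the
  reals.\<close>

definition adj :: "('a::{real_inner,banach} \<Rightarrow>\<^sub>L 'b::{real_inner,banach}) \<Rightarrow> 'b \<Rightarrow>\<^sub>L 'a" where
  "adj A = Blinfun (\<lambda>y. SOME z. \<forall>x. A x \<bullet> y = x \<bullet> z)"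

lemma inner_ext:
  fixes u v :: "'a::real_inner"
  assumes "\<And>x. x \<bullet> u = x \<bullet> v"
  shows "u = v"
  using assms[of "u - v"] by (metis eq_iff_diff_eq_0 inner_diff_right inner_eq_zero_iff)

lemma adj_right:
  fixes A :: "'a::{real_inner,banach} \<Rightarrow>\<^sub>L 'b::{real_inner,banach}"
  shows "A x \<bullet> y = x \<bullet> adj A y"
proof -
  define g where "g y = (SOME z. \<forall>x. A x \<bullet> y = x \<bullet> z)" for y
  have ex: "\<exists>z. \<forall>x. A x \<bullet> y = x \<bullet> z" for y
  proof -
    have "bounded_linear (\<lambda>x. A x \<bullet> y)"
      by (intro bounded_linear_intros)
    then obtain z where "\<forall>x\<in>UNIV. A x \<bullet> y = z \<bullet> x"
      using riesz_subspace[OF subspace_UNIV closed_UNIV] by blast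
    then show ?thesis by (auto simp: inner_commute)
  qed
  then have g: "A x \<bullet> y = x \<bullet> g y" for x y
    using someI_ex[OF ex] unfolding g_def by blast
  have "bounded_linear g"
  proof (rule bounded_linear_intro[where K = "norm A"])
    show "g (y + z) = g y + g z" for y z
      by (rule inner_ext) (metis g inner_add_right)
    show "g (r *\<^sub>R y) = r *\<^sub>R g y" for r y
      by (rule inner_ext) (metis g inner_scaleR_right)
    show "norm (g y) \<le> norm y * norm A" for y
    proof -
      have "(norm (g y))\<^sup>2 = A (g y) \<bullet> y" by (simp add: g power2_norm_eq_inner)
      also have "\<dots> \<le> norm (A (g y)) * norm y" by (rule norm_cauchy_schwarz)
      also have "\<dots> \<le> (norm A * norm (g y)) * norm y" by (intro mult_right_mono norm_blinfun) simp
      finally have "norm (g y) * norm (g y) \<le> norm (g y) * (norm y * norm A)"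
        by (simp add: power2_eq_square mult_ac)
      then show ?thesis
        by (cases "norm (g y) = 0") (simp_all add: mult_le_cancel_left)
    qed
  qed
  then have "adj A y = g y"
    unfolding adj_def g_def by (simp add: bounded_linear_Blinfun_apply)
  then show ?thesis using g by simp
qed

lemma adj_left:
  fixes A :: "'a::{real_inner,banach} \<Rightarrow>\<^sub>L 'b::{real_inner,banach}"
  shows "adj A y \<bullet> x = y \<bullet> A x"
  by (metis adj_right inner_commute)

lemma adj_eqI:
  fixes A :: "'a::{real_inner,banach} \<Rightarrow>\<^sub>L 'b::{real_inner,banach}"
  assumes "\<And>x y. A x \<bullet> y = x \<bullet> blinfun_apply B y"
  shows "adj A = B"
  by (rule blinfun_eqI, rule inner_ext) (metis adj_right assms)

lemma adj_adj [simp]: "adj (adj A) = A"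
  by (rule adj_eqI) (rule adj_left)

lemma adj_compose: "adj (A o\<^sub>L B) = adj B o\<^sub>L adj A"
  by (rule adj_eqI) (simp add: adj_right)

lemma adj_id [simp]: "adj id_blinfun = id_blinfun"
  by (rule adj_eqI) simp

lemma norm_adj_le: "norm (adj A) \<le> norm A"
proof (rule norm_blinfun_bound)
  fix y
  have "(norm (adj A y))\<^sup>2 = A (adj A y) \<bullet> y" by (simp add: adj_right power2_norm_eq_inner)
  also have "\<dots> \<le> norm (A (adj A y)) * norm y" by (rule norm_cauchy_schwarz)
  also have "\<dots> \<le> (norm A * norm (adj A y)) * norm y" by (intro mult_right_mono norm_blinfun) simp
  finally have "norm (adj A y) * norm (adj A y) \<le> norm (adj A y) * (norm A * norm y)"
    by (simp add: power2_eq_square mult_ac)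
  then show "norm (adj A y) \<le> norm A * norm y"
    by (cases "norm (adj A y) = 0") (simp_all add: mult_le_cancel_left)
qed simp

lemma bounded_linear_adj: "bounded_linear adj"
proof (rule bounded_linear_intro[where K = 1])
  show "adj (A + B) = adj A + adj B" for A B :: "'a \<Rightarrow>\<^sub>L 'b"
    by (rule adj_eqI) (simp add: plus_blinfun.rep_eq inner_add_left inner_add_right adj_right)
  show "adj (r *\<^sub>R A) = r *\<^sub>R adj A" for r and A :: "'a \<Rightarrow>\<^sub>L 'b"
    by (rule adj_eqI) (simp add: scaleR_blinfun.rep_eq adj_right)
qed (simp add: norm_adj_le)

lemmas tendsto_adj = bounded_linear.tendsto[OF bounded_linear_adj]

lemma norm_add_orthogonal:
  fixes x y :: "'a::real_inner"
  assumes "x \<bullet> y = 0"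
  shows "(norm (x + y))\<^sup>2 = (norm x)\<^sup>2 + (norm y)\<^sup>2"
  using assms by (simp add: power2_norm_eq_inner inner_add_left inner_add_right inner_commute)

lemma polarization_isometry:
  fixes A :: "'a::{real_inner,banach} \<Rightarrow>\<^sub>L 'b::{real_inner,banach}"
  assumes "\<And>x. norm (blinfun_apply A x) = norm x"
  shows "A x \<bullet> A y = x \<bullet> y"
proof -
  have "(norm (A (x + y)))\<^sup>2 = (norm (x + y))\<^sup>2" by (simp add: assms)
  then show ?thesis
    using assms[of x] assms[of y]
    by (simp only: power2_norm_eq_inner blinfun.add_right inner_add_left inner_add_right)
       (simp add: inner_commute norm_eq_sqrt_inner)
qed

lemma adj_isometry [simp]:
  fixes A :: "'a::{real_inner,banach} \<Rightarrow>\<^sub>L 'b::{real_inner,banach}"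
  assumes "\<And>x. norm (blinfun_apply A x) = norm x"
  shows "adj A (A x) = x"
  by (rule inner_ext) (simp add: adj_right[symmetric] polarization_isometry[OF assms])

lemma norm_adj_isometry_le:
  fixes A :: "'a::{real_inner,banach} \<Rightarrow>\<^sub>L 'b::{real_inner,banach}"
  assumes "\<And>x. norm (blinfun_apply A x) = norm x"
  shows "norm (adj A y) \<le> norm y"
proof -
  have "norm A \<le> 1" by (rule norm_blinfun_bound) (simp_all add: assms)
  then have "norm (adj A) \<le> 1" using norm_adj_le[of A] by linarith
  then show ?thesis
    using norm_blinfun[of "adj A" y] mult_right_mono[of "norm (adj A)" 1 "norm y"] by simp
qed

lemma adj_unitary:
  fixes A :: "'a::{real_inner,banach} \<Rightarrow>\<^sub>L 'b::{real_inner,banach}"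
  assumes "\<And>x. norm (blinfun_apply A x) = norm x" "surj (blinfun_apply A)"
  shows "A (adj A y) = y" "norm (adj A y) = norm y" "surj (blinfun_apply (adj A))"
proof -
  show 1: "A (adj A y) = y" for y
    by (metis adj_isometry[OF assms(1)] assms(2) surjD)
  show "norm (adj A y) = norm y" by (metis 1 assms(1))
  show "surj (blinfun_apply (adj A))" by (metis adj_isometry[OF assms(1)] surjI)
qed

section \<open>Operators with positive real part and their inverses\<close>

definition coercive :: "real \<Rightarrow> ('a::{real_inner,banach} \<Rightarrow>\<^sub>L 'a) \<Rightarrow> bool" where
  "coercive d A \<longleftrightarrow> (\<forall>x. d * (norm x)\<^sup>2 \<le> A x \<bullet> x)"

lemma coercive_bounded_below:
  fixes A :: "'a::{real_inner,banach} \<Rightarrow>\<^sub>L 'a"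
  assumes "coercive d A"
  shows "d * norm x \<le> norm (A x)"
proof (cases "x = 0")
  case False
  have "d * (norm x)\<^sup>2 \<le> norm (A x) * norm x"
    using assms norm_cauchy_schwarz[of "A x" x] unfolding coercive_def by (meson order_trans)
  then show ?thesis using False by (simp add: power2_eq_square mult.assoc[symmetric])
qed simp

lemma closed_image_bounded_below:
  fixes A :: "'a::{real_normed_vector,banach} \<Rightarrow>\<^sub>L 'b::banach"
  assumes "subspace S" "closed S" "0 < e" "\<And>x. x \<in> S \<Longrightarrow> e * norm x \<le> norm (A x)"
  shows "closed (blinfun_apply A ` S)"
  using complete_isometric_image[OF assms(3,1) blinfun.bounded_linear_right[of A]] assms(2,4)
  by (simp add: complete_eq_closed)

text \<open>Lax-Milgram: the range is closed, and a vector orthogonal to it is orthogonal to its own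
  image, hence zero by coercivity. Only the real part of the quadratic form enters, so operators
  that are not self-adjoint are covered.\<close>

lemma coercive_surj:
  assumes "coercive d A" "0 < d"
  shows "surj (blinfun_apply A)"
proof (rule closed_subspace_eq_UNIV)
  show "subspace (range (blinfun_apply A))"
    by (intro linear_subspace_image subspace_UNIV bounded_linear.linear blinfun.bounded_linear_right)
  show "closed (range (blinfun_apply A))"
    by (rule closed_image_bounded_below[OF subspace_UNIV closed_UNIV \<open>0 < d\<close>])
       (rule coercive_bounded_below[OF assms(1)])
  fix x assume orth: "\<And>z. z \<in> range (blinfun_apply A) \<Longrightarrow> x \<bullet> z = 0"
  have "A x \<bullet> x = 0" using orth[OF rangeI, of x] by (simp add: inner_commute)
  then have "d * (norm x)\<^sup>2 \<le> 0" using assms(1)[unfolded coercive_def, rule_format, of x] by simp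
  then show "x = 0" using \<open>0 < d\<close> by (simp add: mult_le_0_iff)
qed

definition binv :: "('a::{real_inner,banach} \<Rightarrow>\<^sub>L 'a) \<Rightarrow> 'a \<Rightarrow>\<^sub>L 'a" where
  "binv A = Blinfun (inv (blinfun_apply A))"

lemma binv_coercive:
  fixes A :: "'a::{real_inner,banach} \<Rightarrow>\<^sub>L 'a"
  assumes A: "coercive d A" and d: "0 < d"
  shows "A (binv A x) = x" "binv A (A x) = x" "d * norm (binv A x) \<le> norm x"
proof -
  have surj: "surj (blinfun_apply A)" using coercive_surj[OF assms] .
  have inj: "inj (blinfun_apply A)"
  proof (rule injI)
    fix x y assume "A x = A y"
    then have "A (x - y) = 0" by (simp add: blinfun.diff_right)
    then have "d * norm (x - y) \<le> 0" using coercive_bounded_below[OF A, of "x - y"] by simp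
    then show "x = y" using d by (simp add: mult_le_0_iff)
  qed
  define g where "g = inv (blinfun_apply A)"
  have g1: "A (g x) = x" for x unfolding g_def by (rule surj_f_inv_f[OF surj])
  have g2: "g (A x) = x" for x unfolding g_def by (rule inv_f_f[OF inj])
  have g3: "d * norm (g x) \<le> norm x" for x using coercive_bounded_below[OF A, of "g x"] g1 by simp
  have "bounded_linear g"
  proof (rule bounded_linear_intro[where K = "1 / d"])
    show "g (x + y) = g x + g y" for x y by (metis blinfun.add_right g1 g2)
    show "g (r *\<^sub>R x) = r *\<^sub>R g x" for r x by (metis blinfun.scaleR_right g1 g2)
    show "norm (g x) \<le> norm x * (1 / d)" for x using g3[of x] d by (simp add: field_simps)
  qed
  then have "blinfun_apply (binv A) = g" unfolding binv_def g_def by (rule bounded_linear_Blinfun_apply)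
  then show "A (binv A x) = x" "binv A (A x) = x" "d * norm (binv A x) \<le> norm x"
    using g1 g2 g3 by auto
qed

lemma tendsto_binv:
  fixes A :: "'x \<Rightarrow> 'a::{real_inner,banach} \<Rightarrow>\<^sub>L 'a"
  assumes lim: "(A \<longlongrightarrow> A0) F" and A0: "coercive d A0" "0 < d"
  shows "((\<lambda>x. binv (A x)) \<longlongrightarrow> binv A0) F"
proof (rule tendstoI)
  fix e :: real assume "0 < e"
  \<comment> \<open>The bound \<open>d / 2\<close> leaves nearby operators coercive with half the
    constant. The difference of the inverses is then at most 2 h / d^2, and the second bound makes
    this at most \<open>e / 2\<close>.\<close>
  define h where "h = min (d / 2) (e * d\<^sup>2 / 4)"
  have "0 < h" using \<open>0 < e\<close> \<open>0 < d\<close> unfolding h_def by simp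
  have "eventually (\<lambda>x. dist (A x) A0 < h) F" using tendstoD[OF lim \<open>0 < h\<close>] .
  then show "eventually (\<lambda>x. dist (binv (A x)) (binv A0) < e) F"
  proof (rule eventually_mono)
    fix x assume "dist (A x) A0 < h"
    then have n: "norm (A x - A0) < h" by (simp add: dist_norm)
    have c: "coercive (d / 2) (A x)"
      unfolding coercive_def
    proof
      fix y
      have "\<bar>(A x - A0) y \<bullet> y\<bar> \<le> norm ((A x - A0) y) * norm y" by (rule Cauchy_Schwarz_ineq2)
      also have "\<dots> \<le> (norm (A x - A0) * norm y) * norm y" by (intro mult_right_mono norm_blinfun) simp
      also have "\<dots> = norm (A x - A0) * (norm y)\<^sup>2" by (simp add: power2_eq_square)
      also have "\<dots> \<le> (d / 2) * (norm y)\<^sup>2"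
        using n unfolding h_def by (intro mult_right_mono) auto
      finally have "\<bar>A x y \<bullet> y - A0 y \<bullet> y\<bar> \<le> (d / 2) * (norm y)\<^sup>2"
        by (simp add: minus_blinfun.rep_eq inner_diff_left)
      moreover have "d * (norm y)\<^sup>2 \<le> A0 y \<bullet> y" using A0 unfolding coercive_def by blast
      moreover have "d / 2 * (norm y)\<^sup>2 = d * (norm y)\<^sup>2 / 2" by simp
      ultimately show "d / 2 * (norm y)\<^sup>2 \<le> A x y \<bullet> y" by linarith
    qed
    have d2: "0 < d / 2" using \<open>0 < d\<close> by simp
    have "norm (binv (A x) - binv A0) \<le> (2 / d\<^sup>2) * h"
    proof (rule norm_blinfun_bound)
      show "0 \<le> 2 / d\<^sup>2 * h" using \<open>0 < h\<close> by simp
      fix y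
      define u v where "u = binv (A x) y" and "v = binv A0 y"
      have "A x (u - v) = - ((A x - A0) v)"
        unfolding u_def v_def using binv_coercive(1)[OF c d2] binv_coercive(1)[OF A0]
        by (simp add: blinfun.diff_right minus_blinfun.rep_eq)
      then have "(d / 2) * norm (u - v) \<le> norm ((A x - A0) v)"
        using coercive_bounded_below[OF c, of "u - v"] by simp
      also have "\<dots> \<le> h * norm v"
        using norm_blinfun[of "A x - A0" v] n by (meson less_imp_le mult_right_mono norm_ge_zero order_trans)
      also have "\<dots> \<le> h * (norm y / d)"
        using binv_coercive(3)[OF A0, of y] \<open>0 < d\<close> \<open>0 < h\<close> unfolding v_def
        by (intro mult_left_mono) (auto simp: field_simps)
      finally show "norm ((binv (A x) - binv A0) y) \<le> 2 / d\<^sup>2 * h * norm y"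
        using \<open>0 < d\<close> by (simp add: u_def v_def minus_blinfun.rep_eq field_simps power2_eq_square)
    qed
    also have "\<dots> \<le> (2 / d\<^sup>2) * (e * d\<^sup>2 / 4)"
      using \<open>0 < d\<close> unfolding h_def by (intro mult_left_mono) auto
    also have "\<dots> < e" using \<open>0 < d\<close> \<open>0 < e\<close> by simp
    finally show "dist (binv (A x)) (binv A0) < e" by (simp add: dist_norm)
  qed
qed

text \<open>Uniform boundedness by a gliding hump. If the norms in \<open>U\<close> grow faster than
  2 (n + 1) 3^n, a series of steps of length 3^-n along normalised elements \<open>r n\<close>
  converges to a point of \<open>R\<close> that pairs with \<open>r n\<close> to at least half of
  3^-n times its norm: the tail after step n has norm at most 3^-n / 2.\<close>

lemma weakly_bounded_imp_bounded:
  fixes R :: "'a::{real_inner,banach} set"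
  assumes R: "subspace R" "closed R" and U: "U \<subseteq> R"
    and w: "\<And>x. x \<in> R \<Longrightarrow> \<exists>c. \<forall>r\<in>U. \<bar>r \<bullet> x\<bar> \<le> c"
  shows "bounded U"
proof (rule ccontr)
  assume nb: "\<not> bounded U"
  have "\<exists>r\<in>U. 2 * 3 ^ n * (real n + 1) < norm r" for n :: nat
    using nb unfolding bounded_iff by (meson not_le)
  then obtain r where r: "\<And>n. r n \<in> U" "\<And>n. 2 * 3 ^ n * (real n + 1) < norm (r n)" by metis
  have rpos: "0 < norm (r n)" for n
  proof -
    have "(0::real) < 2 * 3 ^ n * (real n + 1)" by simp
    then show ?thesis using r(2)[of n] by linarith
  qed
  \<comment> \<open>The sign is chosen so that the new step does not cancel the pairing of
    \<open>r n\<close> with the sum reached so far.\<close>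
  define d where "d n s = (if r n \<bullet> s \<ge> 0 then 1 else - 1 :: real) *\<^sub>R (((1/3) ^ n / norm (r n)) *\<^sub>R r n)" for n s
  define s where "s = rec_nat 0 (\<lambda>n t. t + d n t)"
  have s0: "s 0 = 0" and sS: "s (Suc n) = s n + d n (s n)" for n unfolding s_def by simp_all
  define e where "e n = d n (s n)" for n
  have ne: "norm (e n) = (1/3) ^ n" for n
    unfolding e_def d_def using rpos[of n] by simp
  have sum_e: "(\<Sum>k<n. e k) = s n" for n
    by (induction n) (simp_all add: s0 sS e_def)
  have sm: "summable (\<lambda>n. (1/3::real) ^ n)" by (simp add: summable_geometric)
  have se: "summable e" by (rule summable_norm_cancel) (simp add: ne sm)
  define x where "x = suminf e"
  have eR: "e n \<in> R" for n
    unfolding e_def d_def using r(1)[of n] U by (intro subspace_scale[OF R(1)]) blast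
  have sR: "s n \<in> R" for n
    unfolding sum_e[symmetric] by (intro subspace_sum R eR)
  have "s \<longlonglongrightarrow> x" using summable_LIMSEQ[OF se] unfolding x_def sum_e .
  then have "x \<in> R" using closed_sequentially[OF R(2), of s x] sR by blast
  then obtain c where c: "\<And>r. r \<in> U \<Longrightarrow> \<bar>r \<bullet> x\<bar> \<le> c" using w by blast
  have le_c: "real n + 1 \<le> c" for n
  proof -
    have "x = (\<Sum>k. e (k + Suc n)) + s (Suc n)"
      unfolding x_def using suminf_split_initial_segment[OF se, of "Suc n"] sum_e[of "Suc n"] by simp
    then have "norm (x - s (Suc n)) = norm (\<Sum>k. e (k + Suc n))" by simp
    also have "\<dots> \<le> (\<Sum>k. norm (e (k + Suc n)))"
      by (intro summable_norm) (simp add: ne summable_ignore_initial_segment sm del: add_Suc_right power_Suc)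
    also have "\<dots> = (\<Sum>k. (1/3) ^ Suc n * (1/3) ^ k)"
      by (simp add: ne power_add mult_ac)
    also have "\<dots> = (1/3) ^ Suc n * (3/2)"
      by (subst suminf_mult[OF sm]) (simp add: suminf_geometric)
    finally have tail: "norm (x - s (Suc n)) \<le> (1/2) * (1/3) ^ n" by simp
    have "\<bar>r n \<bullet> s (Suc n)\<bar> \<ge> (1/3) ^ n * norm (r n)"
    proof -
      define p where "p = (1/3) ^ n * norm (r n)"
      have "r n \<bullet> d n (s n) = (if r n \<bullet> s n \<ge> 0 then 1 else - 1) * p"
        unfolding d_def p_def using rpos[of n] by (simp add: power2_norm_eq_inner[symmetric] power2_eq_square)
      moreover have "0 \<le> p" unfolding p_def by simp
      ultimately show ?thesis unfolding sS inner_add_right p_def[symmetric]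
        by (auto simp: abs_if split: if_splits)
    qed
    moreover have "\<bar>r n \<bullet> (x - s (Suc n))\<bar> \<le> norm (r n) * ((1/2) * (1/3) ^ n)"
      using Cauchy_Schwarz_ineq2[of "r n" "x - s (Suc n)"] tail
      by (meson mult_left_mono norm_ge_zero order_trans)
    moreover have "norm (r n) * ((1/2) * (1/3) ^ n) = (1/2) * ((1/3) ^ n * norm (r n))" by simp
    ultimately have "(1/2) * ((1/3) ^ n * norm (r n)) \<le> \<bar>r n \<bullet> x\<bar>"
      unfolding inner_diff_right by argo
    also have "\<dots> \<le> c" using c r(1) by blast
    finally have "norm (r n) \<le> 2 * 3 ^ n * c" by (simp add: field_simps power_one_over)
    then have "2 * 3 ^ n * (real n + 1) < 2 * 3 ^ n * c" using r(2)[of n] by linarith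
    then show ?thesis using mult_less_cancel_left_pos[of "2 * 3 ^ n" "real n + 1" c] by simp
  qed
  obtain n where "c < real n" using reals_Archimedean2 by blast
  with le_c[of n] show False by linarith
qed

text \<open>The quantitative form of the closed range theorem, by duality: the compressed adjoint is
  bounded below on the range of \<open>A\<close>, so its own image is closed, and that image turns
  out to contain every vector of \<open>S\<close> orthogonal to the kernel. Pairing such a vector
  with itself returns the bound to \<open>A\<close>.\<close>

lemma closed_range_bounded_below:
  fixes A :: "'a::{real_inner,banach} \<Rightarrow>\<^sub>L 'b::{real_inner,banach}"
  assumes S: "subspace S" "closed S" and cl: "closed (blinfun_apply A ` S)"
  shows "\<exists>c>0. \<forall>v\<in>S. (\<forall>z\<in>S. A z = 0 \<longrightarrow> v \<bullet> z = 0) \<longrightarrow> c * norm v \<le> norm (A v)"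
proof -
  define R where "R = blinfun_apply A ` S"
  have R: "subspace R" "closed R"
    using cl S unfolding R_def
    by (auto intro!: linear_subspace_image bounded_linear.linear blinfun.bounded_linear_right)
  text \<open>The compression \<open>B\<close> of the adjoint to \<open>R \<rightarrow> S\<close> is bounded below by uniform boundedness.\<close>
  have "\<exists>y\<in>S. \<forall>z\<in>S. r \<bullet> A z = y \<bullet> z" for r
  proof -
    have "bounded_linear (\<lambda>z. r \<bullet> A z)" by (intro bounded_linear_intros)
    from riesz_subspace[OF S this] show ?thesis by auto
  qed
  then obtain B where BS: "\<And>r. B r \<in> S" and B: "\<And>r z. z \<in> S \<Longrightarrow> r \<bullet> A z = B r \<bullet> z"
    by metis
  have Bdiff: "u = v" if "u \<in> S" "v \<in> S" "\<And>z. z \<in> S \<Longrightarrow> u \<bullet> z = v \<bullet> z" for u v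
  proof -
    have "(u - v) \<bullet> (u - v) = 0"
      using that S(1) subspace_diff[of S u v] by (simp add: inner_diff_left)
    then show ?thesis by simp
  qed
  have Bscale: "B (c *\<^sub>R r) = c *\<^sub>R B r" for c r
    by (rule Bdiff) (auto simp: BS B[symmetric] subspace_scale S)
  have Badd: "B (r + t) = B r + B t" for r t
    by (rule Bdiff) (auto simp: BS B[symmetric] subspace_add S inner_add_left)
  have "bounded {r\<in>R. norm (B r) \<le> 1}"
  proof (rule weakly_bounded_imp_bounded[OF R])
    show "\<exists>c. \<forall>r\<in>{r\<in>R. norm (B r) \<le> 1}. \<bar>r \<bullet> x\<bar> \<le> c" if "x \<in> R" for x
    proof -
      obtain z where z: "z \<in> S" "x = A z" using \<open>x \<in> R\<close> unfolding R_def by blast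
      have "\<bar>r \<bullet> x\<bar> \<le> norm z" if "norm (B r) \<le> 1" for r
      proof -
        have "\<bar>r \<bullet> x\<bar> = \<bar>B r \<bullet> z\<bar>" using B z by simp
        also have "\<dots> \<le> norm (B r) * norm z" by (rule Cauchy_Schwarz_ineq2)
        also have "\<dots> \<le> norm z" using mult_right_mono[OF that, of "norm z"] by simp
        finally show ?thesis .
      qed
      then show ?thesis by blast
    qed
  qed auto
  then have "\<exists>C>0. \<forall>r\<in>{r\<in>R. norm (B r) \<le> 1}. norm r \<le> C" by (simp only: bounded_pos)
  then obtain C where C: "0 < C" "\<And>r. r \<in> R \<Longrightarrow> norm (B r) \<le> 1 \<Longrightarrow> norm r \<le> C" by auto
  have Bzero: "r = 0" if r: "r \<in> R" "B r = 0" for r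
  proof -
    obtain z where "z \<in> S" "r = A z" using r(1) unfolding R_def by blast
    then have "r \<bullet> r = 0" using B[of z r] r(2) by simp
    then show ?thesis by simp
  qed
  have below: "norm r \<le> C * norm (B r)" if "r \<in> R" for r
  proof (cases "B r = 0")
    case True then show ?thesis using Bzero that by simp
  next
    case False
    then have "norm ((1 / norm (B r)) *\<^sub>R r) \<le> C"
      by (intro C(2)) (auto simp: Bscale that subspace_scale R)
    then show ?thesis using False by (simp add: field_simps)
  qed
  have BR: "subspace (B ` R)" "closed (B ` R)"
  proof -
    have lin: "bounded_linear B"
    proof (rule bounded_linear_intro[where K = "norm A"])
      fix r
      have "(norm (B r))\<^sup>2 = r \<bullet> A (B r)" using B[OF BS] by (simp add: power2_norm_eq_inner)
      also have "\<dots> \<le> norm r * norm (A (B r))" by (rule norm_cauchy_schwarz)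
      also have "\<dots> \<le> norm r * (norm A * norm (B r))" by (intro mult_left_mono norm_blinfun) simp
      finally have "norm (B r) * norm (B r) \<le> norm (B r) * (norm r * norm A)"
        by (simp add: power2_eq_square mult_ac)
      then show "norm (B r) \<le> norm r * norm A"
        by (cases "norm (B r) = 0") (simp_all add: mult_le_cancel_left)
    qed (auto simp: Badd Bscale)
    show "subspace (B ` R)" using R lin by (auto intro: linear_subspace_image bounded_linear.linear)
    show "closed (B ` R)"
      using complete_isometric_image[of "1/C" R B] C R lin below
      by (simp add: complete_eq_closed field_simps)
  qed
  show ?thesis
  proof (intro exI[of _ "1 / C"] conjI ballI impI)
    show "0 < 1 / C" using C by simp
    fix v assume v: "v \<in> S" "\<forall>z\<in>S. A z = 0 \<longrightarrow> v \<bullet> z = 0"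
    \<comment> \<open>The component \<open>v - y\<close> orthogonal to the image of \<open>B\<close>
      is killed by \<open>A\<close>, hence orthogonal to \<open>v\<close> by assumption, hence
      zero.\<close>
    obtain y where y: "y \<in> B ` R" "\<And>z. z \<in> B ` R \<Longrightarrow> (v - y) \<bullet> z = 0"
      using orthogonal_decomposition[OF BR, of v] by blast
    have "y \<in> S" using y(1) BS by blast
    have vy: "v - y \<in> S" using v(1) \<open>y \<in> S\<close> S(1) by (simp add: subspace_diff)
    have "A (v - y) \<in> R" unfolding R_def using vy by blast
    then have "A (v - y) \<bullet> A (v - y) = 0"
      using y(2)[of "B (A (v - y))"] B[OF vy, of "A (v - y)"] by (simp add: inner_commute)
    then have "A (v - y) = 0" by simp
    then have "v \<bullet> (v - y) = 0" using v(2) vy by blast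
    moreover have "(v - y) \<bullet> y = 0" using y by blast
    ultimately have "(v - y) \<bullet> (v - y) = 0" by (simp add: inner_diff_right inner_commute)
    then have "v = y" by simp
    then obtain r where r: "r \<in> R" "v = B r" using y(1) by blast
    have "(norm v)\<^sup>2 = r \<bullet> A v" using B[OF v(1), of r] r by (simp add: power2_norm_eq_inner)
    also have "\<dots> \<le> norm r * norm (A v)" by (rule norm_cauchy_schwarz)
    also have "\<dots> \<le> (C * norm v) * norm (A v)" using below[OF r(1)] r(2) by (intro mult_right_mono) auto
    finally have "norm v * norm v \<le> norm v * (C * norm (A v))" by (simp add: power2_eq_square mult_ac)
    then have "norm v \<le> C * norm (A v)"
      using C(1) mult_le_cancel_left_pos[of "norm v" "norm v" "C * norm (A v)"]
      by (cases "v = 0") simp_all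
    then show "1 / C * norm v \<le> norm (A v)" using C(1) by (simp add: pos_divide_le_eq mult.commute)
  qed
qed

section \<open>Complex structure and projections\<close>

lemma inner_scaleC_left:
  fixes x y :: "'a::sep_chilbert"
  shows "(c *\<^sub>C x) \<bullet> y = x \<bullet> (cnj c *\<^sub>C y)"
proof -
  have "cinner x (cnj c *\<^sub>C y) = c * cinner x y"
    using cinner_commute[of x "cnj c *\<^sub>C y"] cinner_commute[of x y] by (simp add: cinner_scaleC_left)
  then show ?thesis
    unfolding Re_cinner[symmetric] by (simp add: cinner_scaleC_left)
qed

lemma norm_scaleC [simp]:
  fixes x :: "'a::sep_chilbert"
  shows "norm (c *\<^sub>C x) = cmod c * norm x"
proof -
  have "(norm (c *\<^sub>C x))\<^sup>2 = x \<bullet> (complex_of_real ((cmod c)\<^sup>2) *\<^sub>C x)"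
    unfolding power2_norm_eq_inner[of "c *\<^sub>C x"] inner_scaleC_left scaleC_scaleC
    by (simp only: complex_norm_square mult.commute)
  also have "\<dots> = (cmod c * norm x)\<^sup>2"
    by (simp add: scaleC_of_real power2_norm_eq_inner power_mult_distrib)
  finally show ?thesis by (simp add: power2_eq_iff_nonneg)
qed

lemma cinner_eq_Complex: "cinner x y = Complex (x \<bullet> y) (x \<bullet> (\<i> *\<^sub>C y))"
proof -
  have "cinner x (\<i> *\<^sub>C y) = - \<i> * cinner x y"
    using cinner_commute[of x "\<i> *\<^sub>C y"] cinner_commute[of x y] by (simp add: cinner_scaleC_left)
  then have "x \<bullet> (\<i> *\<^sub>C y) = Im (cinner x y)"
    unfolding Re_cinner[symmetric] by simp
  then show ?thesis by (simp add: complex_eq_iff Re_cinner)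
qed

lemma cinner_eq_0_iff: "cinner x y = 0 \<longleftrightarrow> (\<forall>c. x \<bullet> (c *\<^sub>C y) = 0)"
proof
  assume "cinner x y = 0"
  then have "cinner x (c *\<^sub>C y) = 0" for c
    using cinner_commute[of x "c *\<^sub>C y"] cinner_commute[of x y] by (simp add: cinner_scaleC_left)
  then show "\<forall>c. x \<bullet> (c *\<^sub>C y) = 0" unfolding Re_cinner[symmetric] by simp
next
  assume "\<forall>c. x \<bullet> (c *\<^sub>C y) = 0"
  then show "cinner x y = 0"
    unfolding cinner_eq_Complex using cvec.scale_one[of y]
    by (simp add: complex_eq_iff) (metis cvec.scale_one)
qed

lemma cinner_self: "cinner x x = complex_of_real ((norm x)\<^sup>2)"
  using cinner_commute[of x x] Re_cinner[of x x]
  by (simp add: complex_eq_iff power2_norm_eq_inner)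

lemma cinner_right:
  "cinner x (y + z) = cinner x y + cinner x z" "cinner x (c *\<^sub>C y) = cnj c * cinner x y"
  by (simp_all add: cinner_commute[of x "y + z"] cinner_commute[of x "c *\<^sub>C y"] cinner_add_left
      cinner_scaleC_left cinner_commute[of x y] cinner_commute[of x z])

lemma bounded_bilinear_scaleC: "bounded_bilinear (scaleC :: complex \<Rightarrow> 'a::sep_chilbert \<Rightarrow> 'a)"
proof
  fix a a' :: complex and b b' :: 'a and r :: real
  show "(a + a') *\<^sub>C b = a *\<^sub>C b + a' *\<^sub>C b" by (rule scaleC_add_left)
  show "a *\<^sub>C (b + b') = a *\<^sub>C b + a *\<^sub>C b'" by (rule scaleC_add_right)
  show "(r *\<^sub>R a) *\<^sub>C b = r *\<^sub>R (a *\<^sub>C b)"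
    by (simp add: scaleC_of_real[symmetric] scaleC_scaleC scaleR_conv_of_real)
  show "a *\<^sub>C (r *\<^sub>R b) = r *\<^sub>R (a *\<^sub>C b)"
    by (simp add: scaleC_of_real[symmetric] scaleC_scaleC mult.commute)
  show "\<exists>K. \<forall>(a::complex) b::'a. norm (a *\<^sub>C b) \<le> norm a * norm b * K"
    by (intro exI[of _ 1]) simp
qed

lemma csubspace_imp_subspace:
  assumes "cvec.subspace S"
  shows "subspace S"
  using assms unfolding cvec.subspace_def subspace_def
  by (metis scaleC_of_real)

text \<open>Additivity is part of the operator type; complex homogeneity is what remains of complex
  linearity.\<close>

definition clin :: "('a::sep_chilbert \<Rightarrow>\<^sub>L 'b::sep_chilbert) \<Rightarrow> bool" where
  "clin A \<longleftrightarrow> (\<forall>c x. A (c *\<^sub>C x) = c *\<^sub>C A x)"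

lemma linear_iff_clin: "Vector_Spaces.linear scaleC scaleC (blinfun_apply A) \<longleftrightarrow> clin A"
proof -
  have "vector_space (scaleC :: complex \<Rightarrow> 'c::sep_chilbert \<Rightarrow> 'c)"
    by unfold_locales
  then show ?thesis
    unfolding clin_def
    by (auto simp: Vector_Spaces.linear_def module_hom_iff blinfun.add_right
        module_hom_axioms_def cvec.vector_space_axioms cvec.module_axioms module_hom_def)
qed

lemma clin_scaleC: "clin A \<Longrightarrow> A (c *\<^sub>C x) = c *\<^sub>C A x"
  by (simp add: clin_def)

named_theorems clin_intros

lemma clin_id [clin_intros]: "clin id_blinfun"
  by (simp add: clin_def)

lemma clin_compose [clin_intros]: "clin A \<Longrightarrow> clin B \<Longrightarrow> clin (A o\<^sub>L B)"
  by (simp add: clin_def)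

lemma clin_add [clin_intros]: "clin A \<Longrightarrow> clin B \<Longrightarrow> clin (A + B)"
  by (simp add: clin_def plus_blinfun.rep_eq scaleC_add_right)

lemma clin_diff [clin_intros]: "clin A \<Longrightarrow> clin B \<Longrightarrow> clin (A - B)"
  by (simp add: clin_def minus_blinfun.rep_eq cvec.scale_right_diff_distrib)

lemma clin_minus [clin_intros]: "clin A \<Longrightarrow> clin (- A)"
  by (simp add: clin_def uminus_blinfun.rep_eq)

lemma clin_scaleR [clin_intros]: "clin A \<Longrightarrow> clin (r *\<^sub>R A)"
  by (simp add: clin_def scaleR_blinfun.rep_eq scaleC_of_real[symmetric] scaleC_scaleC mult.commute)

lemma clin_adj [clin_intros]:
  assumes "clin A"
  shows "clin (adj A)"
  unfolding clin_def
proof (intro allI, rule inner_ext)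
  fix c x y
  have "y \<bullet> adj A (c *\<^sub>C x) = (cnj c *\<^sub>C A y) \<bullet> x"
    by (simp add: adj_right[symmetric] inner_scaleC_left)
  also have "\<dots> = (cnj c *\<^sub>C y) \<bullet> adj A x"
    using assms by (simp add: adj_right[symmetric] clin_scaleC)
  finally show "y \<bullet> adj A (c *\<^sub>C x) = y \<bullet> (c *\<^sub>C adj A x)"
    by (simp add: inner_scaleC_left)
qed

lemma clin_binv [clin_intros]:
  assumes "clin A" "coercive d A" "0 < d"
  shows "clin (binv A)"
  unfolding clin_def
proof (intro allI)
  fix c x
  have "binv A (c *\<^sub>C x) = binv A (A (c *\<^sub>C binv A x))"
    by (simp only: clin_scaleC[OF assms(1)] binv_coercive(1)[OF assms(2,3)])
  then show "binv A (c *\<^sub>C x) = c *\<^sub>C binv A x" by (simp only: binv_coercive(2)[OF assms(2,3)])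
qed

lemma clin_fst [clin_intros]: "clin fst_blinfun" and clin_snd [clin_intros]: "clin snd_blinfun"
  by (simp_all add: clin_def scaleC_prod_def)

lemma cinner_adj: "clin A \<Longrightarrow> cinner (A x) y = cinner x (adj A y)"
  unfolding cinner_eq_Complex
  using clin_scaleC[OF clin_adj, of A \<i> y] by (simp add: adj_right)

lemma subspace_kernel_eq: "cvec.subspace {x. cinner x y = 0}"
  by (auto simp: cvec.subspace_def cinner_add_left cinner_scaleC_left)
     (metis cinner_scaleC_left cvec.scale_zero_left mult_zero_left)

lemma csubspace_orth_comp: "cvec.subspace (orth_comp S)"
proof -
  have "orth_comp S = \<Inter> ((\<lambda>y. {x. cinner x y = 0}) ` S)" by (auto simp: orth_comp_def)
  then show ?thesis by (auto intro!: cvec.subspace_Inter subspace_kernel_eq)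
qed

lemma closed_orth_comp: "closed (orth_comp (S :: 'a::sep_chilbert set))"
proof -
  have "orth_comp S = (\<Inter>y\<in>S. \<Inter>c. {x. x \<bullet> (c *\<^sub>C y) = 0})"
    by (auto simp: orth_comp_def cinner_eq_0_iff)
  then show ?thesis by (auto intro!: closed_INT closed_Collect_eq continuous_intros)
qed

lemma orth_comp_iff:
  assumes "cvec.subspace S"
  shows "x \<in> orth_comp S \<longleftrightarrow> (\<forall>y\<in>S. x \<bullet> y = 0)"
  unfolding orth_comp_def cinner_eq_0_iff
  using assms by (auto simp: cvec.subspace_def) (metis cvec.scale_one)

lemma orth_comp_inner: "x \<in> orth_comp S \<Longrightarrow> y \<in> S \<Longrightarrow> x \<bullet> y = 0"
  using Re_cinner[of x y] by (simp add: orth_comp_def)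

lemma orth_comp_span: "orth_comp (cvec.span B) = orth_comp B"
proof -
  have "cvec.span B \<subseteq> {y. cinner x y = 0}" if "x \<in> orth_comp B" for x
  proof (rule cvec.span_minimal)
    show "B \<subseteq> {y. cinner x y = 0}" using that by (auto simp: orth_comp_def)
    show "cvec.subspace {y. cinner x y = 0}"
      using subspace_kernel_eq[of x] by (simp add: cinner_commute[of x])
  qed
  then show ?thesis using cvec.span_superset by (auto simp: orth_comp_def)
qed

locale closed_csubspace =
  fixes S :: "'a::sep_chilbert set"
  assumes csub: "cvec.subspace S" and closed: "closed S"
begin

lemma sub: "subspace S" by (rule csubspace_imp_subspace[OF csub])

lemma Proj_works:
  shows Proj_in: "Proj S x \<in> S" and Proj_orth: "x - Proj S x \<in> orth_comp S"
    and clin_Proj: "clin (Proj S)" and norm_Proj: "norm (Proj S x) \<le> norm x"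
    and Proj_unique: "\<And>y. y \<in> S \<Longrightarrow> x - y \<in> orth_comp S \<Longrightarrow> Proj S x = y"
proof -
  define g where "g x = (THE y. y \<in> S \<and> x - y \<in> orth_comp S)" for x
  have uniq: "y = z" if "y \<in> S" "x - y \<in> orth_comp S" "z \<in> S" "x - z \<in> orth_comp S" for x y z
  proof -
    have "y - z \<in> S" using that csub by (simp add: cvec.subspace_diff)
    moreover have "(x - z) - (x - y) \<in> orth_comp S"
      using that csubspace_orth_comp cvec.subspace_diff by blast
    ultimately have "(y - z) \<bullet> (y - z) = 0" using orth_comp_inner by fastforce
    then show ?thesis by simp
  qed
  have ex: "\<exists>y. y \<in> S \<and> x - y \<in> orth_comp S" for x
    using orthogonal_decomposition[OF sub closed, of x] orth_comp_iff[OF csub] by metis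
  have g: "g x \<in> S \<and> x - g x \<in> orth_comp S" for x
    unfolding g_def by (rule theI') (use ex uniq in blast)
  have gI: "g x = y" if "y \<in> S" "x - y \<in> orth_comp S" for x y
    using g uniq that by blast
  have gscale: "g (c *\<^sub>C x) = c *\<^sub>C g x" for c x
    by (rule gI)
      (use g csub csubspace_orth_comp[of S] in
        \<open>simp_all add: cvec.subspace_scale cvec.scale_right_diff_distrib[symmetric]\<close>)
  have gadd: "g (x + y) = g x + g y" for x y
    by (rule gI)
      (use g csub csubspace_orth_comp[of S] in
        \<open>simp_all add: cvec.subspace_add add_diff_add\<close>)
  have gnorm: "norm (g x) \<le> norm x" for x
  proof -
    have "(x - g x) \<bullet> g x = 0" using g orth_comp_inner by blast
    then have "(norm (g x))\<^sup>2 = x \<bullet> g x" by (simp add: inner_diff_left power2_norm_eq_inner)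
    also have "\<dots> \<le> norm x * norm (g x)" by (rule norm_cauchy_schwarz)
    finally show ?thesis
      by (cases "g x = 0") (simp_all add: power2_eq_square)
  qed
  have "bounded_linear g"
    by (rule bounded_linear_intro[where K = 1])
       (auto simp: gadd gnorm gscale scaleC_of_real[symmetric])
  then have P: "blinfun_apply (Proj S) = g"
    unfolding Proj_def g_def by (rule bounded_linear_Blinfun_apply)
  show "Proj S x \<in> S" "x - Proj S x \<in> orth_comp S" "norm (Proj S x) \<le> norm x"
    "clin (Proj S)" "\<And>y. y \<in> S \<Longrightarrow> x - y \<in> orth_comp S \<Longrightarrow> Proj S x = y"
    unfolding P clin_def using g gnorm gscale gI by auto
qed

lemma Proj_id: "x \<in> S \<Longrightarrow> Proj S x = x"
  by (rule Proj_unique) (simp_all add: csubspace_orth_comp cvec.subspace_0)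

lemma Proj_zero: "x \<in> orth_comp S \<Longrightarrow> Proj S x = 0"
  by (rule Proj_unique) (simp_all add: csub cvec.subspace_0)

lemma Proj_idem [simp]: "Proj S (Proj S x) = Proj S x"
  by (rule Proj_id[OF Proj_in])

lemma Proj_iff: "Proj S x = x \<longleftrightarrow> x \<in> S"
  using Proj_id Proj_in by metis

lemma Proj_self: "Proj S x \<bullet> y = x \<bullet> Proj S y"
proof -
  have "(x - Proj S x) \<bullet> Proj S y = 0" "(y - Proj S y) \<bullet> Proj S x = 0"
    using Proj_in Proj_orth orth_comp_inner by blast+
  then show ?thesis unfolding inner_diff_left by (metis inner_commute eq_iff_diff_eq_0)
qed

lemma adj_Proj [simp]: "adj (Proj S) = Proj S"
  by (rule adj_eqI) (rule Proj_self)

lemma in_iff_orth_orth: "x \<in> S \<longleftrightarrow> (\<forall>y\<in>orth_comp S. x \<bullet> y = 0)"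
proof
  show "x \<in> S \<Longrightarrow> \<forall>y\<in>orth_comp S. x \<bullet> y = 0"
    using orth_comp_inner by (metis inner_commute)
  assume "\<forall>y\<in>orth_comp S. x \<bullet> y = 0"
  then have "x \<bullet> (x - Proj S x) = 0" using Proj_orth by blast
  moreover have "Proj S x \<bullet> (x - Proj S x) = 0"
    using Proj_in Proj_orth orth_comp_inner by (metis inner_commute)
  ultimately have "(x - Proj S x) \<bullet> (x - Proj S x) = 0" by (simp add: inner_diff_left)
  then show "x \<in> S" using Proj_in[of x] by simp
qed

end

lemma closed_csubspace_orth_comp: "closed_csubspace (orth_comp S)"
  by (simp add: closed_csubspace_def csubspace_orth_comp closed_orth_comp)

section \<open>Finite-dimensional subspaces\<close>

definition orthonormal :: "'a::sep_chilbert set \<Rightarrow> bool" where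
  "orthonormal C \<longleftrightarrow> (\<forall>c\<in>C. \<forall>d\<in>C. cinner c d = (if c = d then 1 else 0))"

lemma cinner_sum_left: "cinner (\<Sum>i\<in>I. f i) y = (\<Sum>i\<in>I. cinner (f i) y)"
proof -
  have z: "cinner 0 y = 0" using cinner_add_left[of 0 0 y] by simp
  show ?thesis by (induction I rule: infinite_finite_induct) (simp_all add: z cinner_add_left)
qed

lemma orthonormal_sum_orth:
  assumes C: "finite C" "orthonormal C"
  shows "x - (\<Sum>c\<in>C. cinner x c *\<^sub>C c) \<in> orth_comp C"
proof -
  have "cinner (\<Sum>c\<in>C. cinner x c *\<^sub>C c) d = cinner x d" if "d \<in> C" for d
  proof -
    have "cinner (\<Sum>c\<in>C. cinner x c *\<^sub>C c) d = (\<Sum>c\<in>C. if c = d then cinner x c else 0)"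
      unfolding cinner_sum_left cinner_scaleC_left
      using C(2) that by (intro sum.cong) (auto simp: orthonormal_def)
    then show ?thesis using C(1) that by simp
  qed
  moreover have "cinner (x - y) d + cinner y d = cinner x d" for y d
    using cinner_add_left[of "x - y" y d] by simp
  ultimately show ?thesis by (auto simp: orth_comp_def) (metis add_cancel_left_left)
qed

lemma finite_orthonormal_basis:
  assumes "finite B"
  shows "\<exists>C. finite C \<and> orthonormal C \<and> cvec.span C = cvec.span B"
  using assms
proof (induction B)
  case empty
  then show ?case by (auto simp: orthonormal_def intro!: exI[of _ "{}"])
next
  case (insert b B)
  then obtain C where C: "finite C" "orthonormal C" "cvec.span C = cvec.span B" by blast
  define s where "s = (\<Sum>c\<in>C. cinner b c *\<^sub>C c)"
  define d where "d = b - s"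
  have s: "s \<in> cvec.span C"
    unfolding s_def by (intro cvec.span_sum cvec.span_scale cvec.span_base)
  show ?case
  proof (cases "d = 0")
    case True
    then have "b \<in> cvec.span B" using s C(3) by (simp add: d_def)
    then show ?thesis using C by (auto simp: cvec.span_redundant)
  next
    case False
    have orth: "cinner d c = 0" if "c \<in> C" for c
      using orthonormal_sum_orth[OF C(1,2), of b] that unfolding d_def s_def orth_comp_def by blast
    define e where "e = complex_of_real (1 / norm d) *\<^sub>C d"
    have "norm e = 1" using False by (simp add: e_def norm_divide)
    then have "cinner e e = 1" by (simp add: cinner_self)
    moreover have "cinner e c = 0" "cinner c e = 0" if "c \<in> C" for c
      using orth[OF that] cinner_commute[of c e] by (simp_all add: e_def cinner_scaleC_left)
    ultimately have "orthonormal (insert e C)" using C(2) by (auto simp: orthonormal_def)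
    moreover have "cvec.span (insert e C) = cvec.span (insert b B)"
    proof -
      have "d = complex_of_real (norm d) *\<^sub>C e" using False by (simp add: e_def scaleC_scaleC)
      then have "b = complex_of_real (norm d) *\<^sub>C e + s" by (simp add: d_def)
      moreover have "s \<in> cvec.span (insert e C)" using s cvec.span_mono[of C "insert e C"] by blast
      ultimately have "b \<in> cvec.span (insert e C)"
        by (metis cvec.span_add cvec.span_base cvec.span_scale insertI1)
      moreover have "B \<subseteq> cvec.span (insert e C)"
        using C(3) cvec.span_superset[of B] cvec.span_mono[of C "insert e C"] by blast
      moreover have "C \<subseteq> cvec.span (insert b B)"
        using C(3) cvec.span_superset[of C] cvec.span_mono[of B "insert b B"] by blast
      moreover have "e \<in> cvec.span (insert b B)"
      proof -
        have "s \<in> cvec.span (insert b B)" using s C(3) cvec.span_mono[of B "insert b B"] by blast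
        then show ?thesis
          unfolding e_def d_def by (intro cvec.span_scale cvec.span_diff) (auto intro: cvec.span_base)
      qed
      ultimately show ?thesis by (auto simp: cvec.span_eq)
    qed
    ultimately show ?thesis using C(1) by blast
  qed
qed

lemma orthonormal_expansion:
  assumes "finite C" "orthonormal C" "x \<in> cvec.span C"
  shows "x = (\<Sum>c\<in>C. cinner x c *\<^sub>C c)"
proof -
  define d where "d = x - (\<Sum>c\<in>C. cinner x c *\<^sub>C c)"
  have "d \<in> cvec.span C"
    unfolding d_def by (intro cvec.span_diff assms cvec.span_sum cvec.span_scale cvec.span_base)
  moreover have "d \<in> orth_comp (cvec.span C)"
    unfolding d_def orth_comp_span using orthonormal_sum_orth[OF assms(1,2)] .
  ultimately have "d \<bullet> d = 0" using orth_comp_inner by blast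
  then show ?thesis by (simp add: d_def)
qed

text \<open>The factor 2 comes from estimating real and imaginary part separately by the real
  Cauchy-Schwarz inequality.\<close>

lemma cmod_cinner_le: "cmod (cinner x y) \<le> 2 * norm x * norm y"
proof -
  have "cmod (cinner x y) \<le> \<bar>x \<bullet> y\<bar> + \<bar>x \<bullet> (\<i> *\<^sub>C y)\<bar>"
    unfolding cinner_eq_Complex using cmod_le[of "Complex (x \<bullet> y) (x \<bullet> (\<i> *\<^sub>C y))"] by simp
  also have "\<dots> \<le> norm x * norm y + norm x * norm (\<i> *\<^sub>C y)"
    by (intro add_mono Cauchy_Schwarz_ineq2)
  finally show ?thesis by simp
qed

lemma bounded_linear_cinner_left: "bounded_linear (\<lambda>x. cinner x y)"
proof (rule bounded_linear_intro[where K = "2 * norm y"])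
  show "cinner (x + z) y = cinner x y + cinner z y" for x z by (rule cinner_add_left)
  show "cinner (r *\<^sub>R x) y = r *\<^sub>R cinner x y" for r x
    by (simp add: scaleC_of_real[symmetric] cinner_scaleC_left scaleR_conv_of_real)
  show "norm (cinner x y) \<le> norm x * (2 * norm y)" for x
    using cmod_cinner_le[of x y] by (simp add: mult_ac)
qed

text \<open>The span is the fixed point set of the continuous map that sends a vector to its
  expansion in an orthonormal basis.\<close>

lemma closed_span_finite:
  assumes "finite B"
  shows "closed (cvec.span B)"
proof -
  obtain C where C: "finite C" "orthonormal C" "cvec.span C = cvec.span B"
    using finite_orthonormal_basis[OF assms] by blast
  have "cvec.span C = {x. x = (\<Sum>c\<in>C. cinner x c *\<^sub>C c)}"
  proof (intro equalityI subsetI CollectI)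
    fix x assume "x \<in> {x. x = (\<Sum>c\<in>C. cinner x c *\<^sub>C c)}"
    then have "x = (\<Sum>c\<in>C. cinner x c *\<^sub>C c)" by simp
    moreover have "(\<Sum>c\<in>C. cinner x c *\<^sub>C c) \<in> cvec.span C"
      by (intro cvec.span_sum cvec.span_scale cvec.span_base)
    ultimately show "x \<in> cvec.span C" by simp
  qed (rule orthonormal_expansion[OF C(1,2)])
  moreover have "continuous_on UNIV (\<lambda>x. cinner x c *\<^sub>C c)" for c
    by (intro linear_continuous_on
        bounded_linear_compose[OF bounded_bilinear.bounded_linear_left[OF bounded_bilinear_scaleC]
          bounded_linear_cinner_left])
  ultimately show ?thesis
    using C(3) by (auto intro!: closed_Collect_eq continuous_on_sum continuous_on_id)
qed

text \<open>Every element of \<open>B\<close> imposes one linear condition on \<open>N\<close>, so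
  dropping it adds at most one dimension.\<close>

lemma finite_dim_if_orth_comp_trivial:
  assumes "finite B" "cvec.subspace N" "N \<inter> orth_comp B = {0}"
  shows "finite_dim N"
  using assms
proof (induction B arbitrary: N)
  case empty
  then have "N = {0}" by (auto simp: orth_comp_def)
  then show ?case by (auto simp: finite_dim_def intro!: exI[of _ "{}"])
next
  case (insert b B)
  define N' where "N' = N \<inter> {x. cinner x b = 0}"
  have "cvec.subspace N'"
    unfolding N'_def using insert.prems(1) subspace_kernel_eq cvec.subspace_inter by blast
  moreover have "N' \<inter> orth_comp B = {0}"
    using insert.prems(2) by (auto simp: N'_def orth_comp_def)
  ultimately have "finite_dim N'" by (rule insert.IH)
  then obtain D where D: "finite D" "N' \<subseteq> cvec.span D"
    unfolding finite_dim_def by blast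
  show ?case
  proof (cases "N \<subseteq> N'")
    case True then show ?thesis using D by (auto simp: finite_dim_def)
  next
    case False
    then obtain w where w: "w \<in> N" "cinner w b \<noteq> 0" by (auto simp: N'_def)
    have "N \<subseteq> cvec.span (insert w D)"
    proof
      fix x assume "x \<in> N"
      define y where "y = x - (cinner x b / cinner w b) *\<^sub>C w"
      have "cinner y b + (cinner x b / cinner w b) * cinner w b = cinner x b"
        using cinner_add_left[of y "(cinner x b / cinner w b) *\<^sub>C w" b]
        by (simp add: y_def cinner_scaleC_left)
      then have "y \<in> N'"
        unfolding N'_def y_def using w \<open>x \<in> N\<close> insert.prems(1)
        by (auto simp: cvec.subspace_diff cvec.subspace_scale)
      then have "y \<in> cvec.span (insert w D)" using D(2) cvec.span_mono[of D "insert w D"] by blast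
      moreover have "x = y + (cinner x b / cinner w b) *\<^sub>C w" by (simp add: y_def)
      ultimately show "x \<in> cvec.span (insert w D)"
        by (metis cvec.span_add cvec.span_base cvec.span_scale insertI1)
    qed
    then show ?thesis using D(1) unfolding finite_dim_def by blast
  qed
qed

text \<open>Modulo \<open>S\<close> the sum becomes a finite-dimensional span, and it is the
  preimage of that span under the projection off \<open>S\<close>.\<close>

lemma (in closed_csubspace) closed_plus_span:
  assumes "finite C"
  shows "closed (S + cvec.span C)"
proof -
  define D where "D = (\<lambda>c. c - Proj S c) ` C"
  have "Vector_Spaces.linear scaleC scaleC (blinfun_apply (id_blinfun - Proj S))"
    unfolding linear_iff_clin by (intro clin_intros clin_Proj)
  then interpret Q: Vector_Spaces.linear scaleC scaleC "blinfun_apply (id_blinfun - Proj S)" .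
  have img: "(\<lambda>x. x - Proj S x) ` cvec.span C = cvec.span D"
    using Q.span_image[of C] unfolding D_def minus_blinfun.rep_eq by simp
  have "S + cvec.span C = {x. x - Proj S x \<in> cvec.span D}"
  proof (intro equalityI subsetI)
    fix x assume "x \<in> S + cvec.span C"
    then obtain s c where "s \<in> S" "c \<in> cvec.span C" "x = s + c" by (auto elim: set_plus_elim)
    then have "x - Proj S x = c - Proj S c" by (simp add: blinfun.add_right Proj_id)
    then show "x \<in> {x. x - Proj S x \<in> cvec.span D}" using img \<open>c \<in> _\<close> by auto
  next
    fix x assume "x \<in> {x. x - Proj S x \<in> cvec.span D}"
    then have "x - Proj S x \<in> (\<lambda>x. x - Proj S x) ` cvec.span C" unfolding img by simp
    then obtain c where c: "c \<in> cvec.span C" "x - Proj S x = c - Proj S c" by blast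
    then have "x = (Proj S x - Proj S c) + c" by (simp add: algebra_simps)
    moreover have "Proj S x - Proj S c \<in> S" using csub Proj_in by (simp add: cvec.subspace_diff)
    ultimately show "x \<in> S + cvec.span C" using c(1) by (metis set_plus_intro)
  qed
  moreover have "closed ((\<lambda>x. x - Proj S x) -` cvec.span D)"
    by (rule continuous_closed_vimage)
       (auto intro!: closed_span_finite continuous_intros simp: D_def assms)
  ultimately show ?thesis by (simp add: vimage_def)
qed

section \<open>Unitaries with essentially invertible $u + 1$\<close>

text \<open>For a unitary \<open>u\<close> this says that $u + 1$ is Fredholm, in a form that is stable under the
  constructions below.\<close>

definition ess_below :: "('a::sep_chilbert \<Rightarrow>\<^sub>L 'b::sep_chilbert) \<Rightarrow> bool" where
  "ess_below A \<longleftrightarrow> (\<exists>B e. finite B \<and> 0 < e \<and> (\<forall>v\<in>orth_comp B. e * norm v \<le> norm (A v)))"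

definition UE :: "('a::sep_chilbert \<Rightarrow>\<^sub>L 'a) set" where
  "UE = {u. clin u \<and> (\<forall>x. norm (u x) = norm x) \<and> surj (blinfun_apply u) \<and> ess_below (u + id_blinfun)}"

lemma UE_D:
  assumes "u \<in> UE"
  shows "clin u" "norm (u x) = norm x" "surj (blinfun_apply u)" "ess_below (u + id_blinfun)"
  using assms by (simp_all add: UE_def)

lemma clin_image_span:
  assumes "clin A"
  shows "blinfun_apply A ` cvec.span B = cvec.span (blinfun_apply A ` B)"
proof -
  interpret Vector_Spaces.linear scaleC scaleC "blinfun_apply A"
    using assms by (simp add: linear_iff_clin)
  show ?thesis by (rule span_image[symmetric])
qed

lemma clin_image_subspace:
  assumes "clin A" "cvec.subspace S"
  shows "cvec.subspace (blinfun_apply A ` S)"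
proof -
  interpret Vector_Spaces.linear scaleC scaleC "blinfun_apply A"
    using assms by (simp add: linear_iff_clin)
  show ?thesis using assms(2) by (rule subspace_image)
qed

lemma closed_csubspace_kernel:
  assumes "clin A"
  shows "closed_csubspace {x. A x = 0}"
proof
  show "cvec.subspace {x. A x = 0}"
    using assms by (simp add: cvec.subspace_def blinfun.add_right clin_scaleC)
  show "closed {x. A x = 0}"
    by (intro closed_Collect_eq continuous_intros)
qed

text \<open>The range is the closed image of \<open>orth_comp B\<close> plus a finite-dimensional
  space.\<close>

lemma ess_below_closed_range:
  assumes A: "clin A" "ess_below A"
  shows "closed (range (blinfun_apply A))"
proof -
  obtain B e where B: "finite B" "0 < e" "\<And>v. v \<in> orth_comp B \<Longrightarrow> e * norm v \<le> norm (A v)"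
    using A(2) unfolding ess_below_def by blast
  define S where "S = blinfun_apply A ` orth_comp B"
  interpret C: closed_csubspace "cvec.span B"
    by (simp add: closed_csubspace_def closed_span_finite B(1) cvec.subspace_span)
  interpret S: closed_csubspace S
    unfolding S_def using A(1) B csubspace_orth_comp closed_orth_comp
    by (auto simp: closed_csubspace_def intro!: clin_image_subspace closed_image_bounded_below
        csubspace_imp_subspace)
  have "range (blinfun_apply A) = S + cvec.span (blinfun_apply A ` B)"
  proof (intro equalityI subsetI)
    fix y assume "y \<in> range (blinfun_apply A)"
    then obtain x where x: "y = A x" by blast
    have "x - Proj (cvec.span B) x \<in> orth_comp B" using C.Proj_orth[of x] by (simp add: orth_comp_span)
    then have "A (x - Proj (cvec.span B) x) \<in> S" unfolding S_def by blast
    moreover have "A (Proj (cvec.span B) x) \<in> cvec.span (blinfun_apply A ` B)"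
      using C.Proj_in[of x] clin_image_span[OF A(1), of B] by blast
    moreover have "y = A (x - Proj (cvec.span B) x) + A (Proj (cvec.span B) x)"
      by (simp add: x blinfun.diff_right)
    ultimately show "y \<in> S + cvec.span (blinfun_apply A ` B)" by (metis set_plus_intro)
  next
    fix y assume "y \<in> S + cvec.span (blinfun_apply A ` B)"
    then obtain s t where "s \<in> S" "t \<in> blinfun_apply A ` cvec.span B" "y = s + t"
      unfolding clin_image_span[OF A(1)] by (auto elim: set_plus_elim)
    then show "y \<in> range (blinfun_apply A)"
      unfolding S_def by (auto simp: blinfun.add_right[symmetric])
  qed
  then show ?thesis using S.closed_plus_span[of "blinfun_apply A ` B"] B(1) by simp
qed

text \<open>The auxiliary finite set is traded for the kernel itself: the kernel meets
  \<open>orth_comp B\<close> only in 0, and closedness of the range gives a lower bound on the whole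
  complement of the kernel.\<close>

lemma ess_below_split:
  assumes A: "clin A" "ess_below A"
  shows "finite_dim {x. A x = 0}"
    and "\<exists>c>0. \<forall>v\<in>orth_comp {x. A x = 0}. c * norm v \<le> norm (A v)"
proof -
  obtain B e where B: "finite B" "0 < e" "\<And>v. v \<in> orth_comp B \<Longrightarrow> e * norm v \<le> norm (A v)"
    using A(2) unfolding ess_below_def by blast
  interpret N: closed_csubspace "{x. A x = 0}" by (rule closed_csubspace_kernel[OF A(1)])
  have "v = 0" if "A v = 0" "v \<in> orth_comp B" for v
    using B(3)[OF that(2)] that(1) B(2) by (simp add: mult_le_0_iff)
  then have "{x. A x = 0} \<inter> orth_comp B = {0}"
    using csubspace_orth_comp[of B] by (auto simp: cvec.subspace_def)
  then show "finite_dim {x. A x = 0}" using finite_dim_if_orth_comp_trivial[OF B(1) N.csub] by simp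
  have "closed (blinfun_apply A ` UNIV)" by (rule ess_below_closed_range[OF A])
  from closed_range_bounded_below[OF subspace_UNIV closed_UNIV this]
  obtain c where "c > 0" "\<And>v. (\<And>z. A z = 0 \<Longrightarrow> v \<bullet> z = 0) \<Longrightarrow> c * norm v \<le> norm (A v)" by auto
  then show "\<exists>c>0. \<forall>v\<in>orth_comp {x. A x = 0}. c * norm v \<le> norm (A v)"
    using orth_comp_inner by blast
qed

text \<open>For unitary \<open>u\<close> the adjoint of \<open>u + 1\<close> has its kernel inside
  that of \<open>u + 1\<close>, since applying \<open>u\<close> to \<open>adj u x + x\<close> gives
  \<open>x + u x\<close>. Hence the kernel also bounds the codimension of the range. All homotopies
  are built in \<open>UE\<close> and transported along this inclusion.\<close>

lemma UE_subset_U_F: "UE \<subseteq> U_F"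
proof
  fix u :: "'a \<Rightarrow>\<^sub>L 'a" assume u: "u \<in> UE"
  note u' = UE_D[OF u]
  define A where "A = u + id_blinfun"
  have A: "clin A" "ess_below A" unfolding A_def using u' by (auto intro: clin_intros)
  have iso: "u x \<bullet> u y = x \<bullet> y" for x y by (rule polarization_isometry) (rule u')
  have "cinner (u x) (u y) = cinner x y" for x y
    unfolding cinner_eq_Complex using iso u'(1) by (simp add: clin_scaleC[symmetric])
  then have "unitary_op u" using u' by (simp add: unitary_op_def linear_iff_clin)
  moreover have "fredholm_op A"
    unfolding fredholm_op_def
  proof (intro conjI)
    show "Vector_Spaces.linear scaleC scaleC (blinfun_apply A)" by (simp add: linear_iff_clin A)
    show fd: "finite_dim {x. A x = 0}" by (rule ess_below_split(1)[OF A])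
    show cl: "closed (range (blinfun_apply A))" by (rule ess_below_closed_range[OF A])
    interpret R: closed_csubspace "range (blinfun_apply A)"
      by (simp add: closed_csubspace_def cl clin_image_subspace A)
    obtain B where B: "finite B" "{x. A x = 0} \<subseteq> cvec.span B" using fd by (auto simp: finite_dim_def)
    have "x \<in> {x. A x = 0}" if x: "x \<in> orth_comp (range (blinfun_apply A))" for x
    proof -
      have "x \<bullet> A y = 0" for y using orth_comp_inner[OF x] by blast
      then have "y \<bullet> adj A x = y \<bullet> 0" for y by (simp add: adj_right[symmetric] inner_commute)
      then have 1: "adj A x = 0" by (rule inner_ext)
      have "adj A = adj u + id_blinfun"
        by (rule adj_eqI) (simp add: A_def plus_blinfun.rep_eq inner_add_left inner_add_right adj_right)
      then have "adj u x + x = 0" using 1 by (simp add: plus_blinfun.rep_eq)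
      then have "u (adj u x + x) = 0" by (simp only: blinfun.zero_right)
      then have "x + u x = 0" using adj_unitary(1)[OF u'(2,3)] by (simp add: blinfun.add_right)
      then show ?thesis by (simp add: A_def plus_blinfun.rep_eq add.commute)
    qed
    then have "Proj (range A) x + (x - Proj (range A) x) \<in> range (blinfun_apply A) + cvec.span B" for x
      using R.Proj_in[of x] R.Proj_orth[of x] B(2) by (intro set_plus_intro) auto
    then have "x \<in> range (blinfun_apply A) + cvec.span B" for x by simp
    then show "finite_codim_in UNIV (range (blinfun_apply A))"
      using B(1) by (auto simp: finite_codim_in_def)
  qed
  ultimately show "u \<in> U_F" by (simp add: U_F_def A_def)
qed

section \<open>Conjugation by partial isometries\<close>

text \<open>For an isometry \<open>s\<close> this is \<open>s u s*\<close>, extended by the identity on the complement of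
  the range of \<open>s\<close>.\<close>

definition conj_ext ::
    "('a::sep_chilbert \<Rightarrow>\<^sub>L 'b::sep_chilbert) \<Rightarrow> ('a \<Rightarrow>\<^sub>L 'a) \<Rightarrow> 'b \<Rightarrow>\<^sub>L 'b" where
  "conj_ext s u = id_blinfun + (s o\<^sub>L (u - id_blinfun) o\<^sub>L adj s)"

text \<open>Partial isometries with initial space \<open>W\<close>. The extension by zero lets
  \<open>W\<close> vary with a parameter while norm continuity is measured on a fixed ambient
  space.\<close>

definition part_isom :: "'a set \<Rightarrow> ('a::sep_chilbert \<Rightarrow>\<^sub>L 'b::sep_chilbert) \<Rightarrow> bool" where
  "part_isom W s \<longleftrightarrow> closed_csubspace W \<and> clin s \<and> (\<forall>w\<in>W. norm (s w) = norm w) \<and>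
     (\<forall>w\<in>orth_comp W. s w = 0)"

lemma part_isom_D:
  assumes "part_isom W s"
  shows "closed_csubspace W" "clin s" "w \<in> W \<Longrightarrow> norm (s w) = norm w"
    "w \<in> orth_comp W \<Longrightarrow> s w = 0"
    and part_isom_inner: "w \<in> W \<Longrightarrow> s w \<bullet> s a = w \<bullet> a"
    and part_isom_adj_in: "adj s k \<in> W"
    and part_isom_adj: "w \<in> W \<Longrightarrow> adj s (s w) = w"
proof -
  show W: "closed_csubspace W" and 2: "clin s" and n: "\<And>w. w \<in> W \<Longrightarrow> norm (s w) = norm w"
    and z: "\<And>w. w \<in> orth_comp W \<Longrightarrow> s w = 0" using assms unfolding part_isom_def by auto
  interpret closed_csubspace W by (rule W)
  have pol: "s v \<bullet> s w = v \<bullet> w" if "v \<in> W" "w \<in> W" for v w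
  proof -
    have "(norm (s (v + w)))\<^sup>2 = (norm (v + w))\<^sup>2"
      using that n csub by (simp add: cvec.subspace_add)
    moreover have "(norm (s v))\<^sup>2 = (norm v)\<^sup>2" "(norm (s w))\<^sup>2 = (norm w)\<^sup>2" using that n by auto
    ultimately show ?thesis
      unfolding power2_norm_eq_inner by (simp add: blinfun.add_right inner_add_left inner_add_right inner_commute)
  qed
  show i: "s w \<bullet> s a = w \<bullet> a" if "w \<in> W" for w a
  proof -
    have a: "s a = s (Proj W a)" using z[OF Proj_orth[of a]] by (simp add: blinfun.diff_right)
    have "w \<bullet> (a - Proj W a) = 0" using Proj_orth[of a] orth_comp_inner that by (metis inner_commute)
    then show ?thesis unfolding a using pol[OF that Proj_in[of a]] by (simp add: inner_diff_right)
  qed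
  show "adj s k \<in> W"
    unfolding in_iff_orth_orth by (simp add: adj_left z)
  show "adj s (s w) = w" if "w \<in> W" for w
    by (rule inner_ext) (use i[OF that] in \<open>simp add: adj_right[symmetric] inner_commute\<close>)
qed

lemma part_isom_UNIV:
  "part_isom UNIV s \<longleftrightarrow> clin s \<and> (\<forall>x. norm (s x) = norm x)"
proof -
  have "w = 0" if "w \<in> orth_comp UNIV" for w :: 'a using orth_comp_inner[OF that, of w] by simp
  then show ?thesis
    unfolding part_isom_def closed_csubspace_def by (metis UNIV_I blinfun.zero_right closed_UNIV cvec.subspace_UNIV)
qed

lemma conj_ext_apply: "conj_ext s u k = k + s (u (adj s k) - adj s k)"
  by (simp add: conj_ext_def plus_blinfun.rep_eq minus_blinfun.rep_eq)

lemma conj_ext_conj_ext: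
  assumes "\<And>x. norm (blinfun_apply r x) = norm x"
  shows "conj_ext r (conj_ext s u) = conj_ext (r o\<^sub>L s) u"
  by (rule blinfun_eqI) (simp add: conj_ext_apply adj_compose)

lemma unitary_preserves:
  assumes W: "closed_csubspace W" and n: "\<And>x. norm (blinfun_apply u x) = norm x"
    and fx: "\<And>w. w \<in> orth_comp W \<Longrightarrow> u w = w"
  shows "u a \<in> W \<longleftrightarrow> a \<in> W"
proof -
  interpret closed_csubspace W by (rule W)
  have "u a \<bullet> w = a \<bullet> w" if "w \<in> orth_comp W" for w
    using polarization_isometry[OF n, of a w] fx[OF that] n by simp
  then show ?thesis unfolding in_iff_orth_orth by simp
qed

text \<open>As \<open>u\<close> is the identity off \<open>W\<close>, it preserves \<open>W\<close>.
  The target splits orthogonally into the image of \<open>W\<close>, where the conjugate is a copy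
  of \<open>u\<close> on \<open>W\<close>, and a rest \<open>c k\<close>, where it is the
  identity.\<close>

lemma conj_ext_UE:
  assumes s: "part_isom W s" and u: "u \<in> UE"
    and fx: "\<And>w. w \<in> orth_comp W \<Longrightarrow> u w = w"
  shows "conj_ext s u \<in> UE"
proof -
  note u' = UE_D[OF u] and s' = part_isom_D[OF s]
  interpret closed_csubspace W by (rule s')
  have pres: "u a \<in> W \<longleftrightarrow> a \<in> W" for a by (rule unitary_preserves[OF s'(1) u'(2) fx])
  define c where "c k = k - s (adj s k)" for k
  have ck: "k = s (adj s k) + c k" for k by (simp add: c_def)
  have adjc: "adj s (c k) = 0" for k by (simp add: c_def blinfun.diff_right s'(6,7))
  have pyth: "(norm (s a + r *\<^sub>R c k))\<^sup>2 = (norm a)\<^sup>2 + r\<^sup>2 * (norm (c k))\<^sup>2" if "a \<in> W" for a k r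
  proof -
    have "s a \<bullet> c k = 0" by (simp add: adj_right adjc)
    then have "(norm (s a + r *\<^sub>R c k))\<^sup>2 = (norm (s a))\<^sup>2 + r\<^sup>2 * (norm (c k))\<^sup>2"
      by (simp add: norm_add_orthogonal power_mult_distrib)
    then show ?thesis using s'(3)[OF that] by simp
  qed
  have E: "conj_ext s u k = s (u (adj s k)) + c k" for k
    by (simp add: conj_ext_apply c_def blinfun.diff_right)
  have "norm (conj_ext s u k) = norm k" for k
  proof -
    have "(norm (conj_ext s u k))\<^sup>2 = (norm k)\<^sup>2"
      using pyth[of "u (adj s k)" 1 k] pyth[of "adj s k" 1 k] s'(6)[of k] pres u'(2) ck[of k]
      by (simp add: E)
    then show ?thesis by simp
  qed
  moreover have "surj (blinfun_apply (conj_ext s u))"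
  proof -
    have "\<exists>x. conj_ext s u x = k" for k
    proof -
      obtain a where a: "u a = adj s k" using u'(3) by (metis surjD)
      then have "a \<in> W" using pres[of a] s'(6) by simp
      then have 1: "adj s (s a + c k) = a" by (simp add: blinfun.add_right adjc s'(7))
      moreover have "c (s a + c k) = c k" unfolding c_def[of "s a + c k"] 1 by simp
      ultimately have "conj_ext s u (s a + c k) = k" unfolding E using ck[of k] a by simp
      then show ?thesis by blast
    qed
    then show ?thesis by (metis surjI)
  qed
  moreover have "clin (conj_ext s u)"
    unfolding conj_ext_def by (intro clin_intros s' u')
  moreover have "ess_below (conj_ext s u + id_blinfun)"
  proof -
    obtain B e where B: "finite B" "0 < e"
        "\<And>v. v \<in> orth_comp B \<Longrightarrow> e * norm v \<le> norm ((u + id_blinfun) v)"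
      using u'(4) unfolding ess_below_def by blast
    \<comment> \<open>On the complement of the image of \<open>W\<close> the conjugate plus 1 is
      multiplication by 2.\<close>
    define m where "m = min e 2"
    have m: "0 < m" "m \<le> e" "m \<le> 2" using B(2) by (auto simp: m_def)
    have "m * norm k \<le> norm ((conj_ext s u + id_blinfun) k)" if k: "k \<in> orth_comp (blinfun_apply s ` B)" for k
    proof -
      define a where "a = adj s k"
      have "a \<in> orth_comp B"
        using k cinner_adj[OF clin_adj[OF s'(2)]] by (auto simp: orth_comp_def a_def)
      then have le: "m * norm a \<le> norm (u a + a)"
        using B(3)[of a] m by (simp add: plus_blinfun.rep_eq) (meson mult_right_mono norm_ge_zero order_trans)
      have aW: "u a + a \<in> W" "a \<in> W"
        using pres s'(6) csub by (auto simp: a_def cvec.subspace_add)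
      have "(conj_ext s u + id_blinfun) k = s (u a + a) + 2 *\<^sub>R c k"
        using ck[of k] by (simp add: plus_blinfun.rep_eq E a_def blinfun.add_right scaleR_2)
      then have "(norm ((conj_ext s u + id_blinfun) k))\<^sup>2 = (norm (u a + a))\<^sup>2 + 4 * (norm (c k))\<^sup>2"
        using pyth[OF aW(1), of 2 k] by simp
      moreover have "(norm k)\<^sup>2 = (norm a)\<^sup>2 + (norm (c k))\<^sup>2"
        using pyth[OF aW(2), of 1 k] ck[of k] by (simp add: a_def)
      moreover have "m\<^sup>2 * (norm a)\<^sup>2 \<le> (norm (u a + a))\<^sup>2"
        using power_mono[OF le, of 2] m by (simp add: power_mult_distrib)
      moreover have "m\<^sup>2 * (norm (c k))\<^sup>2 \<le> 4 * (norm (c k))\<^sup>2"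
        using power_mono[OF m(3), of 2] m by (intro mult_right_mono) auto
      ultimately have "(m * norm k)\<^sup>2 \<le> (norm ((conj_ext s u + id_blinfun) k))\<^sup>2"
        by (simp add: power_mult_distrib distrib_left)
      then show ?thesis by (rule power2_le_imp_le) simp
    qed
    then show ?thesis unfolding ess_below_def using B(1) m(1) by blast
  qed
  ultimately show ?thesis by (simp add: UE_def)
qed

section \<open>Norm-continuous families and homotopies\<close>

text \<open>Expressing continuity over an abstract topology by limits along \<open>atin X x\<close>
  makes the limit rules for sums, compositions, adjoints and inverses applicable.\<close>

lemma continuous_map_euclidean_iff:
  "continuous_map X euclidean f \<longleftrightarrow> (\<forall>x\<in>topspace X. (f \<longlongrightarrow> f x) (atin X x))"
  by (simp add: continuous_map_atin limitin_canonical_iff)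

named_theorems cont_intros

lemma cont_const [cont_intros]: "continuous_map X euclidean (\<lambda>x. c)"
  by simp

lemma cont_add [cont_intros]:
  fixes f g :: "'x \<Rightarrow> 'b::real_normed_vector"
  shows "continuous_map X euclidean f \<Longrightarrow> continuous_map X euclidean g \<Longrightarrow>
    continuous_map X euclidean (\<lambda>x. f x + g x)"
  unfolding continuous_map_euclidean_iff by (auto intro!: tendsto_intros)

lemma cont_diff [cont_intros]:
  fixes f g :: "'x \<Rightarrow> 'b::real_normed_vector"
  shows "continuous_map X euclidean f \<Longrightarrow> continuous_map X euclidean g \<Longrightarrow>
    continuous_map X euclidean (\<lambda>x. f x - g x)"
  unfolding continuous_map_euclidean_iff by (auto intro!: tendsto_intros)

lemma cont_minus [cont_intros]:
  fixes f :: "'x \<Rightarrow> 'b::real_normed_vector"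
  shows "continuous_map X euclidean f \<Longrightarrow> continuous_map X euclidean (\<lambda>x. - f x)"
  unfolding continuous_map_euclidean_iff by (auto intro!: tendsto_intros)

lemma cont_scaleR [cont_intros]:
  fixes f :: "'x \<Rightarrow> 'b::real_normed_vector"
  shows "continuous_map X euclidean r \<Longrightarrow> continuous_map X euclidean f \<Longrightarrow>
    continuous_map X euclidean (\<lambda>x. r x *\<^sub>R f x)"
  unfolding continuous_map_euclidean_iff by (auto intro!: tendsto_intros)

lemma cont_compose [cont_intros]:
  fixes f :: "'x \<Rightarrow> 'b::real_normed_vector \<Rightarrow>\<^sub>L 'c::real_normed_vector"
    and g :: "'x \<Rightarrow> 'a::real_normed_vector \<Rightarrow>\<^sub>L 'b"
  shows "continuous_map X euclidean f \<Longrightarrow> continuous_map X euclidean g \<Longrightarrow>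
    continuous_map X euclidean (\<lambda>x. f x o\<^sub>L g x)"
  unfolding continuous_map_euclidean_iff
  by (auto intro!: bounded_bilinear.tendsto[OF bounded_bilinear_blinfun_compose])

lemma cont_adj [cont_intros]:
  "continuous_map X euclidean f \<Longrightarrow> continuous_map X euclidean (\<lambda>x. adj (f x))"
  unfolding continuous_map_euclidean_iff by (auto intro!: tendsto_adj)

lemma cont_binv:
  "continuous_map X euclidean f \<Longrightarrow> (\<And>x. x \<in> topspace X \<Longrightarrow> \<exists>d>0. coercive d (f x)) \<Longrightarrow>
    continuous_map X euclidean (\<lambda>x. binv (f x))"
  unfolding continuous_map_euclidean_iff using tendsto_binv by blast

lemma cont_real:
  fixes f :: "'x \<Rightarrow> real" and g :: "real \<Rightarrow> 'b::topological_space"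
  shows "continuous_map X euclidean f \<Longrightarrow> continuous_on UNIV g \<Longrightarrow>
    continuous_map X euclidean (\<lambda>x. g (f x))"
  using continuous_map_compose[of X euclidean f euclidean g] by (simp add: o_def)

lemma cont_conj_ext [cont_intros]:
  "continuous_map X euclidean s \<Longrightarrow> continuous_map X euclidean u \<Longrightarrow>
    continuous_map X euclidean (\<lambda>x. conj_ext (s x) (u x))"
  unfolding conj_ext_def by (intro cont_intros)

abbreviation "cyl X \<equiv> prod_topology (top_of_set {0..1::real}) X"

lemma cont_cyl_fst [cont_intros]: "continuous_map (cyl X) euclidean fst"
  by (metis continuous_map_fst continuous_map_into_fulltopology)

lemma cont_cyl_snd:
  "continuous_map X Y f \<Longrightarrow> continuous_map (cyl X) Y (\<lambda>p. f (snd p))"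
  using continuous_map_compose[OF continuous_map_snd, of X Y f "top_of_set {0..1::real}"]
  by (simp add: o_def)

definition UE_homotopic where
  "UE_homotopic X f g \<longleftrightarrow> homotopic_with (\<lambda>_. True) X (top_of_set UE) f g"

lemma UE_homotopicI:
  assumes "continuous_map (cyl X) euclidean h"
    and "\<And>t x. t \<in> {0..1} \<Longrightarrow> x \<in> topspace X \<Longrightarrow> h (t, x) \<in> UE"
    and "\<And>x. x \<in> topspace X \<Longrightarrow> h (0, x) = f x" "\<And>x. x \<in> topspace X \<Longrightarrow> h (1, x) = g x"
  shows "UE_homotopic X f g"
  unfolding UE_homotopic_def
proof (subst homotopic_with)
  show "\<exists>h. continuous_map (cyl X) (top_of_set UE) h \<and> (\<forall>x\<in>topspace X. h (0, x) = f x) \<and>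
      (\<forall>x\<in>topspace X. h (1, x) = g x) \<and> (\<forall>t\<in>{0..1}. True)"
    using assms by (intro exI[of _ h]) (auto simp: continuous_map_in_subtopology)
qed simp

lemma UE_homotopic_trans [trans]: "UE_homotopic X f g \<Longrightarrow> UE_homotopic X g h \<Longrightarrow> UE_homotopic X f h"
  unfolding UE_homotopic_def by (rule homotopic_with_trans)

lemma UE_homotopic_sym: "UE_homotopic X f g \<Longrightarrow> UE_homotopic X g f"
  unfolding UE_homotopic_def by (rule homotopic_with_symD)

lemma UE_homotopic_refl:
  assumes "continuous_map X euclidean f" "\<And>x. x \<in> topspace X \<Longrightarrow> f x \<in> UE"
    "\<And>x. x \<in> topspace X \<Longrightarrow> f x = g x"
  shows "UE_homotopic X f g"
  unfolding UE_homotopic_def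
  using assms by (intro homotopic_with_equal) (auto simp: continuous_map_in_subtopology)

text \<open>Orthogonality of the two ranges makes cos times \<open>s\<close> plus sin times
  \<open>s'\<close> a partial isometry with the same initial space for every angle.\<close>

lemma UE_homotopic_rotate:
  fixes s s' :: "'x \<Rightarrow> 'a::sep_chilbert \<Rightarrow>\<^sub>L 'b::sep_chilbert"
  assumes cont: "continuous_map X euclidean s" "continuous_map X euclidean s'"
      "continuous_map X euclidean u"
    and s: "\<And>x. x \<in> topspace X \<Longrightarrow> part_isom (W x) (s x) \<and> part_isom (W x) (s' x)"
    and orth: "\<And>x y z. x \<in> topspace X \<Longrightarrow> s x y \<bullet> s' x z = 0"
    and u: "\<And>x. x \<in> topspace X \<Longrightarrow> u x \<in> UE"
    and fx: "\<And>x w. x \<in> topspace X \<Longrightarrow> w \<in> orth_comp (W x) \<Longrightarrow> u x w = w"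
  shows "UE_homotopic X (\<lambda>x. conj_ext (s x) (u x)) (\<lambda>x. conj_ext (s' x) (u x))"
proof (rule UE_homotopicI)
  define r where "r t x = cos (pi / 2 * t) *\<^sub>R s x + sin (pi / 2 * t) *\<^sub>R s' x" for t x
  show "continuous_map (cyl X) euclidean (\<lambda>p. conj_ext (r (fst p) (snd p)) (u (snd p)))"
    unfolding r_def
    by (intro cont_intros cont_cyl_snd cont cont_real[OF cont_cyl_fst, where g = "\<lambda>t. cos (pi / 2 * t)"]
        cont_real[OF cont_cyl_fst, where g = "\<lambda>t. sin (pi / 2 * t)"] continuous_intros)
  fix x assume x: "x \<in> topspace X"
  note s1 = part_isom_D[OF conjunct1[OF s[OF x]]] and s2 = part_isom_D[OF conjunct2[OF s[OF x]]]
  have "part_isom (W x) (r t x)" for t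
    unfolding part_isom_def
  proof (intro conjI ballI)
    show "closed_csubspace (W x)" by (rule s1)
    show "clin (r t x)" unfolding r_def by (intro clin_intros s1 s2)
    show "r t x w = 0" if "w \<in> orth_comp (W x)" for w
      using s1(4)[OF that] s2(4)[OF that] by (simp add: r_def plus_blinfun.rep_eq scaleR_blinfun.rep_eq)
    fix w assume w: "w \<in> W x"
    have "(norm (r t x w))\<^sup>2 = (cos (pi / 2 * t))\<^sup>2 * (norm (s x w))\<^sup>2 + (sin (pi / 2 * t))\<^sup>2 * (norm (s' x w))\<^sup>2"
      using orth[OF x, of w w]
      by (simp add: r_def plus_blinfun.rep_eq scaleR_blinfun.rep_eq norm_add_orthogonal power_mult_distrib)
    also have "\<dots> = (norm w)\<^sup>2"
      using s1(3)[OF w] s2(3)[OF w] by (simp add: distrib_right[symmetric])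
    finally show "norm (r t x w) = norm w" by simp
  qed
  then show "conj_ext (r (fst (t, x)) (snd (t, x))) (u (snd (t, x))) \<in> UE" for t
    using u[OF x] fx[OF x] by (auto intro: conj_ext_UE)
qed (simp_all)

section \<open>The Moebius deformation\<close>

text \<open>With \<open>F = (1 + i s)/(1 - i s)\<close> the deformation rescales the Cayley parameter \<open>s\<close> to
  \<open>l s\<close>.  As \<open>l\<close> tends to 0, the spectrum away from \<open>- 1\<close> is pushed to \<open>1\<close>.\<close>

definition mden :: "real \<Rightarrow> ('a::sep_chilbert \<Rightarrow>\<^sub>L 'a) \<Rightarrow> 'a \<Rightarrow>\<^sub>L 'a" where
  "mden l F = (1 + l) *\<^sub>R id_blinfun + (1 - l) *\<^sub>R F"

definition mnum :: "real \<Rightarrow> ('a::sep_chilbert \<Rightarrow>\<^sub>L 'a) \<Rightarrow> 'a \<Rightarrow>\<^sub>L 'a" where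
  "mnum l F = (1 - l) *\<^sub>R id_blinfun + (1 + l) *\<^sub>R F"

text \<open>The quotient of \<open>mnum l F\<close> by \<open>mden l F\<close>, which is the Cayley
  transform of the rescaled parameter. Written as a perturbation of 1, it displays its distance from
  1 and makes sense at \<open>l = 0\<close>.\<close>

definition moebius :: "real \<Rightarrow> ('a::sep_chilbert \<Rightarrow>\<^sub>L 'a) \<Rightarrow> 'a \<Rightarrow>\<^sub>L 'a" where
  "moebius l F = id_blinfun + (2 * l) *\<^sub>R (binv (mden l F) o\<^sub>L (F - id_blinfun))"

lemmas blinfun_rep = plus_blinfun.rep_eq minus_blinfun.rep_eq scaleR_blinfun.rep_eq uminus_blinfun.rep_eq
  blinfun.add_right blinfun.diff_right blinfun.scaleR_right blinfun.minus_right

lemma mden_apply: "mden l F x = (1 + l) *\<^sub>R x + (1 - l) *\<^sub>R F x"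
  by (simp add: mden_def blinfun_rep)

lemma mnum_apply: "mnum l F x = (1 - l) *\<^sub>R x + (1 + l) *\<^sub>R F x"
  by (simp add: mnum_def blinfun_rep)

lemma mnum_eq_mden: "mnum l F x = mden l F x + (2 * l) *\<^sub>R (F x - x)"
proof -
  have "(2 * l) *\<^sub>R v = l *\<^sub>R v + l *\<^sub>R v" for v :: 'a
    by (simp add: scaleR_add_left[symmetric])
  then show ?thesis
    by (simp add: mden_apply mnum_apply scaleR_right_diff_distrib scaleR_left_distrib
        scaleR_left_diff_distrib)
qed

lemma moebius_apply: "moebius l F x = x + (2 * l) *\<^sub>R binv (mden l F) (F x - x)"
  by (simp add: moebius_def blinfun_rep)

context
  fixes l d :: real and F :: "'a::sep_chilbert \<Rightarrow>\<^sub>L 'a"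
  assumes co: "coercive d (mden l F)" "0 < d"
begin

lemma mden_moebius: "mden l F (moebius l F x) = mnum l F x"
proof -
  have "mden l F (moebius l F x) = mden l F x + (2 * l) *\<^sub>R (F x - x)"
    using binv_coercive(1)[OF co] by (simp add: moebius_apply blinfun_rep)
  then show ?thesis by (simp add: mnum_eq_mden)
qed

lemma moebius_mden: "moebius l F (mden l F y) = mnum l F y"
proof -
  have "F (mden l F y) - mden l F y = mden l F (F y - y)"
    by (simp add: mden_apply blinfun_rep algebra_simps)
  then have "moebius l F (mden l F y) = mden l F y + (2 * l) *\<^sub>R (F y - y)"
    using binv_coercive(2)[OF co] by (simp add: moebius_apply)
  then show ?thesis by (simp add: mnum_eq_mden)
qed

text \<open>For isometric \<open>F\<close>, numerator and denominator have equal norm on every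
  vector, since they differ by exchanging the coefficients of \<open>y\<close> and
  \<open>F y\<close>.\<close>

lemma moebius_unitary:
  assumes n: "\<And>x. norm (F x) = norm x" and surj: "surj (blinfun_apply F)"
  shows "norm (moebius l F x) = norm x" "surj (blinfun_apply (moebius l F))"
proof -
  define y where "y = binv (mden l F) x"
  have x: "mden l F y = x" unfolding y_def by (rule binv_coercive(1)[OF co])
  have "(norm (mnum l F y))\<^sup>2 = (norm (mden l F y))\<^sup>2"
    using n[of y] unfolding power2_norm_eq_inner mnum_apply mden_apply norm_eq_sqrt_inner
    by (simp add: inner_add_left inner_add_right inner_commute algebra_simps)
  then show "norm (moebius l F x) = norm x"
    using moebius_mden[of y] x by simp
  have co': "coercive d (adj (mden l F))"
    using co(1) unfolding coercive_def adj_left by (simp add: inner_commute)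
  \<comment> \<open>The numerator is \<open>F\<close> composed with the adjoint of the denominator,
    and that adjoint is coercive too.\<close>
  have "\<exists>y. mnum l F y = z" for z
  proof -
    obtain y where y: "adj (mden l F) y = adj F z"
      using coercive_surj[OF co' co(2)] by (metis surjD)
    have "adj (mden l F) = (1 + l) *\<^sub>R id_blinfun + (1 - l) *\<^sub>R adj F"
      by (rule adj_eqI) (simp add: mden_apply blinfun_rep inner_add_left inner_add_right adj_right)
    then have "F (adj (mden l F) y) = (1 + l) *\<^sub>R F y + (1 - l) *\<^sub>R y"
      using adj_unitary(1)[OF n surj] by (simp add: blinfun_rep)
    then have "mnum l F y = z" using y adj_unitary(1)[OF n surj] by (simp add: mnum_apply add.commute)
    then show ?thesis by blast
  qed
  then show "surj (blinfun_apply (moebius l F))" by (metis moebius_mden surj_def)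
qed

lemma clin_moebius: "clin F \<Longrightarrow> clin (moebius l F)"
  unfolding moebius_def using co by (intro clin_intros clin_binv[OF _ co]) (simp_all add: mden_def clin_intros)

end

lemma coercive_mden:
  assumes "\<And>x. norm (blinfun_apply F x) = norm x" "0 \<le> l" "l \<le> 1"
  shows "coercive (2 * l) (mden l F)"
  unfolding coercive_def
proof
  fix x
  have "\<bar>F x \<bullet> x\<bar> \<le> (norm x)\<^sup>2"
    using Cauchy_Schwarz_ineq2[of "F x" x] assms(1) by (simp add: power2_eq_square)
  then have "(1 - l) * (- (norm x)\<^sup>2) \<le> (1 - l) * (F x \<bullet> x)"
    using assms(3) by (intro mult_left_mono) auto
  then show "2 * l * (norm x)\<^sup>2 \<le> mden l F x \<bullet> x"
    by (simp add: mden_apply inner_add_left power2_norm_eq_inner algebra_simps)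
qed

text \<open>Numerator plus denominator is 2 (F + 1), and the denominator has norm at most 2; so the
  deformed operator plus 1 dominates \<open>F + 1\<close> pointwise.\<close>

lemma moebius_UE:
  assumes F: "F \<in> UE" and l: "0 < l" "l \<le> 1"
  shows "moebius l F \<in> UE"
proof -
  note F' = UE_D[OF F]
  have co: "coercive (2 * l) (mden l F)" by (rule coercive_mden) (use F' l in auto)
  have l2: "0 < 2 * l" using l by simp
  have "norm ((F + id_blinfun) x) \<le> norm ((moebius l F + id_blinfun) x)" for x
  proof -
    have "mden l F ((moebius l F + id_blinfun) x) = 2 *\<^sub>R ((F + id_blinfun) x)"
      using mden_moebius[OF co l2, of x]
      by (simp add: blinfun_rep mnum_apply mden_apply algebra_simps scaleR_2)
    moreover have "norm (mden l F z) \<le> 2 * norm z" for z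
    proof -
      have "norm (mden l F z) \<le> norm ((1 + l) *\<^sub>R z) + norm ((1 - l) *\<^sub>R F z)"
        unfolding mden_apply by (rule norm_triangle_ineq)
      also have "\<dots> = (1 + l) * norm z + (1 - l) * norm z" using l F'(2) by simp
      also have "\<dots> = 2 * norm z" by (simp add: algebra_simps)
      finally show ?thesis .
    qed
    ultimately have "norm (2 *\<^sub>R ((F + id_blinfun) x)) \<le> 2 * norm ((moebius l F + id_blinfun) x)"
      by metis
    then show ?thesis by simp
  qed
  then have "ess_below (moebius l F + id_blinfun)"
    using F'(4) unfolding ess_below_def by (meson order_trans)
  then show ?thesis
    unfolding UE_def using moebius_unitary[OF co l2 F'(2,3)] clin_moebius[OF co l2 F'(1)] by simp
qed

lemma moebius_one [simp]: "moebius 1 F = F"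
proof (rule blinfun_eqI)
  fix x
  have co: "coercive 2 (mden 1 F)" by (simp add: coercive_def mden_apply power2_norm_eq_inner)
  have "mden 1 F (moebius 1 F x) = mnum 1 F x" by (rule mden_moebius[OF co]) simp
  then show "moebius 1 F x = F x" by (simp add: mden_apply mnum_apply)
qed

lemma moebius_zero [simp]: "moebius 0 F = id_blinfun"
  by (simp add: moebius_def)

lemma cont_moebius:
  assumes "continuous_map X euclidean l" "continuous_map X euclidean F"
    and "\<And>x. x \<in> topspace X \<Longrightarrow> \<exists>d>0. coercive d (mden (l x) (F x))"
  shows "continuous_map X euclidean (\<lambda>x. moebius (l x) (F x))"
  unfolding moebius_def
  using assms(3) unfolding mden_def
  by (intro cont_intros cont_binv assms(1,2)
      cont_real[OF assms(1), where g = "\<lambda>t. 2 * t"] cont_real[OF assms(1), where g = "\<lambda>t. 1 + t"]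
      cont_real[OF assms(1), where g = "\<lambda>t. 1 - t"] continuous_intros) auto

text \<open>Close families are joined by the deformation of \<open>f g*\<close> to \<open>1\<close>, times \<open>g\<close>.\<close>

lemma UE_homotopic_close:
  fixes f g :: "'x \<Rightarrow> 'a::sep_chilbert \<Rightarrow>\<^sub>L 'a"
  assumes cont: "continuous_map X euclidean f" "continuous_map X euclidean g"
    and f: "\<And>x. x \<in> topspace X \<Longrightarrow> f x \<in> UE" and g: "\<And>x. x \<in> topspace X \<Longrightarrow> g x \<in> UE"
    and close: "\<And>x v. x \<in> topspace X \<Longrightarrow> norm (f x v - g x v) \<le> (1/2) * norm v"
    and ess: "\<And>x. x \<in> topspace X \<Longrightarrow>
      \<exists>B. finite B \<and> (\<forall>v\<in>orth_comp B. norm (g x v - v) \<le> (1/2) * norm v)"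
  shows "UE_homotopic X f g"
proof (rule UE_homotopic_sym, rule UE_homotopicI)
  define w where "w x = f x o\<^sub>L adj (g x)" for x
  have w: "norm (w x v) = norm v" "surj (blinfun_apply (w x))" "clin (w x)"
     "norm (w x v - v) \<le> (1/2) * norm v" if "x \<in> topspace X" for x v
  proof -
    note f' = UE_D[OF f[OF that]] and g' = UE_D[OF g[OF that]]
    note ag = adj_unitary[OF g'(2,3)]
    show "norm (w x v) = norm v" by (simp add: w_def f' ag)
    have "blinfun_apply (w x) = blinfun_apply (f x) \<circ> blinfun_apply (adj (g x))"
      by (auto simp: w_def)
    then show "surj (blinfun_apply (w x))" using comp_surj[OF ag(3) f'(3)] by metis
    show "clin (w x)" unfolding w_def by (intro clin_intros f' g')
    show "norm (w x v - v) \<le> (1/2) * norm v"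
      using close[OF that, of "adj (g x) v"] ag(1,2) by (simp add: w_def)
  qed
  \<comment> \<open>Closeness gives \<open>w x\<close> real part at least 1/2, so the denominator
    has real part at least (1 + t) + (1 - t)/2, which is at least 3/2. This is uniform down to t =
    0, where the general bound 2 t degenerates.\<close>
  have co: "coercive (3/2) (mden t (w x))" if "x \<in> topspace X" "t \<in> {0..1}" for x t
    unfolding coercive_def
  proof
    fix y
    have "(y - w x y) \<bullet> y \<le> (1/2) * norm y * norm y"
      using norm_cauchy_schwarz[of "y - w x y" y] w(4)[OF that(1), of y]
        mult_right_mono[of "norm (y - w x y)" "(1/2) * norm y" "norm y"]
      by (simp add: norm_minus_commute)
    then have 1: "(1/2) * (y \<bullet> y) \<le> w x y \<bullet> y"
      by (simp add: inner_diff_left power2_norm_eq_inner[symmetric] power2_eq_square)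
    define p q where "p = y \<bullet> y" and "q = w x y \<bullet> y"
    have "(1 - t) * ((1/2) * p) \<le> (1 - t) * q"
      using that(2) 1 unfolding p_def q_def by (intro mult_left_mono) auto
    moreover have "0 \<le> t * p" using that(2) by (simp add: p_def)
    ultimately have "3 / 2 * p \<le> (1 + t) * p + (1 - t) * q"
      by (simp add: field_simps)
    then show "3 / 2 * (norm y)\<^sup>2 \<le> mden t (w x) y \<bullet> y"
      by (simp add: mden_apply inner_add_left power2_norm_eq_inner p_def q_def)
  qed
  have c32: "(0::real) < 3/2" by simp
  show "continuous_map (cyl X) euclidean (\<lambda>p. moebius (fst p) (w (snd p)) o\<^sub>L g (snd p))"
  proof (intro cont_intros cont_moebius)
    show "continuous_map (cyl X) euclidean (\<lambda>p. g (snd p))" by (intro cont_cyl_snd cont)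
    show "continuous_map (cyl X) euclidean (\<lambda>p. w (snd p))"
      unfolding w_def by (intro cont_cyl_snd cont_intros cont)
    show "\<exists>d>0. coercive d (mden (fst p) (w (snd p)))" if "p \<in> topspace (cyl X)" for p
      using that by (intro exI[of _ "3/2"] conjI c32 co) auto
  qed
  fix t :: real and x assume t: "t \<in> {0..1}" and x: "x \<in> topspace X"
  note g' = UE_D[OF g[OF x]] and c = co[OF x t]
  define m where "m = moebius t (w x)"
  have m: "norm (m v) = norm v" "surj (blinfun_apply m)" "clin m" for v
    unfolding m_def using moebius_unitary[OF c c32 w(1,2)[OF x]] clin_moebius[OF c c32 w(3)[OF x]] by auto
  \<comment> \<open>The factor is 2 t times 2/3 from the inverse times 1/2 from closeness.\<close>
  have m1: "norm (m v - v) \<le> (2/3) * norm v" for v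
  proof -
    have "(3/2) * norm (binv (mden t (w x)) (w x v - v)) \<le> norm (w x v - v)"
      by (rule binv_coercive(3)[OF c c32])
    then have "norm (binv (mden t (w x)) (w x v - v)) \<le> (1/3) * norm v"
      using w(4)[OF x, of v] by linarith
    moreover have "norm (m v - v) = 2 * (t * norm (binv (mden t (w x)) (w x v - v)))"
      using t by (simp add: m_def moebius_apply)
    moreover have "t * norm (binv (mden t (w x)) (w x v - v)) \<le> norm (binv (mden t (w x)) (w x v - v))"
      using t by (simp add: mult_left_le_one_le)
    ultimately show ?thesis by linarith
  qed
  have "ess_below ((m o\<^sub>L g x) + id_blinfun)"
  proof -
    obtain B where B: "finite B" "\<And>v. v \<in> orth_comp B \<Longrightarrow> norm (g x v - v) \<le> (1/2) * norm v"
      using ess[OF x] by blast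
    \<comment> \<open>The constant is 2 - 2/3 - 1/2: the deformation moves a vector by at most 2/3
      and \<open>g x\<close> moves it by at most 1/2.\<close>
    have "(5/6) * norm v \<le> norm (((m o\<^sub>L g x) + id_blinfun) v)" if "v \<in> orth_comp B" for v
    proof -
      have "norm (2 *\<^sub>R v) \<le> norm (m (g x v) + v) + norm (m (g x v) - g x v) + norm (g x v - v)"
        using norm_triangle_ineq4[of "m (g x v) + v" "m (g x v) - v"]
          norm_triangle_ineq[of "m (g x v) - g x v" "g x v - v"] by (simp add: scaleR_2)
      then show ?thesis
        using m1[of "g x v"] B(2)[OF that] g'(2)[of v] by (simp add: plus_blinfun.rep_eq)
    qed
    then show ?thesis unfolding ess_below_def using B(1) by (intro exI[of _ B] exI[of _ "5/6"]) auto
  qed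
  moreover have "surj (blinfun_apply (m o\<^sub>L g x))"
  proof -
    have "blinfun_apply (m o\<^sub>L g x) = blinfun_apply m \<circ> blinfun_apply (g x)" by auto
    then show ?thesis using comp_surj[OF g'(3) m(2)] by metis
  qed
  moreover have "clin (m o\<^sub>L g x)" by (intro clin_intros m g')
  moreover have "norm ((m o\<^sub>L g x) v) = norm v" for v by (simp add: m(1) g'(2))
  ultimately show "moebius (fst (t, x)) (w (snd (t, x))) o\<^sub>L g (snd (t, x)) \<in> UE"
    by (simp add: UE_def m_def)
next
  fix x assume x: "x \<in> topspace X"
  show "moebius (fst (0, x)) (f (snd (0, x)) o\<^sub>L adj (g (snd (0, x)))) o\<^sub>L g (snd (0, x)) = g x"
    by (rule blinfun_eqI) simp
  show "moebius (fst (1, x)) (f (snd (1, x)) o\<^sub>L adj (g (snd (1, x)))) o\<^sub>L g (snd (1, x)) = f x"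
    by (rule blinfun_eqI) (simp add: adj_isometry UE_D[OF g[OF x]])
qed

section \<open>Stabilization\<close>

text \<open>Expansion in a finite orthonormal basis turns strong convergence into uniform
  convergence on the unit ball.\<close>

lemma strong_convergence_finite_dim:
  fixes A :: "real \<Rightarrow> 'a::sep_chilbert \<Rightarrow>\<^sub>L 'b::sep_chilbert"
  assumes N: "finite_dim N" and A: "\<And>t. clin (A t)" "\<And>v. ((\<lambda>t. A t v) \<longlongrightarrow> 0) at_top" and "0 < e"
  shows "\<forall>\<^sub>F t in at_top. \<forall>v\<in>N. norm (A t v) \<le> e * norm v"
proof -
  obtain C where C: "finite C" "orthonormal C" "N \<subseteq> cvec.span C"
    using N finite_orthonormal_basis unfolding finite_dim_def by metis
  have "((\<lambda>t. \<Sum>c\<in>C. 2 * norm c * norm (A t c)) \<longlongrightarrow> (\<Sum>c\<in>C. 2 * norm c * norm (0::'b))) at_top"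
    by (intro tendsto_intros A)
  then have "\<forall>\<^sub>F t in at_top. (\<Sum>c\<in>C. 2 * norm c * norm (A t c)) < e"
    using \<open>0 < e\<close> by (intro order_tendstoD(2)) auto
  then show ?thesis
  proof (rule eventually_mono, intro ballI)
    fix t v assume le: "(\<Sum>c\<in>C. 2 * norm c * norm (A t c)) < e" and "v \<in> N"
    then have "v = (\<Sum>c\<in>C. cinner v c *\<^sub>C c)" using orthonormal_expansion[OF C(1,2)] C(3) by blast
    then have "A t v = A t (\<Sum>c\<in>C. cinner v c *\<^sub>C c)" by (rule arg_cong)
    also have "\<dots> = (\<Sum>c\<in>C. cinner v c *\<^sub>C A t c)"
      by (simp add: blinfun.sum_right clin_scaleC[OF A(1)])
    finally have "norm (A t v) \<le> (\<Sum>c\<in>C. cmod (cinner v c) * norm (A t c))"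
      using norm_sum[of "\<lambda>c. cinner v c *\<^sub>C A t c" C] by simp
    also have "\<dots> \<le> (\<Sum>c\<in>C. 2 * norm v * norm c * norm (A t c))"
      by (intro sum_mono mult_right_mono cmod_cinner_le) simp
    also have "\<dots> = (\<Sum>c\<in>C. 2 * norm c * norm (A t c)) * norm v"
      by (simp add: sum_distrib_left sum_distrib_right mult_ac)
    also have "\<dots> \<le> e * norm v" using le by (intro mult_right_mono) auto
    finally show "norm (A t v) \<le> e * norm v" .
  qed
qed

section \<open>Replacing a path of unitaries by its strong limit\<close>

context
  fixes V :: "real \<Rightarrow> 'a::sep_chilbert \<Rightarrow>\<^sub>L 'a" and R :: "'a \<Rightarrow>\<^sub>L 'a"
  assumes V: "\<And>t. clin (V t)" "\<And>t x. norm (V t x) = norm x" "V 0 = id_blinfun" "continuous_on UNIV V"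
    and R: "clin R" "\<And>x. norm (R x) = norm x" and VR: "\<And>x. ((\<lambda>t. V t x) \<longlongrightarrow> R x) at_top"
begin

text \<open>Conjugation by \<open>V t\<close> and by \<open>R\<close> sees an operator only through
  its difference from 1. The first clause makes \<open>V t\<close> and \<open>R\<close> nearly agree
  on the range of that difference; the second is the essential closeness to 1 required by
  \<open>UE_homotopic_close\<close>.\<close>

definition good :: "('a \<Rightarrow>\<^sub>L 'a) \<Rightarrow> real \<Rightarrow> bool" where
  "good F t \<longleftrightarrow> (\<forall>x. norm ((V t - R) (moebius (1/t) F x - x)) \<le> (1/4) * norm x) \<and>
     (\<exists>B. finite B \<and> (\<forall>v\<in>orth_comp B. norm (moebius (1/t) F v - v) \<le> (1/2) * norm v))"

text \<open>Let \<open>N\<close> be the kernel of \<open>F0 + 1\<close>. For \<open>F\<close> near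
  \<open>F0\<close>, the operator \<open>F + 1\<close> stays bounded below off \<open>N\<close>, so
  strong rescaling pushes \<open>F\<close> to 1 there, and the difference from 1 takes values almost
  in \<open>N\<close>. On the finite-dimensional \<open>N\<close>, strong convergence of
  \<open>V t\<close> to \<open>R\<close> is uniform.\<close>

lemma good_locally:
  assumes F0: "F0 \<in> UE"
  shows "\<exists>r. 0 < r \<and> r \<le> 1 \<and> (\<forall>F\<in>UE. dist F F0 < r \<longrightarrow> (\<forall>t\<ge>1/r. good F t))"
proof -
  define N where "N = {x. (F0 + id_blinfun) x = 0}"
  note F0' = UE_D[OF F0]
  have c0: "clin (F0 + id_blinfun)" by (intro clin_intros F0')
  interpret N: closed_csubspace N unfolding N_def by (rule closed_csubspace_kernel[OF c0])
  have fd: "finite_dim N" unfolding N_def by (rule ess_below_split(1)[OF c0 F0'(4)])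
  obtain c where c: "0 < c" "\<And>v. v \<in> orth_comp N \<Longrightarrow> c * norm v \<le> norm (F0 v + v)"
    using ess_below_split(2)[OF c0 F0'(4)] unfolding N_def by (auto simp: plus_blinfun.rep_eq)
  \<comment> \<open>For isometric \<open>F\<close> the squared norm of \<open>F y + y\<close> is
    twice its pairing with \<open>y\<close>; the lower bound c/2 off \<open>N\<close> thus yields
    real part at least (c/2)^2 / 2.\<close>
  define d where "d = c\<^sup>2 / 8"
  have d: "0 < d" using c(1) by (simp add: d_def)
  have "((\<lambda>t. (V t - R) x) \<longlongrightarrow> 0) at_top" for x
    using tendsto_diff[OF VR[of x] tendsto_const[of "R x"]] by (simp add: minus_blinfun.rep_eq)
  then have "\<forall>\<^sub>F t in at_top. \<forall>v\<in>N. norm ((V t - R) v) \<le> (1/16) * norm v"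
    by (intro strong_convergence_finite_dim fd clin_intros V R) auto
  then obtain t0 where t0: "\<And>t v. t \<ge> t0 \<Longrightarrow> v \<in> N \<Longrightarrow> norm ((V t - R) v) \<le> (1/16) * norm v"
    unfolding eventually_at_top_linorder by blast
  \<comment> \<open>The bound c/2 preserves half of the lower bound off \<open>N\<close>. The bound
    d/256 gives r + 4 l at most d/32, where l = 1/t is at most r. The last one forces t past
    \<open>t0\<close>.\<close>
  define r where "r = min (min 1 (c/2)) (min (d/256) (1 / max t0 1))"
  have r: "0 < r" "r \<le> 1" "r \<le> c / 2" "r \<le> d / 256" "r \<le> 1 / max t0 1"
    using c(1) d by (simp_all add: r_def min_le_iff_disj)
  have "good F t" if F: "F \<in> UE" and dist: "dist F F0 < r" and t: "1 / r \<le> t" for F t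
  proof -
    note F' = UE_D[OF F]
    have tpos: "0 < t" using t r(1) by (meson divide_pos_pos less_le_trans zero_less_one)
    have "1 / t \<le> r" using t r(1) tpos by (simp add: field_simps)
    moreover have "t0 \<le> t"
    proof -
      define m where "m = max t0 1"
      have "0 < m" "t0 \<le> m" by (simp_all add: m_def)
      moreover have "r \<le> 1 / m" using r(5) by (simp add: m_def)
      ultimately have "t0 \<le> 1 / r" using r(1) by (simp add: field_simps) (metis mult.commute mult_left_mono less_imp_le order_trans)
      then show ?thesis using t by linarith
    qed
    ultimately have lr: "1 / t \<le> r" and t0t: "t0 \<le> t" by simp_all
    define l where "l = 1 / t"
    have l: "0 < l" "l \<le> 1" "l \<le> d / 256"
    proof -
      have "l \<le> r" using lr by (simp add: l_def)
      then show "l \<le> 1" "l \<le> d / 256" using r by linarith+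
    qed (use tpos in \<open>simp add: l_def\<close>)
    define D where "D = mden l F"
    have co: "coercive (2 * l) D" unfolding D_def by (rule coercive_mden) (use F' l in auto)
    have l2: "0 < 2 * l" using l by simp
    define k where "k x = (2 * l) *\<^sub>R binv D (F x - x)" for x
    have k: "moebius l F x - x = k x" for x by (simp add: moebius_apply k_def D_def)
    have FF0: "norm (F v - F0 v) \<le> r * norm v" for v
      using norm_blinfun[of "F - F0" v] dist
      by (simp add: minus_blinfun.rep_eq dist_norm) (meson less_imp_le mult_right_mono norm_ge_zero order_trans)
    \<comment> \<open>Split \<open>y = k x\<close> along \<open>N\<close> and test the equation
      \<open>D y = 2 l w\<close> against the part \<open>y2\<close> off \<open>N\<close>. The term
      \<open>D y1\<close> is small because \<open>F0\<close> is -1 on \<open>N\<close>, and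
      \<open>D\<close> has real part at least \<open>d\<close> on the complement of
      \<open>N\<close>.\<close>
    have key: "norm (k x) \<le> 2 * norm x" "norm (k x - Proj N (k x)) \<le> (1/16) * norm x" for x
    proof -
      define w where "w = F x - x"
      have w: "norm w \<le> 2 * norm x" using norm_triangle_ineq4[of "F x" x] F'(2)[of x] by (simp add: w_def)
      define y where "y = k x"
      have Dy: "D y = (2 * l) *\<^sub>R w"
        using binv_coercive(1)[OF co l2] by (simp add: y_def k_def w_def blinfun.scaleR_right)
      have y: "norm y \<le> norm w"
        using binv_coercive(3)[OF co l2, of w] l by (simp add: y_def k_def w_def)
      then show "norm (k x) \<le> 2 * norm x" using w by (simp add: y_def)
      define y1 y2 where "y1 = Proj N y" and "y2 = y - Proj N y"
      have y1: "y1 \<in> N" and y2: "y2 \<in> orth_comp N" and yy: "y = y1 + y2"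
        unfolding y1_def y2_def using N.Proj_in N.Proj_orth by auto
      have ny1: "norm y1 \<le> norm y" unfolding y1_def by (rule N.norm_Proj)
      have Dv: "D v = (F v + v) + l *\<^sub>R (v - F v)" for v
        by (simp add: D_def mden_apply algebra_simps)
      have iso: "F v \<bullet> F v = v \<bullet> v" for v using F'(2)[of v] by (simp add: norm_eq_sqrt_inner)
      have "d * (norm y2)\<^sup>2 \<le> D y2 \<bullet> y2"
      proof -
        have "c * norm y2 \<le> norm (F0 y2 + y2)" by (rule c(2)[OF y2])
        also have "\<dots> \<le> norm (F y2 + y2) + norm (F y2 - F0 y2)"
          using norm_triangle_ineq4[of "F y2 + y2" "F y2 - F0 y2"] by (simp add: algebra_simps)
        finally have "(c - r) * norm y2 \<le> norm (F y2 + y2)" using FF0[of y2] by (simp add: algebra_simps)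
        moreover have "(c / 2) * norm y2 \<le> (c - r) * norm y2" using r(3) by (intro mult_right_mono) auto
        ultimately have "(c / 2) * norm y2 \<le> norm (F y2 + y2)" by linarith
        then have "((c / 2) * norm y2)\<^sup>2 \<le> (norm (F y2 + y2))\<^sup>2" using c(1) by (intro power_mono) auto
        moreover have "(norm (F y2 + y2))\<^sup>2 = 2 * ((F y2 + y2) \<bullet> y2)"
          by (simp add: power2_norm_eq_inner inner_add_left inner_add_right iso inner_commute)
        ultimately have "d * (norm y2)\<^sup>2 \<le> (F y2 + y2) \<bullet> y2"
          by (simp add: d_def power_mult_distrib power_divide)
        moreover have "0 \<le> l * ((y2 - F y2) \<bullet> y2)"
          using norm_cauchy_schwarz[of "F y2" y2] F'(2)[of y2] l(1)
          by (intro mult_nonneg_nonneg) (auto simp: inner_diff_left norm_eq_sqrt_inner iso)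
        ultimately show ?thesis unfolding Dv by (simp add: inner_add_left)
      qed
      also have "\<dots> = (2 * l) * (w \<bullet> y2) - D y1 \<bullet> y2"
      proof -
        have "D y1 + D y2 = (2 * l) *\<^sub>R w" using Dy yy by (simp add: blinfun.add_right)
        then have "D y2 = (2 * l) *\<^sub>R w - D y1" by (metis add_diff_cancel_left')
        then show ?thesis by (simp add: inner_diff_left)
      qed
      also have "\<dots> \<le> (2 * l) * (norm w * norm y2) + ((r + 2 * l) * norm w) * norm y2"
      proof -
        have "(2 * l) * (w \<bullet> y2) \<le> (2 * l) * (norm w * norm y2)"
          using l by (intro mult_left_mono norm_cauchy_schwarz) auto
        have "F0 y1 + y1 = 0" using y1 by (simp add: N_def plus_blinfun.rep_eq)
        then have "D y1 = (F y1 - F0 y1) + l *\<^sub>R (y1 - F y1)"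
          unfolding Dv by (simp add: algebra_simps add_eq_0_iff)
        then have "norm (D y1) \<le> norm (F y1 - F0 y1) + l * norm (y1 - F y1)"
          using norm_triangle_ineq[of "F y1 - F0 y1" "l *\<^sub>R (y1 - F y1)"] l by simp
        also have "\<dots> \<le> r * norm y1 + l * (2 * norm y1)"
          using norm_triangle_ineq4[of y1 "F y1"] F'(2)[of y1] l FF0[of y1]
          by (intro add_mono mult_left_mono) auto
        also have "\<dots> = (r + 2 * l) * norm y1" by (simp add: algebra_simps)
        also have "\<dots> \<le> (r + 2 * l) * norm w" using ny1 y r(1) l by (intro mult_left_mono) auto
        finally have "norm (D y1) * norm y2 \<le> ((r + 2 * l) * norm w) * norm y2"
          by (intro mult_right_mono) auto
        then have "- (D y1 \<bullet> y2) \<le> ((r + 2 * l) * norm w) * norm y2"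
          using Cauchy_Schwarz_ineq2[of "D y1" y2] by linarith
        then show ?thesis using \<open>(2 * l) * (w \<bullet> y2) \<le> (2 * l) * (norm w * norm y2)\<close> by linarith
      qed
      also have "\<dots> = ((r + 4 * l) * norm w) * norm y2" by (simp add: algebra_simps)
      finally have "(d * norm y2) * norm y2 \<le> ((r + 4 * l) * norm w) * norm y2"
        by (simp add: power2_eq_square mult.assoc)
      then have "d * norm y2 \<le> (r + 4 * l) * norm w"
        using r(1) l by (cases "y2 = 0") (simp_all add: mult_le_cancel_right)
      also have "\<dots> \<le> (d / 32) * (2 * norm x)" using r l w d by (intro mult_mono) auto
      finally have "d * norm y2 \<le> d * ((1/16) * norm x)" by simp
      then have "norm y2 \<le> (1/16) * norm x" using d by (simp only: mult_le_cancel_left_pos)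
      then show "norm (k x - Proj N (k x)) \<le> (1/16) * norm x" by (simp add: y2_def y_def)
    qed
    show "good F t"
      unfolding good_def l_def[symmetric] k
    proof (intro conjI allI)
      fix x
      \<comment> \<open>The two parts contribute at most (1/16) 2 and 2 (1/16), in total
        1/4.\<close>
      define p q where "p = Proj N (k x)" and "q = k x - Proj N (k x)"
      have "norm ((V t - R) (k x)) \<le> norm ((V t - R) p) + norm ((V t - R) q)"
        using norm_triangle_ineq[of "(V t - R) p" "(V t - R) q"]
        by (simp add: blinfun.add_right[symmetric] p_def q_def)
      moreover have "norm ((V t - R) p) \<le> (1/16) * norm p"
        using t0[OF t0t] N.Proj_in by (simp add: p_def)
      moreover have "norm p \<le> 2 * norm x"
        using N.norm_Proj[of "k x"] key(1)[of x] by (simp add: p_def)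
      moreover have "norm ((V t - R) q) \<le> 2 * norm q"
        using norm_triangle_ineq4[of "V t q" "R q"] by (simp add: minus_blinfun.rep_eq V(2) R(2))
      moreover have "norm q \<le> (1/16) * norm x" using key(2)[of x] by (simp add: q_def)
      ultimately show "norm ((V t - R) (k x)) \<le> (1/4) * norm x" by simp
    next
      obtain B where B: "finite B" "N \<subseteq> cvec.span B" using fd by (auto simp: finite_dim_def)
      have "norm (k v) \<le> (1/2) * norm v" if "v \<in> orth_comp B" for v
      proof -
        have "v \<in> orth_comp N" using that B(2) unfolding orth_comp_span[symmetric, of B] by (auto simp: orth_comp_def)
        then have vN: "Proj N (k v) \<bullet> v = 0" using orth_comp_inner N.Proj_in by (metis inner_commute)
        \<comment> \<open>Since \<open>v + k v\<close> has the norm of \<open>v\<close>, the squared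
          norm of \<open>k v\<close> is -2 times its pairing with \<open>v\<close>. As
          \<open>v\<close> is orthogonal to \<open>N\<close>, only the small part of
          \<open>k v\<close> off \<open>N\<close> contributes.\<close>
        have "norm (moebius l F v) = norm v" using UE_D(2)[OF moebius_UE[OF F l(1,2)]] .
        then have "norm (v + k v) = norm v" using k[of v] by (metis add.commute diff_add_cancel)
        then have "(norm (v + k v))\<^sup>2 = (norm v)\<^sup>2" by simp
        then have "(norm (k v))\<^sup>2 = - 2 * (k v \<bullet> v)"
          unfolding power2_norm_eq_inner by (simp add: inner_add_left inner_add_right inner_commute)
        also have "\<dots> = - 2 * ((k v - Proj N (k v)) \<bullet> v)" using vN by (simp add: inner_diff_left)
        also have "\<dots> \<le> 2 * (norm (k v - Proj N (k v)) * norm v)"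
          using Cauchy_Schwarz_ineq2[of "k v - Proj N (k v)" v] by linarith
        also have "\<dots> \<le> 2 * (((1/16) * norm v) * norm v)"
          by (intro mult_left_mono mult_right_mono key) auto
        also have "\<dots> \<le> ((1/2) * norm v)\<^sup>2" by (simp add: power2_eq_square)
        finally show ?thesis by (rule power2_le_imp_le) simp
      qed
      then show "\<exists>B. finite B \<and> (\<forall>v\<in>orth_comp B. norm (k v) \<le> (1/2) * norm v)" using B(1) by blast
    qed
  qed
  then show ?thesis using r(1,2) by blast
qed

text \<open>The number \<open>rad F\<close> is 1-Lipschitz in \<open>F\<close>.  This gives a continuous choice of the truncation
  parameter \<open>t\<close>, over an arbitrary space \<open>X\<close>.\<close>

definition radii :: "('a \<Rightarrow>\<^sub>L 'a) \<Rightarrow> real set" where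
  "radii F = {r. 0 < r \<and> r \<le> 1 \<and> (\<forall>G\<in>UE. dist G F < r \<longrightarrow> (\<forall>t\<ge>1/r. good G t))}"

definition rad :: "('a \<Rightarrow>\<^sub>L 'a) \<Rightarrow> real" where
  "rad F = Sup (radii F)"

lemma bdd_above_radii: "bdd_above (radii F)"
  by (auto simp: radii_def bdd_above_def)

lemma rad_pos:
  assumes "F \<in> UE"
  shows "0 < rad F" "rad F \<le> 1"
proof -
  obtain r where r: "r \<in> radii F" using good_locally[OF assms] by (auto simp: radii_def)
  then have "r \<le> rad F" unfolding rad_def by (intro cSup_upper bdd_above_radii)
  then show "0 < rad F" using r by (auto simp: radii_def)
  show "rad F \<le> 1" unfolding rad_def using r by (intro cSup_least) (auto simp: radii_def)
qed

text \<open>The supremum need not be an admissible radius; the factor 2 leaves room for one above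
  \<open>rad F / 2\<close>.\<close>

lemma good_rad:
  assumes F: "F \<in> UE" and t: "2 / rad F \<le> t"
  shows "good F t"
proof -
  have "radii F \<noteq> {}" using good_locally[OF F] by (auto simp: radii_def)
  moreover have "rad F / 2 < Sup (radii F)" using rad_pos[OF F] by (simp add: rad_def)
  ultimately obtain r where r: "r \<in> radii F" "rad F / 2 < r" using less_cSupE by metis
  then have "1 / r \<le> 2 / rad F" using rad_pos[OF F] by (simp add: radii_def field_simps)
  then have "1 / r \<le> t" using t by linarith
  moreover have "dist F F < r" using r(1) by (simp add: radii_def)
  ultimately show ?thesis using r(1) F unfolding radii_def by blast
qed

text \<open>An admissible radius for \<open>F\<close>, diminished by the distance to
  \<open>G\<close>, is admissible for \<open>G\<close>: the smaller ball lies in the larger one, and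
  the condition on \<open>t\<close> only becomes stricter.\<close>

lemma rad_le:
  assumes "F \<in> UE" "G \<in> UE"
  shows "rad F \<le> rad G + dist F G"
proof -
  have "r \<le> rad G + dist F G" if r: "r \<in> radii F" for r
  proof (cases "r \<le> dist F G")
    case True then show ?thesis using rad_pos[OF assms(2)] by linarith
  next
    case False
    define q where "q = r - dist F G"
    have q: "0 < q" "q \<le> r" "r \<le> 1" using False r by (auto simp: q_def radii_def)
    have "good E t" if "E \<in> UE" "dist E G < q" "1 / q \<le> t" for E t
    proof -
      have "dist E F < r" using that(2) dist_triangle[of E F G] by (simp add: q_def dist_commute)
      moreover have "1 / r \<le> 1 / q" using q by (simp add: frac_le)
      then have "1 / r \<le> t" using that(3) by linarith
      ultimately show ?thesis using r that(1) by (simp add: radii_def)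
    qed
    then have "q \<in> radii G" using q by (simp add: radii_def)
    then have "q \<le> rad G" unfolding rad_def by (intro cSup_upper bdd_above_radii)
    then show ?thesis by (simp add: q_def)
  qed
  then show ?thesis
    unfolding rad_def[of F] using good_locally[OF assms(1)] by (intro cSup_least) (auto simp: radii_def)
qed

lemma continuous_on_rad: "continuous_on UE rad"
  unfolding continuous_on_iff
proof (intro ballI allI impI)
  fix F :: "'a \<Rightarrow>\<^sub>L 'a" and e :: real assume F: "F \<in> UE" and "0 < e"
  have "dist (rad G) (rad F) \<le> dist G F" if "G \<in> UE" for G
    using rad_le[OF F that] rad_le[OF that F] by (simp add: dist_real_def dist_commute abs_le_iff)
  then show "\<exists>d>0. \<forall>G\<in>UE. dist G F < d \<longrightarrow> dist (rad G) (rad F) < e"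
    using \<open>0 < e\<close> by (meson le_less_trans)
qed

text \<open>Away from a finite-dimensional subspace, the deformed family is so close to \<open>1\<close> that
  \<open>V t\<close> may be replaced by its strong limit.\<close>

lemma UE_homotopic_stabilize:
  assumes f: "continuous_map X euclidean f" "\<And>x. x \<in> topspace X \<Longrightarrow> f x \<in> UE"
  shows "UE_homotopic X f (\<lambda>x. conj_ext R (f x))"
proof -
  define T where "T x = 2 / rad (f x)" for x
  define g where "g x = moebius (1 / T x) (f x)" for x
  have T: "1 \<le> T x" "0 < 1 / T x" "1 / T x \<le> 1" if "x \<in> topspace X" for x
    using rad_pos[OF f(2)[OF that]] by (auto simp: T_def field_simps)
  have crad: "continuous_map X euclidean (\<lambda>x. rad (f x))"
    using continuous_map_compose[of X "top_of_set UE" f euclidean rad] f continuous_on_rad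
    by (auto simp: o_def continuous_map_in_subtopology)
  have cT: "continuous_map X euclidean T" and ciT: "continuous_map X euclidean (\<lambda>x. 1 / T x)"
    using crad rad_pos(1)[OF f(2)] unfolding T_def continuous_map_euclidean_iff
    by (fastforce intro!: tendsto_intros)+
  have isoV: "part_isom UNIV (V t)" and isoR: "part_isom UNIV R" for t
    using V R by (simp_all add: part_isom_UNIV)
  have UNIV_fix: "w \<in> orth_comp UNIV \<Longrightarrow> u w = w" for u :: "'a \<Rightarrow>\<^sub>L 'a" and w
    using orth_comp_inner[of w UNIV w] by simp
  \<comment> \<open>The rescaling parameter moves linearly from 1, which leaves the family
    unchanged, to \<open>1 / T x\<close>.\<close>
  define l where "l p = 1 - fst p * (1 - 1 / T (snd p))" for p :: "real \<times> _"
  have l: "0 < l (t, x)" "l (t, x) \<le> 1" if "t \<in> {0..1}" "x \<in> topspace X" for t x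
  proof -
    have "t * (1 - 1 / T x) \<le> 1 - 1 / T x" "0 \<le> t * (1 - 1 / T x)"
      using that T[OF that(2)] by (auto intro: mult_left_le_one_le)
    then show "0 < l (t, x)" "l (t, x) \<le> 1"
      using T(2)[OF that(2)] unfolding l_def fst_conv snd_conv by linarith+
  qed
  have cl: "continuous_map (cyl X) euclidean l"
  proof -
    have "continuous_map (cyl X) euclidean (\<lambda>p. 1 - fst p *\<^sub>R (1 - 1 / T (snd p)))"
      by (intro cont_intros cont_cyl_snd ciT)
    moreover have "l = (\<lambda>p. 1 - fst p *\<^sub>R (1 - 1 / T (snd p)))" by (simp add: fun_eq_iff l_def)
    ultimately show ?thesis by simp
  qed
  have cm: "continuous_map (cyl X) euclidean (\<lambda>p. moebius (l p) (f (snd p)))"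
  proof (rule cont_moebius)
    show "\<exists>d>0. coercive d (mden (l p) (f (snd p)))" if "p \<in> topspace (cyl X)" for p
      using that l[of "fst p" "snd p"] UE_D(2)[OF f(2)[of "snd p"]]
      by (intro exI[of _ "2 * l p"] conjI coercive_mden) (auto simp: less_imp_le)
  qed (intro cl cont_cyl_snd f)+
  have mUE: "moebius (l (t, x)) (f x) \<in> UE" if "t \<in> {0..1}" "x \<in> topspace X" for t x
    by (intro moebius_UE f that l)
  have gUE: "g x \<in> UE" if "x \<in> topspace X" for x
    using mUE[of 1 x] that by (simp add: g_def l_def)
  have cg: "continuous_map X euclidean g"
    unfolding g_def
  proof (rule cont_moebius[OF ciT f(1)])
    fix x assume x: "x \<in> topspace X"
    have "coercive (2 * (1 / T x)) (mden (1 / T x) (f x))"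
      using T(2,3)[OF x] by (intro coercive_mden UE_D(2)[OF f(2)[OF x]]) auto
    then show "\<exists>d>0. coercive d (mden (1 / T x) (f x))"
      using T(2)[OF x] by (intro exI[of _ "2 * (1 / T x)"]) auto
  qed
  have "UE_homotopic X f g"
    by (rule UE_homotopicI[OF cm]) (auto simp: mUE g_def, auto simp: l_def)
  \<comment> \<open>The path \<open>V\<close> is traversed from \<open>V 0 = 1\<close> up to the
    point-dependent time \<open>T x\<close>; norm continuity is preserved because the time is finite
    and continuous in \<open>x\<close>.\<close>
  also have "UE_homotopic X g (\<lambda>x. conj_ext (V (T x)) (g x))"
  proof (rule UE_homotopicI)
    show "continuous_map (cyl X) euclidean (\<lambda>p. conj_ext (V (fst p *\<^sub>R T (snd p))) (g (snd p)))"
      by (intro cont_intros cont_cyl_snd cg cT cont_real[where g = V] V(4))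
    show "conj_ext (V (fst (t, x) *\<^sub>R T (snd (t, x)))) (g (snd (t, x))) \<in> UE"
      if "t \<in> {0..1}" "x \<in> topspace X" for t x
      using gUE[OF that(2)] by (intro conj_ext_UE[OF isoV]) (simp_all add: UNIV_fix)
    show "conj_ext (V (fst (0, x) *\<^sub>R T (snd (0, x)))) (g (snd (0, x))) = g x" for x
      by (rule blinfun_eqI) (simp add: V(3) conj_ext_apply)
  qed simp
  also have "UE_homotopic X (\<lambda>x. conj_ext (V (T x)) (g x)) (\<lambda>x. conj_ext R (g x))"
  proof (rule UE_homotopic_close)
    show "continuous_map X euclidean (\<lambda>x. conj_ext (V (T x)) (g x))"
      by (intro cont_intros cg cont_real[OF cT V(4)])
    show "continuous_map X euclidean (\<lambda>x. conj_ext R (g x))" by (intro cont_intros cg)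
    fix x assume x: "x \<in> topspace X"
    show "conj_ext (V (T x)) (g x) \<in> UE" "conj_ext R (g x) \<in> UE"
      using gUE[OF x] by (auto intro!: conj_ext_UE[OF isoV] conj_ext_UE[OF isoR] simp: UNIV_fix)
    have "good (f x) (T x)" by (rule good_rad[OF f(2)[OF x]]) (simp add: T_def)
    then have g1: "\<And>v. norm ((V (T x) - R) (g x v - v)) \<le> (1/4) * norm v"
      and g2: "\<exists>B. finite B \<and> (\<forall>v\<in>orth_comp B. norm (g x v - v) \<le> (1/2) * norm v)"
      unfolding good_def g_def by auto
    note gx = UE_D[OF gUE[OF x]]
    note ag = adj_unitary[OF gx(2,3)]
    fix v
    \<comment> \<open>The difference of the two conjugates is (V - R)(g - 1) a plus R (g - 1)(a -
      b). The first summand is covered by \<open>good\<close>. The second is its dual: the norm of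
      (g - 1)(a - b) is estimated by pairing with itself and moving V - R to the other side. Each
      contributes 1/4.\<close>
    define a b where "a = adj (V (T x)) v" and "b = adj R v"
    define z where "z = g x (a - b) - (a - b)"
    have a: "norm a \<le> norm v" unfolding a_def by (rule norm_adj_isometry_le[OF V(2)])
    have z: "norm z \<le> (1/4) * norm v"
    proof -
      have "(norm z)\<^sup>2 = (a - b) \<bullet> (adj (g x) z - z)"
        unfolding power2_norm_eq_inner z_def[symmetric] inner_diff_right adj_right[symmetric]
        by (simp add: z_def inner_diff_left)
      also have "\<dots> = v \<bullet> (V (T x) - R) (adj (g x) z - z)"
        by (simp add: a_def b_def inner_diff_left adj_left minus_blinfun.rep_eq inner_diff_right
            blinfun.diff_right)
      also have "adj (g x) z - z = - (g x (adj (g x) z) - adj (g x) z)"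
        by (simp add: ag)
      also have "v \<bullet> (V (T x) - R) (- (g x (adj (g x) z) - adj (g x) z))
          \<le> norm v * ((1/4) * norm (adj (g x) z))"
      proof -
        have "norm ((V (T x) - R) (- (g x (adj (g x) z) - adj (g x) z))) \<le> (1/4) * norm (adj (g x) z)"
          using g1[of "adj (g x) z"] by (simp only: blinfun.minus_right norm_minus_cancel)
        then show ?thesis
          by (intro order_trans[OF norm_cauchy_schwarz] mult_left_mono) auto
      qed
      finally have "norm z * norm z \<le> norm z * ((1/4) * norm v)"
        by (simp add: ag power2_eq_square mult_ac)
      then show ?thesis
        using mult_le_cancel_left_pos[of "norm z" "norm z" "(1/4) * norm v"] by (cases "z = 0") simp_all
    qed
    have "conj_ext (V (T x)) (g x) v - conj_ext R (g x) v = (V (T x) - R) (g x a - a) + R z"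
      by (simp add: conj_ext_apply a_def b_def z_def minus_blinfun.rep_eq blinfun.diff_right)
    then have "norm (conj_ext (V (T x)) (g x) v - conj_ext R (g x) v)
        \<le> norm ((V (T x) - R) (g x a - a)) + norm (R z)"
      by (metis norm_triangle_ineq)
    then show "norm (conj_ext (V (T x)) (g x) v - conj_ext R (g x) v) \<le> (1/2) * norm v"
      using g1[of a] a z by (simp add: R(2))
    obtain B where B: "finite B" "\<And>v. v \<in> orth_comp B \<Longrightarrow> norm (g x v - v) \<le> (1/2) * norm v"
      using g2 by blast
    have "norm (conj_ext R (g x) v - v) \<le> (1/2) * norm v" if "v \<in> orth_comp (blinfun_apply R ` B)" for v
    proof -
      have "adj R v \<in> orth_comp B"
        using that cinner_adj[OF clin_adj[OF R(1)]] by (auto simp: orth_comp_def)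
      then have "norm (conj_ext R (g x) v - v) \<le> (1/2) * norm (adj R v)"
        using B(2) by (simp add: conj_ext_apply R(2))
      then show ?thesis using norm_adj_isometry_le[OF R(2), of v] by linarith
    qed
    then show "\<exists>B. finite B \<and> (\<forall>v\<in>orth_comp B. norm (conj_ext R (g x) v - v) \<le> (1/2) * norm v)"
      using B(1) by blast
  qed
  \<comment> \<open>The rescaling is undone inside the conjugation by the constant isometry
    \<open>R\<close>.\<close>
  also have "UE_homotopic X (\<lambda>x. conj_ext R (g x)) (\<lambda>x. conj_ext R (f x))"
  proof (rule UE_homotopic_sym, rule UE_homotopicI)
    show "continuous_map (cyl X) euclidean (\<lambda>p. conj_ext R (moebius (l p) (f (snd p))))"
      by (intro cont_intros cm)
    show "conj_ext R (moebius (l (t, x)) (f (snd (t, x)))) \<in> UE" if "t \<in> {0..1}" "x \<in> topspace X" for t x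
      using mUE[OF that] by (intro conj_ext_UE[OF isoR]) (simp_all add: UNIV_fix)
  qed (simp_all add: l_def g_def)
  finally show ?thesis .
qed

end

section \<open>Orthogonal decompositions into infinitely many copies\<close>

definition slots :: "(nat \<Rightarrow> 'a::{real_inner,banach} \<Rightarrow>\<^sub>L 'b::{real_inner,banach}) \<Rightarrow> bool" where
  "slots B \<longleftrightarrow> (\<forall>k x. norm (B k x) = norm x) \<and> (\<forall>j k x y. j \<noteq> k \<longrightarrow> B j x \<bullet> B k y = 0)"

definition exhausting :: "(nat \<Rightarrow> 'a::{real_inner,banach} \<Rightarrow>\<^sub>L 'b::{real_inner,banach}) \<Rightarrow> bool" where
  "exhausting B \<longleftrightarrow> (\<forall>z. (\<forall>k x. z \<bullet> B k x = 0) \<longrightarrow> z = 0)"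

lemma slots_norm: "slots B \<Longrightarrow> norm (B k x) = norm x"
  by (simp add: slots_def)

lemma adj_slots:
  assumes "slots B"
  shows "adj (B j) (B k x) = (if j = k then x else 0)"
proof (cases "j = k")
  case True
  then show ?thesis using adj_isometry[of "B k"] slots_norm[OF assms] by simp
next
  case False
  then have "y \<bullet> adj (B j) (B k x) = y \<bullet> 0" for y
    using assms by (simp add: adj_right[symmetric] slots_def)
  then show ?thesis using False inner_ext by metis
qed

lemma slots_inner: "slots B \<Longrightarrow> B j x \<bullet> B k y = (if j = k then x \<bullet> y else 0)"
  by (simp add: adj_right adj_slots)

lemma slots_sum_norm:
  assumes "slots C" "finite I"
  shows "(norm (\<Sum>k\<in>I. C k (v k)))\<^sup>2 = (\<Sum>k\<in>I. (norm (v k))\<^sup>2)"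
  unfolding power2_norm_eq_inner inner_sum_left inner_sum_right
  using assms(2) by (simp add: slots_inner[OF assms(1)])

lemma bessel:
  assumes B: "slots B"
  shows "(\<Sum>k<n. (norm (adj (B k) z))\<^sup>2) \<le> (norm z)\<^sup>2"
proof -
  define y where "y = (\<Sum>k<n. B k (adj (B k) z))"
  have ny: "(norm y)\<^sup>2 = (\<Sum>k<n. (norm (adj (B k) z))\<^sup>2)"
    unfolding y_def by (rule slots_sum_norm[OF B]) simp
  have "y \<bullet> z = (\<Sum>k<n. (norm (adj (B k) z))\<^sup>2)"
    by (simp add: y_def inner_sum_left adj_right power2_norm_eq_inner)
  then have "(norm y)\<^sup>2 \<le> norm y * norm z" using norm_cauchy_schwarz[of y z] ny by simp
  then have "norm y \<le> norm z"
    using mult_le_cancel_left_pos[of "norm y" "norm y" "norm z"]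
    by (cases "y = 0") (simp_all add: power2_eq_square)
  then show ?thesis unfolding ny[symmetric] by (intro power_mono) auto
qed

lemma summable_adj_slots: "slots B \<Longrightarrow> summable (\<lambda>k. (norm (adj (B k) z))\<^sup>2)"
  by (rule summableI_nonneg_bounded[where x = "(norm z)\<^sup>2"]) (simp_all add: bessel)

lemma slots_summable:
  assumes C: "slots C" and v: "summable (\<lambda>k. (norm (v k))\<^sup>2)"
  shows "summable (\<lambda>k. C k (v k))" "(norm (\<Sum>k. C k (v k)))\<^sup>2 = (\<Sum>k. (norm (v k))\<^sup>2)"
proof -
  show 1: "summable (\<lambda>k. C k (v k))"
    unfolding summable_Cauchy
  proof (intro allI impI)
    fix e :: real assume "0 < e"
    then obtain N where N: "\<And>m n. m \<ge> N \<Longrightarrow> norm (\<Sum>k\<in>{m..<n}. (norm (v k))\<^sup>2) < e\<^sup>2"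
      using v unfolding summable_Cauchy by (meson zero_less_power)
    have "norm (\<Sum>k\<in>{m..<n}. C k (v k)) < e" if "m \<ge> N" for m n
    proof -
      have "(norm (\<Sum>k\<in>{m..<n}. C k (v k)))\<^sup>2 < e\<^sup>2"
        using N[OF that, of n] slots_sum_norm[OF C, of "{m..<n}" v] by simp
      then show ?thesis using \<open>0 < e\<close> by (simp add: power2_less_imp_less)
    qed
    then show "\<exists>N. \<forall>m\<ge>N. \<forall>n. norm (\<Sum>k\<in>{m..<n}. C k (v k)) < e" by blast
  qed
  have "(\<lambda>n. (norm (\<Sum>k<n. C k (v k)))\<^sup>2) \<longlonglongrightarrow> (norm (\<Sum>k. C k (v k)))\<^sup>2"
    by (intro tendsto_intros summable_LIMSEQ 1)
  moreover have "(\<lambda>n. (norm (\<Sum>k<n. C k (v k)))\<^sup>2) \<longlonglongrightarrow> (\<Sum>k. (norm (v k))\<^sup>2)"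
    using summable_LIMSEQ[OF v] by (simp add: slots_sum_norm[OF C])
  ultimately show "(norm (\<Sum>k. C k (v k)))\<^sup>2 = (\<Sum>k. (norm (v k))\<^sup>2)" by (rule LIMSEQ_unique)
qed

text \<open>Countably many copies of \<open>D\<close>, that is, the tensor product of the identity
  of l^2 with \<open>D\<close>, taken from the slots \<open>B\<close> to the slots
  \<open>C\<close>.\<close>

definition amp where
  "amp B C D = Blinfun (\<lambda>h. \<Sum>k. C k (blinfun_apply D (adj (B k) h)))"

context
  fixes B :: "nat \<Rightarrow> 'a::{real_inner,banach} \<Rightarrow>\<^sub>L 'b::{real_inner,banach}"
    and C :: "nat \<Rightarrow> 'c::{real_inner,banach} \<Rightarrow>\<^sub>L 'd::{real_inner,banach}"
  assumes B: "slots B" and C: "slots C"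
begin

lemma amp_summable:
  fixes D :: "'a \<Rightarrow>\<^sub>L 'c"
  shows "summable (\<lambda>k. (norm (D (adj (B k) h)))\<^sup>2)" "summable (\<lambda>k. C k (D (adj (B k) h)))"
proof -
  have "(norm (D (adj (B k) h)))\<^sup>2 \<le> (norm D)\<^sup>2 * (norm (adj (B k) h))\<^sup>2" for k
    using power_mono[OF norm_blinfun[of D "adj (B k) h"], of 2] by (simp add: power_mult_distrib)
  then show 1: "summable (\<lambda>k. (norm (D (adj (B k) h)))\<^sup>2)"
    by (intro summable_comparison_test'[OF summable_mult[OF summable_adj_slots[OF B]]]) auto
  show "summable (\<lambda>k. C k (D (adj (B k) h)))" by (rule slots_summable(1)[OF C 1])
qed

lemma amp_works:
  fixes D :: "'a \<Rightarrow>\<^sub>L 'c"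
  shows amp_apply: "amp B C D h = (\<Sum>k. C k (D (adj (B k) h)))"
    and amp_norm: "(norm (amp B C D h))\<^sup>2 = (\<Sum>k. (norm (D (adj (B k) h)))\<^sup>2)"
    and amp_norm_le: "norm (amp B C D) \<le> norm D"
proof -
  define g where "g h = (\<Sum>k. C k (D (adj (B k) h)))" for h
  have gn: "(norm (g h))\<^sup>2 = (\<Sum>k. (norm (D (adj (B k) h)))\<^sup>2)" for h
    unfolding g_def by (rule slots_summable(2)[OF C amp_summable(1)])
  have gle: "norm (g h) \<le> norm D * norm h" for h
  proof -
    have "(norm (g h))\<^sup>2 \<le> (norm D * norm h)\<^sup>2"
      unfolding gn
    proof (rule suminf_le_const[OF amp_summable(1)])
      fix n
      have "(\<Sum>k<n. (norm (D (adj (B k) h)))\<^sup>2) \<le> (\<Sum>k<n. (norm D)\<^sup>2 * (norm (adj (B k) h))\<^sup>2)"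
        using power_mono[OF norm_blinfun[of D] norm_ge_zero, where n = 2] by (intro sum_mono) (simp add: power_mult_distrib)
      also have "\<dots> \<le> (norm D)\<^sup>2 * (norm h)\<^sup>2"
        unfolding sum_distrib_left[symmetric] by (intro mult_left_mono bessel[OF B]) simp
      finally show "(\<Sum>k<n. (norm (D (adj (B k) h)))\<^sup>2) \<le> (norm D * norm h)\<^sup>2"
        by (simp add: power_mult_distrib)
    qed
    then show ?thesis by (rule power2_le_imp_le) simp
  qed
  have "bounded_linear g"
  proof (rule bounded_linear_intro[where K = "norm D"])
    show "g (x + y) = g x + g y" for x y
      unfolding g_def by (simp add: blinfun.add_right suminf_add[OF amp_summable(2) amp_summable(2)])
    show "g (r *\<^sub>R x) = r *\<^sub>R g x" for r x
      unfolding g_def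
      by (simp add: blinfun.scaleR_right bounded_linear.suminf[OF bounded_linear_scaleR_right amp_summable(2)])
  qed (subst mult.commute, rule gle)
  then have g: "blinfun_apply (amp B C D) = g"
    unfolding amp_def g_def by (rule bounded_linear_Blinfun_apply)
  show "amp B C D h = (\<Sum>k. C k (D (adj (B k) h)))" by (simp add: g g_def)
  show "(norm (amp B C D h))\<^sup>2 = (\<Sum>k. (norm (D (adj (B k) h)))\<^sup>2)" by (simp add: g gn)
  show "norm (amp B C D) \<le> norm D" by (rule norm_blinfun_bound) (simp_all add: g gle)
qed

lemma amp_inner_zero:
  fixes D :: "'a \<Rightarrow>\<^sub>L 'c"
  assumes "\<And>k. C k (D (adj (B k) h)) \<bullet> z = 0"
  shows "amp B C D h \<bullet> z = 0"
  unfolding amp_apply bounded_linear.suminf[OF bounded_linear_inner_left amp_summable(2)]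
  by (simp add: assms)

lemma adj_amp:
  fixes D :: "'a \<Rightarrow>\<^sub>L 'c"
  shows "adj (C j) (amp B C D h) = D (adj (B j) h)"
  unfolding amp_apply bounded_linear.suminf[OF blinfun.bounded_linear_right amp_summable(2)]
  by (subst adj_slots[OF C], subst suminf_finite[of "{j}"]) auto

lemma amp_slot:
  fixes D :: "'a \<Rightarrow>\<^sub>L 'c"
  shows "amp B C D (B k x) = C k (D x)"
  unfolding amp_apply by (simp add: adj_slots[OF B], subst suminf_finite[of "{k}"]) auto

lemma bounded_linear_amp: "bounded_linear (amp B C :: ('a \<Rightarrow>\<^sub>L 'c) \<Rightarrow> 'b \<Rightarrow>\<^sub>L 'd)"
proof (rule bounded_linear_intro[where K = 1])
  fix D E :: "'a \<Rightarrow>\<^sub>L 'c" and r :: real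
  show "amp B C (D + E) = amp B C D + amp B C E"
    by (rule blinfun_eqI)
       (simp add: amp_apply plus_blinfun.rep_eq blinfun.add_right suminf_add[OF amp_summable(2) amp_summable(2)])
  show "amp B C (r *\<^sub>R D) = r *\<^sub>R amp B C D"
    by (rule blinfun_eqI)
       (simp add: amp_apply scaleR_blinfun.rep_eq blinfun.scaleR_right
        bounded_linear.suminf[OF bounded_linear_scaleR_right amp_summable(2)])
qed (simp add: amp_norm_le)

end

text \<open>Homogeneity is asked of each summand as a whole, because the inner spaces may carry only
  a real structure here, as for \<open>line\<close>.\<close>

lemma clin_amp:
  fixes B :: "nat \<Rightarrow> 'a::{real_inner,banach} \<Rightarrow>\<^sub>L 'b::sep_chilbert"
    and C :: "nat \<Rightarrow> 'c::{real_inner,banach} \<Rightarrow>\<^sub>L 'd::sep_chilbert" and D :: "'a \<Rightarrow>\<^sub>L 'c"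
  assumes BC: "slots B" "slots C"
    and "\<And>k c h. C k (D (adj (B k) (c *\<^sub>C h))) = c *\<^sub>C C k (D (adj (B k) h))"
  shows "clin (amp B C D)"
  unfolding clin_def amp_apply[OF BC]
  by (simp add: assms(3) bounded_linear.suminf[OF bounded_bilinear.bounded_linear_right[OF bounded_bilinear_scaleC]
        amp_summable(2)[OF BC]])

lemma amp_id:
  assumes B: "slots B" "exhausting B"
  shows "amp B B id_blinfun = id_blinfun"
proof (rule blinfun_eqI)
  fix h
  have "(amp B B id_blinfun h - h) \<bullet> B k x = 0" for k x
    by (simp add: inner_commute[of _ "B k x"] adj_right blinfun.diff_right adj_amp[OF B(1) B(1)])
  then have "amp B B id_blinfun h - h = 0" using B(2) unfolding exhausting_def by blast
  then show "amp B B id_blinfun h = id_blinfun h" by simp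
qed

lemma parseval:
  assumes B: "slots B" "exhausting B"
  shows "(\<Sum>k. (norm (adj (B k) h))\<^sup>2) = (norm h)\<^sup>2"
  using amp_norm[OF B(1) B(1), of id_blinfun h] by (simp add: amp_id[OF B])

lemma amp_isometry:
  assumes "slots B" "exhausting B" "slots C"
  shows "norm (amp B C id_blinfun h) = norm h"
proof -
  have "(norm (amp B C id_blinfun h))\<^sup>2 = (norm h)\<^sup>2"
    by (simp add: amp_norm[OF assms(1,3)] parseval[OF assms(1,2)])
  then show ?thesis by simp
qed

lemma exhausting_induct:
  assumes "exhausting B" "subspace S" "closed S" "\<And>k x. B k x \<in> S"
  shows "x \<in> S"
proof -
  have "S = UNIV"
    using assms(1,4) unfolding exhausting_def
    by (intro closed_subspace_eq_UNIV assms(2,3)) blast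
  then show ?thesis by simp
qed

text \<open>Distinct members are at distance sqrt 2, so balls of radius 1/2 around them are
  disjoint; second countability allows only countably many.\<close>

lemma countable_orthonormal:
  assumes M: "orthonormal (M :: 'a::sep_chilbert set)"
  shows "countable M"
proof -
  have far: "1 < dist m n" if "m \<in> M" "n \<in> M" "m \<noteq> n" for m n
  proof -
    have "m \<bullet> n = 0" "m \<bullet> m = 1" "n \<bullet> n = 1"
      using M that by (simp_all add: orthonormal_def Re_cinner[symmetric])
    then have "(norm (m - n))\<^sup>2 = 2"
      by (simp add: power2_norm_eq_inner inner_diff_left inner_diff_right inner_commute)
    then have "1 < norm (m - n)" by (metis norm_ge_zero one_less_numeral_iff one_power2 power2_less_imp_less semiring_norm(76))
    then show ?thesis by (simp add: dist_norm)
  qed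
  have disj: "ball m (1/2) \<inter> ball n (1/2) = {}" if "m \<in> M" "n \<in> M" "m \<noteq> n" for m n
    using far[OF that] dist_triangle_half_l by (fastforce simp: dist_commute)
  have "countable ((\<lambda>m. ball m (1/2)) ` M)"
  proof (rule countable_disjoint_open_subsets)
    show "pairwise disjnt ((\<lambda>m. ball m (1/2)) ` M)"
      using disj by (auto simp: pairwise_def disjnt_def)
  qed auto
  moreover have "inj_on (\<lambda>m. ball m (1/2)) M"
  proof (rule inj_onI, rule ccontr)
    fix m n assume "m \<in> M" "n \<in> M" "ball m (1/2) = ball n (1/2)" "m \<noteq> n"
    then have "ball m (1/2) = {}" using disj by blast
    then show False by simp
  qed
  ultimately show ?thesis by (rule countable_image_inj_on)
qed

text \<open>A maximal orthonormal set from Zorn's lemma is total, hence infinite in infinite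
  dimension, and countable by separability.\<close>

lemma exists_onb:
  assumes inf: "\<not> finite_dim (UNIV :: 'a::sep_chilbert set)"
  shows "\<exists>e :: nat \<Rightarrow> 'a. (\<forall>i j. cinner (e i) (e j) = (if i = j then 1 else 0)) \<and>
    (\<forall>z. (\<forall>k. cinner z (e k) = 0) \<longrightarrow> z = 0)"
proof -
  have "\<exists>M\<in>{S :: 'a set. orthonormal S}. \<forall>X\<in>{S. orthonormal S}. M \<subseteq> X \<longrightarrow> X = M"
  proof (rule subset_Zorn')
    fix K :: "'a set set" assume K: "subset.chain {S. orthonormal S} K"
    have "cinner c d = (if c = d then 1 else 0)" if cd: "c \<in> \<Union> K" "d \<in> \<Union> K" for c d
    proof -
      obtain S1 S2 where "S1 \<in> K" "S2 \<in> K" "c \<in> S1" "d \<in> S2" using cd by blast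
      moreover have "S1 \<subseteq> S2 \<or> S2 \<subseteq> S1" "orthonormal S1" "orthonormal S2"
        using K calculation by (auto simp: subset.chain_def)
      ultimately show ?thesis unfolding orthonormal_def by (meson subsetD)
    qed
    then show "\<Union> K \<in> {S. orthonormal S}" by (auto simp: orthonormal_def)
  qed
  then obtain M :: "'a set" where M: "orthonormal M" "\<And>X. orthonormal X \<Longrightarrow> M \<subseteq> X \<Longrightarrow> X = M" by auto
  have tot: "z = 0" if z: "z \<in> orth_comp M" for z
  proof (rule ccontr)
    assume "z \<noteq> 0"
    define u where "u = complex_of_real (1 / norm z) *\<^sub>C z"
    have "norm u = 1" using \<open>z \<noteq> 0\<close> by (simp add: u_def norm_divide)
    then have u1: "cinner u u = 1" by (simp add: cinner_self)
    have u0: "cinner u m = 0" "cinner m u = 0" if "m \<in> M" for m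
      using z that cinner_commute[of m u] by (simp_all add: u_def cinner_scaleC_left orth_comp_def)
    have "orthonormal (insert u M)" using M(1) u1 u0 by (auto simp: orthonormal_def)
    then have "u \<in> M" using M(2) by blast
    then show False using u0(1) u1 by fastforce
  qed
  have "infinite M"
  proof
    assume fin: "finite M"
    have "x \<in> cvec.span M" for x
    proof -
      have "x - (\<Sum>c\<in>M. cinner x c *\<^sub>C c) = 0" by (rule tot) (rule orthonormal_sum_orth[OF fin M(1)])
      then have "x = (\<Sum>c\<in>M. cinner x c *\<^sub>C c)" by simp
      also have "\<dots> \<in> cvec.span M" by (intro cvec.span_sum cvec.span_scale cvec.span_base)
      finally show ?thesis .
    qed
    then show False using inf fin by (auto simp: finite_dim_def)
  qed
  then have bij: "bij_betw (from_nat_into M) UNIV M"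
    using bij_betw_from_nat_into countable_orthonormal[OF M(1)] by blast
  show ?thesis
  proof (intro exI[of _ "from_nat_into M"] conjI allI impI)
    fix i j
    show "cinner (from_nat_into M i) (from_nat_into M j) = (if i = j then 1 else 0)"
      using M(1) bij_betw_imp_inj_on[OF bij] bij_betwE[OF bij] by (simp add: orthonormal_def inj_eq)
  next
    fix z assume z: "\<forall>k. cinner z (from_nat_into M k) = 0"
    have "range (from_nat_into M) = M" by (rule bij_betw_imp_surj_on[OF bij])
    then have "\<exists>k. m = from_nat_into M k" if "m \<in> M" for m using that by (metis imageE)
    then have "z \<in> orth_comp M" using z unfolding orth_comp_def by auto
    then show "z = 0" by (rule tot)
  qed
qed

section \<open>Splitting a basis into infinitely many infinite blocks\<close>

definition line :: "'a::sep_chilbert \<Rightarrow> complex \<Rightarrow>\<^sub>L 'a" where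
  "line e = Blinfun (\<lambda>c. c *\<^sub>C e)"

lemma line_apply: "line e c = c *\<^sub>C e"
  unfolding line_def
  by (simp add: bounded_linear_Blinfun_apply bounded_bilinear.bounded_linear_left[OF bounded_bilinear_scaleC])

lemma adj_line: "adj (line e) h = cinner h e"
proof (rule inner_ext)
  fix c
  have "c \<bullet> adj (line e) h = Re (c * cinner e h)"
    by (simp add: adj_right[symmetric] line_apply Re_cinner[symmetric] cinner_scaleC_left)
  also have "\<dots> = c \<bullet> cinner h e"
    using cinner_commute[of e h] by (simp add: inner_complex_def)
  finally show "c \<bullet> adj (line e) h = c \<bullet> cinner h e" .
qed

lemma slots_line:
  assumes "\<And>i j. cinner (e i) (e j) = (if i = j then 1 else 0)"
  shows "slots (\<lambda>k. line (e k))"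
  unfolding slots_def
proof (intro conjI allI impI)
  fix k x
  have "complex_of_real ((norm (e k))\<^sup>2) = 1" using assms[of k k] by (simp add: cinner_self)
  then have "(norm (e k))\<^sup>2 = 1" using of_real_eq_1_iff by blast
  then have "norm (e k) = 1" by (simp add: power2_eq_1_iff) (smt (verit) norm_ge_zero)
  then show "norm (line (e k) x) = norm x" by (simp add: line_apply)
next
  fix j k :: nat and x y :: complex assume "j \<noteq> k"
  then show "line (e j) x \<bullet> line (e k) y = 0"
    unfolding adj_right adj_line by (simp add: line_apply cinner_scaleC_left assms)
qed

text \<open>The pairing function cuts an orthonormal basis of the target into countably many
  infinite blocks; the slot \<open>k\<close> carries a basis of the source onto block
  \<open>k\<close>.\<close>

lemma exists_slots:
  assumes inf: "\<not> finite_dim (UNIV :: 'a::sep_chilbert set)" "\<not> finite_dim (UNIV :: 'b::sep_chilbert set)"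
  shows "\<exists>A :: nat \<Rightarrow> 'a \<Rightarrow>\<^sub>L 'b. slots A \<and> exhausting A \<and> (\<forall>k. clin (A k))"
proof -
  obtain e :: "nat \<Rightarrow> 'a" where e: "\<And>i j. cinner (e i) (e j) = (if i = j then 1 else 0)"
    "\<And>z. (\<And>k. cinner z (e k) = 0) \<Longrightarrow> z = 0" using exists_onb[OF inf(1)] by blast
  obtain g :: "nat \<Rightarrow> 'b" where g: "\<And>i j. cinner (g i) (g j) = (if i = j then 1 else 0)"
    "\<And>z. (\<And>k. cinner z (g k) = 0) \<Longrightarrow> z = 0" using exists_onb[OF inf(2)] by blast
  define E where "E k = line (e k)" for k
  define G where "G k l = line (g (prod_encode (k, l)))" for k l
  have E: "slots E" unfolding E_def by (rule slots_line) (rule e)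
  have G: "slots (G k)" for k unfolding G_def by (rule slots_line) (simp add: g)
  have totE: "exhausting E"
    unfolding exhausting_def E_def
  proof (intro allI impI e(2))
    fix z k assume "\<forall>k x. z \<bullet> line (e k) x = 0"
    then have "x \<bullet> cinner z (e k) = x \<bullet> 0" for x
      by (simp add: adj_line[symmetric] adj_right[symmetric] inner_commute)
    then show "cinner z (e k) = 0" by (rule inner_ext)
  qed
  define A where "A k = amp E (G k) id_blinfun" for k
  have GG: "G j l x \<bullet> G k m y = 0" if "j \<noteq> k" for j k l m x y
    using that slots_inner[OF slots_line[of g], of "prod_encode (j, l)" x "prod_encode (k, m)" y] g(1)
    by (simp add: G_def)
  have "slots A"
    unfolding slots_def
  proof (intro conjI allI impI)
    show "norm (A k x) = norm x" for k x unfolding A_def by (rule amp_isometry[OF E totE G])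
    fix j k x y assume "j \<noteq> (k :: nat)"
    show "A j x \<bullet> A k y = 0"
      unfolding A_def[of j]
    proof (rule amp_inner_zero[OF E G])
      fix l
      show "G j l (id_blinfun (adj (E l) x)) \<bullet> A k y = 0"
        unfolding A_def by (subst inner_commute, rule amp_inner_zero[OF E G])
          (use GG[of k j] \<open>j \<noteq> k\<close> in auto)
    qed
  qed
  moreover have "exhausting A"
    unfolding exhausting_def
  proof (intro allI impI g(2))
    fix z n assume z: "\<forall>k x. z \<bullet> A k x = 0"
    obtain k l where n: "n = prod_encode (k, l)" by (metis prod_decode_inverse surj_pair)
    have "c \<bullet> cinner z (g n) = c \<bullet> 0" for c
    proof -
      have "line (g n) c = A k (E l c)" unfolding A_def amp_slot[OF E G] by (simp add: G_def n)
      then have "z \<bullet> line (g n) c = 0" using z by simp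
      then show ?thesis by (simp add: adj_line[symmetric] adj_right[symmetric] inner_commute)
    qed
    then show "cinner z (g n) = 0" by (rule inner_ext)
  qed
  moreover have "clin (A k)" for k
    unfolding A_def
    by (rule clin_amp[OF E G]) (simp add: E_def G_def adj_line line_apply cinner_scaleC_left scaleC_scaleC)
  ultimately show ?thesis by blast
qed

section \<open>A path of unitaries converging strongly to a shift\<close>

definition cscale :: "complex \<Rightarrow> 'a::sep_chilbert \<Rightarrow>\<^sub>L 'a" where
  "cscale c = Blinfun (\<lambda>x. c *\<^sub>C x)"

lemma cscale_apply: "cscale c x = c *\<^sub>C x"
  unfolding cscale_def
  by (simp add: bounded_linear_Blinfun_apply bounded_bilinear.bounded_linear_right[OF bounded_bilinear_scaleC])

lemma bounded_linear_cscale: "bounded_linear cscale"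
proof (rule bounded_linear_intro[where K = 1])
  show "cscale (a + b) = cscale a + cscale b" for a b :: complex
    by (rule blinfun_eqI) (simp add: cscale_apply plus_blinfun.rep_eq scaleC_add_left)
  show "cscale (r *\<^sub>R a) = r *\<^sub>R cscale a" for r and a :: complex
    by (rule blinfun_eqI)
       (simp add: cscale_apply scaleR_blinfun.rep_eq bounded_bilinear.scaleR_left[OF bounded_bilinear_scaleC])
  show "norm (cscale a :: 'a \<Rightarrow>\<^sub>L 'a) \<le> norm a * 1" for a
    by (simp add: norm_blinfun_bound cscale_apply)
qed

lemma conj_ext_isometry:
  assumes s: "\<And>x. norm (blinfun_apply s x) = norm x" and u: "\<And>x. norm (blinfun_apply u x) = norm x"
  shows "norm (conj_ext s u k) = norm k"
proof -
  define a c where "a = adj s k" and "c = k - s (adj s k)"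
  have "adj s c = 0" by (simp add: c_def blinfun.diff_right s)
  then have orth: "s x \<bullet> c = 0" for x by (simp add: adj_right)
  have "k = s a + c" "conj_ext s u k = s (u a) + c"
    by (simp_all add: a_def c_def conj_ext_apply blinfun.diff_right)
  then have "(norm (conj_ext s u k))\<^sup>2 = (norm k)\<^sup>2" by (simp add: norm_add_orthogonal orth s u)
  then show ?thesis by simp
qed

context
  fixes A :: "nat \<Rightarrow> 'k::sep_chilbert \<Rightarrow>\<^sub>L 'k"
  assumes A: "slots A" "exhausting A" "\<And>k. clin (A k)"
begin

definition shift :: "'k \<Rightarrow>\<^sub>L 'k" where
  "shift = amp A (\<lambda>k. A (Suc k)) id_blinfun"

text \<open>An isometry onto the antidiagonal of the slots \<open>0\<close> and
  \<open>Suc k\<close>. The exchange of these slots is -1 there and 1 on the complement, so turning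
  the phase from 1 to -1 connects it with the identity.\<close>

definition swap_isom :: "nat \<Rightarrow> 'k \<Rightarrow>\<^sub>L 'k" where
  "swap_isom k = (1 / sqrt 2) *\<^sub>R (A 0 - A (Suc k))"

text \<open>A path from the identity to the exchange of the slots \<open>0\<close> and \<open>Suc k\<close>.\<close>

definition swap_path :: "nat \<Rightarrow> real \<Rightarrow> 'k \<Rightarrow>\<^sub>L 'k" where
  "swap_path k t = conj_ext (swap_isom k) (cscale (cis (pi * min 1 (max 0 t))))"

text \<open>The exchange with index \<open>n\<close> runs during the time interval from n to n + 1.
  Once finished, the first \<open>n\<close> exchanges have moved each slot \<open>k < n\<close> to
  \<open>Suc k\<close> and returned slot \<open>n\<close> to \<open>0\<close>; the slot that spoils
  the shift escapes to infinity.\<close>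

fun swaps :: "nat \<Rightarrow> real \<Rightarrow> 'k \<Rightarrow>\<^sub>L 'k" where
  "swaps 0 t = id_blinfun"
| "swaps (Suc n) t = swap_path n (t - real n) o\<^sub>L swaps n t"

definition shift_path :: "real \<Rightarrow> 'k \<Rightarrow>\<^sub>L 'k" where
  "shift_path t = swaps (nat \<lceil>t\<rceil>) t"

lemma slots_Suc: "slots (\<lambda>k. A (Suc k))"
  using A(1) by (simp add: slots_def)

lemma clin_shift: "clin shift"
  unfolding shift_def
  by (rule clin_amp[OF A(1) slots_Suc]) (simp add: clin_scaleC A(3) clin_scaleC[OF clin_adj[OF A(3)]])

lemma norm_shift: "norm (shift x) = norm x"
  unfolding shift_def by (rule amp_isometry[OF A(1,2) slots_Suc])

lemma shift_slot: "shift (A k x) = A (Suc k) x"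
  unfolding shift_def by (simp add: amp_slot[OF A(1) slots_Suc])

lemma shift_orth: "shift x \<bullet> A 0 y = 0"
  unfolding shift_def by (rule amp_inner_zero[OF A(1) slots_Suc]) (simp add: slots_inner[OF A(1)])

lemma norm_swap_isom: "norm (swap_isom k x) = norm x"
proof -
  have "(norm (swap_isom k x))\<^sup>2 = (norm x)\<^sup>2"
    unfolding power2_norm_eq_inner swap_isom_def
    by (simp add: blinfun_rep slots_inner[OF A(1)] inner_diff_left inner_diff_right)
  then show ?thesis by simp
qed

lemma adj_swap_isom: "adj (swap_isom k) = (1 / sqrt 2) *\<^sub>R (adj (A 0) - adj (A (Suc k)))"
  by (rule adj_eqI) (simp add: swap_isom_def blinfun_rep inner_diff_left inner_diff_right adj_right)

lemma norm_swap_path: "norm (swap_path k t x) = norm x"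
  unfolding swap_path_def by (rule conj_ext_isometry) (simp_all add: norm_swap_isom cscale_apply)

lemma clin_swap_path: "clin (swap_path k t)"
  unfolding swap_path_def conj_ext_def swap_isom_def
  by (intro clin_intros A) (simp add: clin_def cscale_apply scaleC_scaleC mult.commute)

lemma swap_path_le_0: "t \<le> 0 \<Longrightarrow> swap_path k t = id_blinfun"
  by (rule blinfun_eqI) (simp add: swap_path_def conj_ext_apply cscale_apply)

lemma swap_path_fixes:
  assumes "j \<noteq> 0" "j \<noteq> Suc k"
  shows "swap_path k t (A j x) = A j x"
  using assms by (simp add: swap_path_def conj_ext_apply adj_swap_isom blinfun_rep adj_slots[OF A(1)])

lemma swap_path_ge_1:
  assumes "1 \<le> t"
  shows "swap_path k t (A 0 x) = A (Suc k) x" "swap_path k t (A (Suc k) x) = A 0 x"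
proof -
  have m: "min 1 (max 0 t) = 1" using assms by simp
  have half: "(1 / sqrt 2) *\<^sub>R ((2 / sqrt 2) *\<^sub>R y) = y" for y :: 'k by simp
  have neg: "cscale (-1) y - y = - (2 *\<^sub>R y)" for y :: 'k
    by (simp add: cscale_apply scaleR_2)
  have gen: "swap_path k t z = z - 2 *\<^sub>R swap_isom k (adj (swap_isom k) z)" for z
    unfolding swap_path_def m conj_ext_apply by (simp add: neg blinfun_rep)
  show "swap_path k t (A 0 x) = A (Suc k) x" "swap_path k t (A (Suc k) x) = A 0 x"
    unfolding gen adj_swap_isom by (simp_all add: swap_isom_def blinfun_rep adj_slots[OF A(1)] scaleR_right_diff_distrib)
qed

lemma norm_swaps: "norm (swaps n t x) = norm x"
  by (induction n arbitrary: x) (simp_all add: norm_swap_path)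

lemma clin_swaps: "clin (swaps n t)"
  by (induction n) (auto intro: clin_intros clin_swap_path)

lemma continuous_on_swaps: "continuous_on UNIV (swaps n)"
proof (induction n)
  case 0 then show ?case by simp
next
  case (Suc n)
  have c: "continuous_on UNIV (\<lambda>t. cscale (cis (pi * min 1 (max 0 (t - real n)))) :: 'k \<Rightarrow>\<^sub>L 'k)"
    by (intro bounded_linear.continuous_on[OF bounded_linear_cscale] continuous_intros)
  show ?case
    using Suc unfolding swaps.simps swap_path_def conj_ext_def
    by (intro bounded_bilinear.continuous_on[OF bounded_bilinear_blinfun_compose] continuous_intros c)
qed

text \<open>Factors whose time has not yet come are the identity, so the seemingly infinite product
  is locally finite in \<open>t\<close>; this also gives continuity of
  \<open>shift_path\<close>.\<close>

lemma swaps_stable: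
  assumes "t \<le> real n" "n \<le> m"
  shows "swaps m t = swaps n t"
  using assms(2,1)
proof (induction m rule: dec_induct)
  case (step m)
  then have "t - real m \<le> 0" by simp
  then have "swaps (Suc m) t = swaps m t"
    by (simp add: swap_path_le_0) (rule blinfun_eqI, simp)
  then show ?case using step by simp
qed simp

lemma shift_path_eq: "t \<le> real n \<Longrightarrow> shift_path t = swaps n t"
  unfolding shift_path_def by (metis swaps_stable linorder_linear nat_ceiling_le_eq real_nat_ceiling_ge)

lemma continuous_on_shift_path: "continuous_on UNIV shift_path"
proof (rule continuous_at_imp_continuous_on, rule ballI)
  fix t :: real
  obtain n where n: "t < real n" using reals_Archimedean2 by blast
  have "isCont (swaps n) t" using continuous_on_swaps by (simp add: continuous_on_eq_continuous_at)
  moreover have "\<forall>\<^sub>F s in nhds t. shift_path s = swaps n s"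
    using order_tendstoD(2)[OF tendsto_ident_at n, of UNIV] n
    by (intro eventually_mono[OF eventually_nhds_in_open[of "{..<real n}" t]])
       (auto intro: shift_path_eq)
  ultimately show "isCont shift_path t" by (simp add: isCont_cong)
qed

lemma swaps_slot:
  assumes "real n \<le> t"
  shows "swaps n t (A k x) = (if k < n then A (Suc k) x else if k = n then A 0 x else A k x)"
  using assms
proof (induction n)
  case (Suc n)
  then have t: "1 \<le> t - real n" and IH: "real n \<le> t" by auto
  consider "k < n" | "k = n" | "k = Suc n" | "k > Suc n" by linarith
  then show ?case
    using Suc.IH[OF IH] swap_path_ge_1[OF t, of n x] swap_path_fixes[of "Suc k" n "t - real n" x]
      swap_path_fixes[of k n "t - real n" x] by cases auto
qed simp

lemma shift_path_slot:
  assumes "real (Suc k) \<le> t"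
  shows "shift_path t (A k x) = A (Suc k) x"
proof -
  have "swaps m t (A k x) = A (Suc k) x" if "Suc k \<le> m" for m
    using that
  proof (induction m rule: dec_induct)
    case base then show ?case using swaps_slot[OF assms, of k x] by simp
  next
    case (step m) then show ?case by (simp add: swap_path_fixes)
  qed
  moreover have "Suc k \<le> nat \<lceil>t\<rceil>" using assms by linarith
  ultimately show ?thesis unfolding shift_path_def by blast
qed

lemma norm_shift_path: "norm (shift_path t x) = norm x"
  by (simp add: shift_path_def norm_swaps)

text \<open>On each slot the path is eventually constant. The vectors with convergence form a
  subspace, and it is closed because all operators involved are isometries; as the slots are
  exhausting, it is everything.\<close>

lemma shift_path_tendsto: "((\<lambda>t. shift_path t x) \<longlongrightarrow> shift x) at_top"
proof -
  define S where "S = {x. ((\<lambda>t. shift_path t x - shift x) \<longlongrightarrow> 0) at_top}"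
  have "x \<in> S"
  proof (rule exhausting_induct[OF A(2)])
    show "subspace S"
      unfolding subspace_def S_def
    proof (intro conjI ballI allI; simp)
      show "((\<lambda>t. shift_path t (x + y) - shift (x + y)) \<longlongrightarrow> 0) at_top"
        if "((\<lambda>t. shift_path t x - shift x) \<longlongrightarrow> 0) at_top" "((\<lambda>t. shift_path t y - shift y) \<longlongrightarrow> 0) at_top" for x y
        using tendsto_add[OF that] by (simp add: blinfun.add_right algebra_simps)
      show "((\<lambda>t. shift_path t (c *\<^sub>R x) - shift (c *\<^sub>R x)) \<longlongrightarrow> 0) at_top"
        if "((\<lambda>t. shift_path t x - shift x) \<longlongrightarrow> 0) at_top" for c x
        using tendsto_scaleR[OF tendsto_const that, of c] by (simp add: blinfun.scaleR_right algebra_simps)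
    qed
    show "A k y \<in> S" for k y
    proof -
      have "\<forall>\<^sub>F t in at_top. shift_path t (A k y) - shift (A k y) = 0"
        using eventually_ge_at_top[of "real (Suc k)"]
        by eventually_elim (simp add: shift_path_slot shift_slot)
      then show ?thesis unfolding S_def by (auto intro: tendsto_eventually)
    qed
    show "closed S"
      unfolding closure_subset_eq[symmetric]
    proof
      fix x assume x: "x \<in> closure S"
      have "\<forall>\<^sub>F t in at_top. dist (shift_path t x - shift x) 0 < e" if "0 < e" for e
      proof -
        obtain z where z: "z \<in> S" "dist z x < e / 4"
          using x \<open>0 < e\<close> unfolding closure_approachable by (metis zero_less_divide_iff zero_less_numeral)
        have "\<forall>\<^sub>F t in at_top. dist (shift_path t z - shift z) 0 < e / 4"
          using z(1) \<open>0 < e\<close> unfolding S_def by (intro tendstoD) auto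
        then show ?thesis
        proof eventually_elim
          case (elim t)
          have eq: "shift_path t x - shift x =
              (shift_path t z - shift z) + (shift_path t (x - z) - shift (x - z))"
            by (simp add: blinfun.diff_right)
          have "norm (shift_path t x - shift x) \<le>
              norm (shift_path t z - shift z) + (norm (shift_path t (x - z)) + norm (shift (x - z)))"
            unfolding eq
            using norm_triangle_ineq[of "shift_path t z - shift z" "shift_path t (x - z) - shift (x - z)"]
              norm_triangle_ineq4[of "shift_path t (x - z)" "shift (x - z)"] by linarith
          then show ?case
            using elim z(2) \<open>0 < e\<close> by (simp add: norm_shift_path norm_shift dist_norm norm_minus_commute)
        qed
      qed
      then show "x \<in> S" unfolding S_def by (auto intro: tendstoI)
    qed
  qed
  then have "((\<lambda>t. (shift_path t x - shift x) + shift x) \<longlongrightarrow> 0 + shift x) at_top"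
    unfolding S_def by (intro tendsto_intros) auto
  then show ?thesis by simp
qed

lemma UE_homotopic_shift:
  assumes "continuous_map X euclidean f" "\<And>x. x \<in> topspace X \<Longrightarrow> f x \<in> UE"
  shows "UE_homotopic X f (\<lambda>x. conj_ext shift (f x))"
proof (rule UE_homotopic_stabilize[OF _ norm_shift_path _ continuous_on_shift_path clin_shift norm_shift
      shift_path_tendsto assms])
  show "clin (shift_path t)" for t by (simp add: shift_path_def clin_swaps)
  show "shift_path 0 = id_blinfun" by (simp add: shift_path_def)
qed

end

text \<open>After stabilization by the shift there is room for a rotation: the ranges of \<open>shift o v\<close>
  and \<open>A 0 o s'\<close> are orthogonal for all \<open>v\<close>.  In particular the index does not depend on the
  trivialization, without recourse to the contractibility of the unitary group.\<close>

lemma UE_homotopic_conj_ext: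
  fixes s s' :: "'x \<Rightarrow> 'a::sep_chilbert \<Rightarrow>\<^sub>L 'k::sep_chilbert"
  assumes inf: "\<not> finite_dim (UNIV :: 'k set)"
    and cont: "continuous_map X euclidean s" "continuous_map X euclidean s'"
      "continuous_map X euclidean u"
    and s: "\<And>x. x \<in> topspace X \<Longrightarrow> part_isom (W x) (s x) \<and> part_isom (W x) (s' x)"
    and u: "\<And>x. x \<in> topspace X \<Longrightarrow> u x \<in> UE"
    and fx: "\<And>x w. x \<in> topspace X \<Longrightarrow> w \<in> orth_comp (W x) \<Longrightarrow> u x w = w"
  shows "UE_homotopic X (\<lambda>x. conj_ext (s x) (u x)) (\<lambda>x. conj_ext (s' x) (u x))"
proof -
  obtain A :: "nat \<Rightarrow> 'k \<Rightarrow>\<^sub>L 'k" where A: "slots A" "exhausting A" "\<And>k. clin (A k)"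
    using exists_slots[OF inf inf] by blast
  define R where "R = shift A"
  note R = clin_shift[OF A, folded R_def] norm_shift[OF A, folded R_def] shift_orth[OF A, folded R_def]
  note nA = slots_norm[OF A(1)]
  have comp: "part_isom (W x) (r o\<^sub>L v)" if "part_isom (W x) v" "clin r" "\<And>y. norm (r y) = norm y"
    for x and r :: "'k \<Rightarrow>\<^sub>L 'k" and v
    using that unfolding part_isom_def by (auto intro: clin_intros)
  \<comment> \<open>The endpoint does not involve \<open>v\<close>, so both given families of
    partial isometries are connected to the same one.\<close>
  have to_A: "UE_homotopic X (\<lambda>x. conj_ext (v x) (u x)) (\<lambda>x. conj_ext (A 0 o\<^sub>L s' x) (u x))"
    if v: "continuous_map X euclidean v" "\<And>x. x \<in> topspace X \<Longrightarrow> part_isom (W x) (v x)" for v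
  proof -
    have "UE_homotopic X (\<lambda>x. conj_ext (v x) (u x)) (\<lambda>x. conj_ext R (conj_ext (v x) (u x)))"
      unfolding R_def
      by (rule UE_homotopic_shift[OF A]) (auto intro: cont_intros cont v(1) conj_ext_UE[OF v(2) u fx])
    also have "UE_homotopic X (\<lambda>x. conj_ext R (conj_ext (v x) (u x))) (\<lambda>x. conj_ext (A 0 o\<^sub>L s' x) (u x))"
      unfolding conj_ext_conj_ext[OF R(2)]
      by (rule UE_homotopic_rotate[where W = W])
         (use v s u fx R nA A(3) comp in \<open>auto intro!: cont_intros cont\<close>)
    finally show ?thesis .
  qed
  show ?thesis
    using UE_homotopic_trans[OF to_A[of s] UE_homotopic_sym[OF to_A[of s']]] cont s by blast
qed

section \<open>Existence of trivializations\<close>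

text \<open>An Eilenberg swindle: with \<open>P\<close> the projection onto \<open>W\<close>, the space $W \oplus A \oplus A \oplus \cdots$ is
  regrouped as $(P A \oplus (1-P) A) \oplus (P A \oplus (1-P) A) \oplus \cdots$.\<close>

lemma exists_trivialization:
  fixes W :: "'x \<Rightarrow> 'a::sep_chilbert set" and X :: "'x topology"
  assumes inf: "\<not> finite_dim (UNIV :: 'a set)" "\<not> finite_dim (UNIV :: 'h::sep_chilbert set)"
      "\<not> finite_dim (UNIV :: 'k::sep_chilbert set)"
    and W: "continuous_family X W"
  shows "\<exists>T :: 'x \<Rightarrow> ('a \<times> 'h) \<Rightarrow>\<^sub>L 'k. trivialization X W T"
proof -
  obtain B :: "nat \<Rightarrow> 'a \<Rightarrow>\<^sub>L 'h" where B: "slots B" "exhausting B" "\<And>k. clin (B k)"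
    using exists_slots[OF inf(1,2)] by blast
  obtain C :: "nat \<Rightarrow> 'a \<Rightarrow>\<^sub>L 'k" where C: "slots C" "exhausting C" "\<And>k. clin (C k)"
    using exists_slots[OF inf(1,3)] by blast
  have C': "slots (\<lambda>k. C (Suc k))" using C(1) by (simp add: slots_def)
  \<comment> \<open>With Q = 1 - P: slot \<open>k\<close> of the auxiliary space sends its Q part to
    slot \<open>k\<close> of the target and its P part to slot \<open>Suc k\<close>; the P part of
    slot 0 thereby left free receives \<open>W x\<close>.\<close>
  define T where "T x = (C 0 o\<^sub>L Proj (W x) o\<^sub>L fst_blinfun) +
      ((amp B C (id_blinfun - Proj (W x)) + amp B (\<lambda>k. C (Suc k)) (Proj (W x))) o\<^sub>L snd_blinfun)" for x
  have cP: "continuous_map X euclidean (\<lambda>x. Proj (W x))" using W by (simp add: continuous_family_def)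
  have camp: "continuous_map X euclidean (\<lambda>x. amp B E (f x))"
    if "slots E" "continuous_map X euclidean f" for E :: "nat \<Rightarrow> 'a \<Rightarrow>\<^sub>L 'k" and f
    using that(2) unfolding continuous_map_euclidean_iff
    by (auto intro!: bounded_linear.tendsto[OF bounded_linear_amp[OF B(1) that(1)]])
  have cT: "continuous_map X euclidean T"
    unfolding T_def by (intro cont_intros cP camp C C')
  have "Vector_Spaces.linear scaleC scaleC (blinfun_apply (T x)) \<and>
        (\<forall>v \<in> W x \<times> UNIV. \<forall>w \<in> W x \<times> UNIV. cinner (T x v) (T x w) = cinner v w) \<and>
        T x ` (W x \<times> UNIV) = UNIV \<and>
        (\<forall>v \<in> orth_comp (W x \<times> UNIV). T x v = 0)" if x: "x \<in> topspace X" for x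
  proof -
    interpret P: closed_csubspace "W x"
      using W x by (auto simp: continuous_family_def closed_csubspace_def)
    define p where "p = Proj (W x)"
    define q where "q = id_blinfun - p"
    have q: "q y = y - p y" for y by (simp add: q_def minus_blinfun.rep_eq)
    have pq: "p y \<bullet> q z = 0" for y z
      using P.Proj_self[of y "z - p z"] by (simp add: q p_def blinfun.diff_right)
    have T: "T x (a, h) = C 0 (p a) + (amp B C q h + amp B (\<lambda>k. C (Suc k)) p h)" for a h
      by (simp add: T_def p_def q_def plus_blinfun.rep_eq)
    have cl: "clin p" "clin q" unfolding p_def q_def by (intro clin_intros P.clin_Proj)+
    have "clin (amp B C q)" "clin (amp B (\<lambda>k. C (Suc k)) p)"
      by (intro clin_amp B C C'; simp add: clin_scaleC[OF clin_adj[OF B(3)]] clin_scaleC[OF cl(1)]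
          clin_scaleC[OF cl(2)] clin_scaleC[OF C(3)])+
    then have clT: "clin (T x)"
      unfolding T_def p_def[symmetric] q_def[symmetric] by (intro clin_intros C cl)
    have normT: "norm (T x v) = norm v" if v: "v \<in> W x \<times> UNIV" for v
    proof -
      obtain a h where ah: "v = (a, h)" "p a = a" using v by (auto simp: p_def P.Proj_id)
      define Y Z where "Y = amp B C q h" and "Z = amp B (\<lambda>k. C (Suc k)) p h"
      have XY: "C 0 a \<bullet> Y = 0"
        using pq[of a] by (simp add: adj_right Y_def adj_amp[OF B(1) C(1)] ah(2))
      have XZ: "C 0 a \<bullet> Z = 0"
        unfolding Z_def by (subst inner_commute, rule amp_inner_zero[OF B(1) C'])
          (simp add: slots_inner[OF C(1)])
      have YZ: "Y \<bullet> Z = 0"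
        unfolding Z_def
      proof (subst inner_commute, rule amp_inner_zero[OF B(1) C'])
        show "C (Suc k) (p (adj (B k) h)) \<bullet> Y = 0" for k
          unfolding Y_def by (subst adj_right) (simp add: adj_amp[OF B(1) C(1)] pq)
      qed
      have "(norm (T x v))\<^sup>2 = (norm a)\<^sup>2 + ((norm Y)\<^sup>2 + (norm Z)\<^sup>2)"
        using XY XZ YZ
        by (simp add: ah T Y_def[symmetric] Z_def[symmetric] norm_add_orthogonal inner_add_right slots_norm[OF C(1)])
      also have "(norm Y)\<^sup>2 + (norm Z)\<^sup>2 = (\<Sum>k. (norm (q (adj (B k) h)))\<^sup>2 + (norm (p (adj (B k) h)))\<^sup>2)"
        unfolding Y_def Z_def amp_norm[OF B(1) C(1)] amp_norm[OF B(1) C']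
        by (intro suminf_add amp_summable(1)[OF B(1) C(1)])
      also have "\<dots> = (\<Sum>k. (norm (adj (B k) h))\<^sup>2)"
      proof -
        have "(norm (q y))\<^sup>2 + (norm (p y))\<^sup>2 = (norm y)\<^sup>2" for y
        proof -
          have "y = p y + q y" by (simp add: q)
          then have "(norm y)\<^sup>2 = (norm (p y + q y))\<^sup>2" by (rule arg_cong)
          also have "\<dots> = (norm (p y))\<^sup>2 + (norm (q y))\<^sup>2" by (rule norm_add_orthogonal) (rule pq)
          finally show ?thesis by linarith
        qed
        then show ?thesis by (simp only:)
      qed
      also have "\<dots> = (norm h)\<^sup>2" by (rule parseval[OF B(1,2)])
      finally have "(norm (T x v))\<^sup>2 = (norm v)\<^sup>2"
        by (simp add: ah power2_norm_eq_inner)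
      then show ?thesis by simp
    qed
    have csub: "cvec.subspace (W x \<times> (UNIV :: 'h set))"
      using P.csub by (auto simp: cvec.subspace_def scaleC_prod_def zero_prod_def)
    have zeroT: "T x v = 0" if v: "v \<in> orth_comp (W x \<times> UNIV)" for v
    proof -
      obtain a h where ah: "v = (a, h)" by force
      have *: "a \<bullet> w + h \<bullet> z = 0" if "w \<in> W x" for w z
        using orth_comp_inner[OF v, of "(w, z)"] that by (simp add: ah)
      have "h = 0" using *[of 0 h] P.csub by (simp add: cvec.subspace_0)
      moreover have "p a = 0" unfolding p_def
        by (rule P.Proj_zero) (use *[of _ 0] in \<open>simp add: orth_comp_iff[OF P.csub]\<close>)
      ultimately show ?thesis by (simp add: ah T)
    qed
    have iso: "part_isom (W x \<times> UNIV) (T x)"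
      unfolding part_isom_def closed_csubspace_def
      using csub P.closed clT normT zeroT by (auto intro: closed_Times)
    have "cinner (T x v) (T x w) = cinner v w" if "v \<in> W x \<times> UNIV" "w \<in> W x \<times> UNIV" for v w
      unfolding cinner_eq_Complex using part_isom_inner[OF iso that(1)] clin_scaleC[OF clT, of \<i> w] by metis
    moreover have "T x ` (W x \<times> UNIV) = UNIV"
    proof (rule closed_subspace_eq_UNIV)
      have sub: "subspace (W x \<times> (UNIV :: 'h set))" by (rule csubspace_imp_subspace[OF csub])
      show "subspace (T x ` (W x \<times> UNIV))"
        by (intro linear_subspace_image sub bounded_linear.linear blinfun.bounded_linear_right)
      show "closed (T x ` (W x \<times> UNIV))"
        using P.closed normT
        by (intro closed_image_bounded_below[OF sub, of 1]) (auto intro: closed_Times)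
      fix z assume z: "\<And>y. y \<in> T x ` (W x \<times> UNIV) \<Longrightarrow> z \<bullet> y = 0"
      have z': "T x (p a, h) \<bullet> z = 0" for a h
        using z[of "T x (p a, h)"] P.Proj_in by (simp add: inner_commute p_def)
      have pp: "p (p y) = p y" "p (q y) = 0" "q (q y) = q y" "q (p y) = 0" for y
        by (simp_all add: q p_def blinfun.diff_right)
      \<comment> \<open>Every component of \<open>z\<close> is met by the range: the P part of slot
        0 from \<open>W x\<close>, the P part of slot \<open>Suc k\<close> and the Q part of slot
        \<open>k\<close> from slot \<open>k\<close> of the auxiliary space.\<close>
      have p0: "p (adj (C 0) z) = 0"
      proof (rule inner_ext)
        fix y
        have "C 0 (p y) \<bullet> z = 0" using z'[of y 0] by (simp add: T pp)
        then show "y \<bullet> p (adj (C 0) z) = y \<bullet> 0" by (simp add: adj_right p_def P.Proj_self)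
      qed
      have Tslot: "T x (p 0, B k y) = C k (q y) + C (Suc k) (p y)" for k y
        by (simp add: T amp_slot[OF B(1) C(1)] amp_slot[OF B(1) C'])
      have pS: "p (adj (C (Suc k)) z) = 0" for k
      proof (rule inner_ext)
        fix y
        have "C (Suc k) (p y) \<bullet> z = 0" using z'[of 0 "B k (p y)"] unfolding Tslot by (simp add: pp)
        then show "y \<bullet> p (adj (C (Suc k)) z) = y \<bullet> 0" by (simp add: adj_right p_def P.Proj_self)
      qed
      have qk: "q (adj (C k) z) = 0" for k
      proof (rule inner_ext)
        fix y
        have "C k (q y) \<bullet> z = 0" using z'[of 0 "B k (q y)"] unfolding Tslot by (simp add: pp)
        then have "q y \<bullet> adj (C k) z = 0" by (simp add: adj_right)
        then show "y \<bullet> q (adj (C k) z) = y \<bullet> 0"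
          by (simp add: q inner_diff_left inner_diff_right p_def P.Proj_self)
      qed
      have "adj (C k) z = 0" for k
        using qk[of k] p0 pS by (cases k) (simp_all add: q)
      then have "z \<bullet> C k y = 0" for k y by (simp add: inner_commute[of z] adj_right)
      then show "z = 0" using C(2) unfolding exhausting_def by blast
    qed
    ultimately show ?thesis using clT zeroT by (simp add: linear_iff_clin)
  qed
  then have "trivialization X W T" using cT by (simp add: trivialization_def)
  then show ?thesis by blast
qed

section \<open>Schur complements of unitaries\<close>

text \<open>
  In block form with respect to \<open>W\<close> and its orthogonal complement, a unitary \<open>F\<close> satisfies
  \<open>F + 1 = [[1, X], [0, 1]] diag(G + 1, r\<^sup>-\<^sup>1) [[1, 0], [Y, 1]]\<close>
  if the lower right block \<open>r\<^sup>-\<^sup>1\<close> of \<open>F + 1\<close> is invertible, and then \<open>G\<close> is unitary.  Replacing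
  \<open>X\<close>, \<open>Y\<close>, \<open>r\<close> by \<open>t X\<close>, \<open>t Y\<close> and $1/2 + t^2 (r - 1/2)$ gives a path of unitaries from
  $G \oplus 1$ to \<open>F\<close>; it is the symplectic scaling of a Lagrangian complement of $\Gamma^*$.
\<close>

definition compl_proj :: "'a::sep_chilbert set \<Rightarrow> 'a \<Rightarrow>\<^sub>L 'a" where
  "compl_proj W = id_blinfun - Proj W"

text \<open>Completing the lower right block by the identity on \<open>W\<close> allows inversion on
  the fixed ambient space, where continuity in the parameter is available.\<close>

definition schur_r :: "('a::sep_chilbert \<Rightarrow>\<^sub>L 'a) \<Rightarrow> 'a set \<Rightarrow> 'a \<Rightarrow>\<^sub>L 'a" where
  "schur_r F W = binv (Proj W + (compl_proj W o\<^sub>L (id_blinfun + F) o\<^sub>L compl_proj W))"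

definition schur_X :: "('a::sep_chilbert \<Rightarrow>\<^sub>L 'a) \<Rightarrow> 'a set \<Rightarrow> 'a \<Rightarrow>\<^sub>L 'a" where
  "schur_X F W = Proj W o\<^sub>L F o\<^sub>L compl_proj W o\<^sub>L schur_r F W"

definition schur_Y :: "('a::sep_chilbert \<Rightarrow>\<^sub>L 'a) \<Rightarrow> 'a set \<Rightarrow> 'a \<Rightarrow>\<^sub>L 'a" where
  "schur_Y F W = schur_r F W o\<^sub>L compl_proj W o\<^sub>L F o\<^sub>L Proj W"

text \<open>The Schur complement of \<open>F + 1\<close> with the identity of \<open>W\<close>
  subtracted; it vanishes on the complement of \<open>W\<close>.\<close>

definition schur_G :: "('a::sep_chilbert \<Rightarrow>\<^sub>L 'a) \<Rightarrow> 'a set \<Rightarrow> 'a \<Rightarrow>\<^sub>L 'a" where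
  "schur_G F W = (Proj W o\<^sub>L F o\<^sub>L Proj W) - (schur_X F W o\<^sub>L compl_proj W o\<^sub>L F o\<^sub>L Proj W)"

definition schur_R :: "('a::sep_chilbert \<Rightarrow>\<^sub>L 'a) \<Rightarrow> 'a set \<Rightarrow> real \<Rightarrow> 'a \<Rightarrow>\<^sub>L 'a" where
  "schur_R F W t = Proj W + (1/2) *\<^sub>R compl_proj W +
     t\<^sup>2 *\<^sub>R ((schur_r F W - (1/2) *\<^sub>R id_blinfun) o\<^sub>L compl_proj W)"

text \<open>The scaled triangular product minus 1, multiplied out: the upper diagonal block
  contributes \<open>schur_G F W + Proj W\<close>, and \<open>Proj W - 1\<close> is
  \<open>- compl_proj W\<close>.\<close>

definition schur :: "('a::sep_chilbert \<Rightarrow>\<^sub>L 'a) \<Rightarrow> 'a set \<Rightarrow> real \<Rightarrow> 'a \<Rightarrow>\<^sub>L 'a" where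
  "schur F W t = schur_G F W +
     ((t *\<^sub>R schur_X F W + id_blinfun) o\<^sub>L binv (schur_R F W t) o\<^sub>L (t *\<^sub>R schur_Y F W + compl_proj W)) -
     compl_proj W"

text \<open>The product of \<open>V\<close> with the inverse of \<open>U\<close> is within distance
  less than 1 of the identity, hence coercive.\<close>

lemma near_unitary_surj:
  fixes U V :: "'a::sep_chilbert \<Rightarrow>\<^sub>L 'a"
  assumes U: "\<And>x. norm (U x) = norm x" "surj (blinfun_apply U)"
    and close: "norm (V - U) < 1"
  shows "surj (blinfun_apply V)"
proof -
  have "coercive (1 - norm (V - U)) (V o\<^sub>L adj U)"
    unfolding coercive_def
  proof
    fix y
    have "\<bar>(V - U) (adj U y) \<bullet> y\<bar> \<le> norm ((V - U) (adj U y)) * norm y"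
      by (rule Cauchy_Schwarz_ineq2)
    also have "\<dots> \<le> (norm (V - U) * norm (adj U y)) * norm y"
      by (intro mult_right_mono norm_blinfun) simp
    also have "\<dots> = norm (V - U) * (norm y)\<^sup>2"
      using adj_unitary(2)[OF U] by (simp add: power2_eq_square)
    finally have "\<bar>V (adj U y) \<bullet> y - (norm y)\<^sup>2\<bar> \<le> norm (V - U) * (norm y)\<^sup>2"
      using adj_unitary(1)[OF U] by (simp add: minus_blinfun.rep_eq inner_diff_left power2_norm_eq_inner)
    then show "(1 - norm (V - U)) * (norm y)\<^sup>2 \<le> (V o\<^sub>L adj U) y \<bullet> y"
      by (simp add: algebra_simps)
  qed
  then have "surj (blinfun_apply (V o\<^sub>L adj U))" by (rule coercive_surj) (use close in simp)
  then have "\<exists>x. y = V (adj U x)" for y by (simp add: surj_def)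
  then show ?thesis unfolding surj_def by blast
qed

locale schur_unitary = closed_csubspace W for W :: "'a::sep_chilbert set" +
  fixes F :: "'a \<Rightarrow>\<^sub>L 'a" and d :: real
  assumes clinF: "clin F" and normF: "norm (F x) = norm x" and surjF: "surj (blinfun_apply F)"
    and d: "0 < d" and coF: "b \<in> orth_comp W \<Longrightarrow> d * (norm b)\<^sup>2 \<le> (F b + b) \<bullet> b"
begin

abbreviation "P \<equiv> Proj W"
abbreviation "Q \<equiv> compl_proj W"
abbreviation "r \<equiv> schur_r F W"
abbreviation "XX \<equiv> schur_X F W"
abbreviation "YY \<equiv> schur_Y F W"
abbreviation "G \<equiv> schur_G F W"
abbreviation "RR \<equiv> schur_R F W"

lemma Q_apply: "Q x = x - P x"
  by (simp add: compl_proj_def minus_blinfun.rep_eq)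

lemma PQ: "P (P x) = P x" "Q (Q x) = Q x" "P (Q x) = 0" "Q (P x) = 0"
  by (simp_all add: Q_apply blinfun.diff_right)

lemma PQ_orth: "P x \<bullet> Q y = 0" "Q y \<bullet> P x = 0"
proof -
  show "Q y \<bullet> P x = 0" unfolding Q_apply by (rule orth_comp_inner[OF Proj_orth Proj_in])
  then show "P x \<bullet> Q y = 0" by (simp only: inner_commute)
qed

lemma Q_iff: "Q z = z \<longleftrightarrow> P z = 0"
  by (simp add: Q_apply)

lemma norm_PQ: "(norm x)\<^sup>2 = (norm (P x))\<^sup>2 + (norm (Q x))\<^sup>2"
proof -
  have "x = P x + Q x" by (simp add: Q_apply)
  then have "(norm x)\<^sup>2 = (norm (P x + Q x))\<^sup>2" by (rule arg_cong)
  then show ?thesis by (simp add: norm_add_orthogonal PQ_orth)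
qed

definition MM :: "'a \<Rightarrow>\<^sub>L 'a" where
  "MM = P + (Q o\<^sub>L (id_blinfun + F) o\<^sub>L Q)"

lemma MM_apply: "MM x = P x + Q (Q x + F (Q x))"
  by (simp add: MM_def plus_blinfun.rep_eq)

lemma co_MM: "coercive (min 1 d) MM" "0 < min 1 d"
proof -
  show "coercive (min 1 d) MM"
    unfolding coercive_def
  proof
    fix x
    have "Q x \<in> orth_comp W" using Proj_orth by (simp add: Q_apply)
    then have 1: "d * (norm (Q x))\<^sup>2 \<le> (F (Q x) + Q x) \<bullet> Q x" by (rule coF)
    have "x = P x + Q x" by (simp add: Q_apply)
    then have "MM x \<bullet> x = (P x + Q (Q x + F (Q x))) \<bullet> (P x + Q x)" unfolding MM_apply by simp
    also have "\<dots> = P x \<bullet> P x + Q (Q x + F (Q x)) \<bullet> Q x"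
      by (simp add: inner_add_left inner_add_right PQ_orth)
    also have "Q (Q x + F (Q x)) \<bullet> Q x = (Q x + F (Q x)) \<bullet> Q x"
      using PQ_orth(1)[of "Q x + F (Q x)" x] by (simp add: Q_apply[of "Q x + F (Q x)"] inner_diff_left)
    finally have "MM x \<bullet> x = (norm (P x))\<^sup>2 + (F (Q x) + Q x) \<bullet> Q x"
      by (simp add: power2_norm_eq_inner add.commute)
    moreover have "min 1 d * (norm x)\<^sup>2 \<le> 1 * (norm (P x))\<^sup>2 + d * (norm (Q x))\<^sup>2"
      unfolding norm_PQ[of x] distrib_left by (intro add_mono mult_right_mono) auto
    ultimately show "min 1 d * (norm x)\<^sup>2 \<le> MM x \<bullet> x" using 1 by linarith
  qed
qed (use d in simp)

section \<open>Unitarity expressed through the Schur factors\<close>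

lemma r_eq: "r = binv MM"
  by (simp add: schur_r_def MM_def)

lemma MM_r: "MM (r x) = x" and r_MM: "r (MM x) = x"
  unfolding r_eq by (rule binv_coercive[OF co_MM])+

lemma P_r: "P (r x) = P x"
proof -
  have "P x = P (MM (r x))" by (simp add: MM_r)
  then show ?thesis by (simp add: MM_apply blinfun.add_right PQ)
qed

lemma r_eqn: "P z = 0 \<Longrightarrow> Q (F (r z)) = z - r z"
proof -
  assume z: "P z = 0"
  then have rz: "P (r z) = 0" "Q (r z) = r z" by (simp_all add: P_r Q_iff)
  have "MM (r z) = r z + Q (F (r z))" by (simp add: MM_apply rz blinfun.add_right)
  then show ?thesis by (simp add: MM_r algebra_simps)
qed

text \<open>The vector \<open>r z\<close> solves the lower row of \<open>F + 1\<close> with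
  right-hand side \<open>z\<close>, and the upper row then yields \<open>XX z\<close>.\<close>

lemma F_r: "P z = 0 \<Longrightarrow> F (r z) = XX z + z - r z"
proof -
  assume z: "P z = 0"
  then have "XX z = P (F (r z))" by (simp add: schur_X_def Q_iff[THEN iffD2] P_r)
  moreover have "F (r z) = P (F (r z)) + Q (F (r z))" by (simp add: Q_apply)
  ultimately show ?thesis using r_eqn[OF z] by (simp add: algebra_simps)
qed

lemma PY: "P (YY x) = 0"
  by (simp add: schur_Y_def P_r PQ)

lemma PX: "P (XX x) = XX x"
  by (simp add: schur_X_def)

lemma PG: "P (G x) = G x" and G_P: "G (P x) = G x"
  by (simp_all add: schur_G_def minus_blinfun.rep_eq blinfun.diff_right PX)

text \<open>The correction by \<open>YY v\<close> is what makes the lower row of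
  \<open>F + 1\<close> vanish; the upper row is then the Schur complement applied to
  \<open>v\<close>.\<close>

lemma F_Y:
  assumes v: "P v = v"
  shows "F (v - YY v) = G v + YY v"
proof -
  have Yv: "YY v = r (Q (F v))" by (simp add: schur_Y_def v)
  have Qr: "Q (r (Q (F v))) = r (Q (F v))" by (simp add: Q_iff P_r PQ)
  have A: "F (YY v) = XX (Q (F v)) + Q (F v) - YY v"
    unfolding Yv by (rule F_r) (rule PQ)
  have B: "G v = P (F v) - XX (Q (F v))"
    by (simp add: schur_G_def minus_blinfun.rep_eq v)
  have C: "F v = P (F v) + Q (F v)" by (simp add: Q_apply)
  have "F (v - YY v) = (P (F v) + Q (F v)) - (XX (Q (F v)) + Q (F v) - YY v)"
    unfolding blinfun.diff_right by (rule arg_cong2[where f = minus, OF C A])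
  then show ?thesis unfolding B by simp
qed

lemma F_inner: "F x \<bullet> F y = x \<bullet> y"
  by (rule polarization_isometry) (rule normF)

lemma norm_G:
  assumes v: "P v = v"
  shows "norm (G v) = norm v"
proof -
  have "v \<bullet> YY v = 0" using PQ_orth(1)[of v "YY v"] v PY[of v] by (simp add: Q_iff[THEN iffD2])
  moreover have "G v \<bullet> YY v = 0"
    using PQ_orth(1)[of "G v" "YY v"] PG[of v] PY[of v] by (simp add: Q_iff[THEN iffD2])
  moreover have "(norm (F (v - YY v)))\<^sup>2 = (norm (v - YY v))\<^sup>2" by (simp add: normF)
  ultimately have "(norm (G v))\<^sup>2 = (norm v)\<^sup>2"
    unfolding F_Y[OF v]
    by (simp add: power2_norm_eq_inner inner_diff_left inner_diff_right inner_add_left inner_add_right inner_commute)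
  then show ?thesis by simp
qed

text \<open>Comparing norms of \<open>r z\<close> and \<open>F (r z)\<close>. In particular the real
  part of \<open>r\<close> off \<open>W\<close> is at least 1/2, and its excess over 1/2 is
  quadratic in \<open>XX\<close>.\<close>

lemma inner_r:
  assumes z: "P z = 0"
  shows "2 * (z \<bullet> r z) = (norm z)\<^sup>2 + (norm (XX z))\<^sup>2"
proof -
  have "XX z \<bullet> z = 0" "XX z \<bullet> r z = 0"
    using PQ_orth(1)[of "XX z" z] PQ_orth(1)[of "XX z" "r z"] PX[of z] z P_r[of z]
    by (simp_all add: Q_iff[THEN iffD2])
  moreover have "(norm (F (r z)))\<^sup>2 = (norm (r z))\<^sup>2" by (simp add: normF)
  ultimately show ?thesis
    unfolding F_r[OF z]
    by (simp add: power2_norm_eq_inner inner_diff_left inner_diff_right inner_add_left inner_add_right inner_commute)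
qed

text \<open>Polarised isometry of \<open>F\<close> between the vectors of \<open>F_Y\<close> and
  \<open>F_r\<close>. Together with \<open>norm_G\<close> and \<open>inner_r\<close> it expresses
  that \<open>F\<close> is isometric. The three relations are homogeneous when \<open>XX\<close> and
  \<open>YY\<close> are scaled by t and \<open>r - 1/2\<close> by t^2, so the scaled factors satisfy
  them again.\<close>

lemma G_X:
  assumes v: "P v = v" and z: "P z = 0"
  shows "G v \<bullet> XX z = - (YY v \<bullet> z)"
proof -
  have o: "a \<bullet> b = 0" if "P a = a" "P b = 0" for a b
    using PQ_orth(1)[of a b] that by (simp add: Q_iff[THEN iffD2])
  have "F (v - YY v) \<bullet> F (r z) = (v - YY v) \<bullet> r z" by (rule F_inner)
  then have "(G v + YY v) \<bullet> (XX z + z - r z) = (v - YY v) \<bullet> r z"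
    unfolding F_Y[OF v] F_r[OF z] .
  moreover have "v \<bullet> r z = 0" "G v \<bullet> z = 0" "G v \<bullet> r z = 0" "XX z \<bullet> YY v = 0"
    using o v z PX PG PY P_r by auto
  ultimately show ?thesis
    by (simp add: inner_diff_left inner_diff_right inner_add_left inner_add_right inner_commute)
qed

section \<open>The scaled path and its unitarity\<close>

lemma RR_apply: "RR t x = P x + (1/2) *\<^sub>R Q x + t\<^sup>2 *\<^sub>R (r (Q x) - (1/2) *\<^sub>R Q x)"
  by (simp add: schur_R_def plus_blinfun.rep_eq minus_blinfun.rep_eq scaleR_blinfun.rep_eq)

lemma co_RR: "coercive (1/2) (RR t)"
  unfolding coercive_def
proof
  fix x
  define z where "z = Q x"
  have z: "P z = 0" by (simp add: z_def PQ)
  have Pz: "P x \<bullet> z = 0" "P x \<bullet> r z = 0"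
    using PQ_orth(1)[of x "r z"] z by (simp_all add: z_def PQ_orth Q_iff[THEN iffD2] P_r PQ)
  have "x = P x + z" by (simp add: Q_apply z_def)
  then have "RR t x \<bullet> x = (P x + (1/2) *\<^sub>R z + t\<^sup>2 *\<^sub>R (r z - (1/2) *\<^sub>R z)) \<bullet> (P x + z)"
    unfolding RR_apply z_def by simp
  also have "\<dots> = (norm (P x))\<^sup>2 + (1/2) * (norm z)\<^sup>2 + t\<^sup>2 * (z \<bullet> r z - (1/2) * (norm z)\<^sup>2)"
    using Pz by (simp add: inner_add_left inner_add_right inner_diff_left inner_diff_right power2_norm_eq_inner inner_commute)
  also have "\<dots> = (norm (P x))\<^sup>2 + (1/2) * (norm z)\<^sup>2 + t\<^sup>2 * ((1/2) * (norm (XX z))\<^sup>2)"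
    using inner_r[OF z] by simp
  finally show "1/2 * (norm x)\<^sup>2 \<le> RR t x \<bullet> x"
    unfolding norm_PQ[of x] z_def by simp
qed

text \<open>The component off \<open>W\<close> of \<open>(schur F W t + 1) u\<close>.\<close>

definition "zz t u = binv (RR t) (t *\<^sub>R YY u + Q u)"

lemma zz:
  shows P_zz: "P (zz t u) = 0" and RR_zz: "RR t (zz t u) = t *\<^sub>R YY u + Q u"
    and zz_eq: "Q u = (1/2) *\<^sub>R zz t u + t\<^sup>2 *\<^sub>R (r (zz t u) - (1/2) *\<^sub>R zz t u) - t *\<^sub>R YY u"
proof -
  show 1: "RR t (zz t u) = t *\<^sub>R YY u + Q u"
    unfolding zz_def by (rule binv_coercive(1)[OF co_RR]) simp
  have "P (RR t y) = P y" for y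
    by (simp add: RR_apply blinfun.add_right blinfun.scaleR_right blinfun.diff_right PQ P_r)
  then show 2: "P (zz t u) = 0"
    using 1 by (metis PQ(3) PY blinfun.add_right blinfun.scaleR_right add.right_neutral scaleR_zero_right)
  show "Q u = (1/2) *\<^sub>R zz t u + t\<^sup>2 *\<^sub>R (r (zz t u) - (1/2) *\<^sub>R zz t u) - t *\<^sub>R YY u"
    using 1 unfolding RR_apply 2 Q_iff[THEN iffD2, OF 2] by (simp add: algebra_simps)
qed

lemma schur_apply: "schur F W t u = (G u + t *\<^sub>R XX (zz t u)) + (zz t u - Q u)"
  by (simp add: schur_def zz_def plus_blinfun.rep_eq minus_blinfun.rep_eq scaleR_blinfun.rep_eq)

lemma schur_parts: "P (G u + t *\<^sub>R XX (zz t u)) = G u + t *\<^sub>R XX (zz t u)" "P (zz t u - Q u) = 0"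
  by (simp_all add: blinfun_rep PG PX P_zz PQ)

lemma PQ_pyth:
  assumes "P a = a" "P b = 0"
  shows "(norm (a + b))\<^sup>2 = (norm a)\<^sup>2 + (norm b)\<^sup>2"
  using PQ_orth(1)[of a b] assms by (simp add: norm_add_orthogonal Q_iff[THEN iffD2])

lemma YY_P: "YY (P x) = YY x"
  by (simp add: schur_Y_def PQ)

text \<open>Pythagoras along \<open>W\<close> and its complement. Once the lower part of
  \<open>u\<close> is written in terms of \<open>z\<close>, the terms linear in t cancel by
  \<open>G_X\<close> and those in t^2 by \<open>inner_r\<close>.\<close>

lemma norm_schur: "norm (schur F W t u) = norm u"
proof -
  define v b z where "v = P u" and "b = Q u" and "z = zz t u"
  have v: "P v = v" by (simp add: v_def)
  have z: "P z = 0" by (simp add: z_def P_zz)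
  have b: "b = (1/2) *\<^sub>R z + t\<^sup>2 *\<^sub>R (r z - (1/2) *\<^sub>R z) - t *\<^sub>R YY v"
    using zz_eq[of u t] by (simp add: b_def z_def v_def YY_P)
  have zb: "2 * (z \<bullet> b) = (norm z)\<^sup>2 + t\<^sup>2 * (norm (XX z))\<^sup>2 - 2 * t * (YY v \<bullet> z)"
  proof -
    have "2 * (z \<bullet> b) = (norm z)\<^sup>2 + t\<^sup>2 * (2 * (z \<bullet> r z) - (norm z)\<^sup>2) - 2 * t * (YY v \<bullet> z)"
      unfolding b by (simp add: inner_diff_right inner_add_right power2_norm_eq_inner inner_commute algebra_simps)
    then show ?thesis unfolding inner_r[OF z] by simp
  qed
  have "(norm (schur F W t u))\<^sup>2 = (norm (G u + t *\<^sub>R XX z))\<^sup>2 + (norm (z - b))\<^sup>2"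
    unfolding schur_apply z_def b_def by (rule PQ_pyth) (rule schur_parts)+
  also have "(norm (G u + t *\<^sub>R XX z))\<^sup>2 = (norm (G v))\<^sup>2 + 2 * t * (G v \<bullet> XX z) + t\<^sup>2 * (norm (XX z))\<^sup>2"
    unfolding v_def G_P
    by (simp add: power2_norm_eq_inner inner_add_left inner_add_right inner_commute power2_eq_square[of t] algebra_simps)
  also have "(norm (z - b))\<^sup>2 = (norm z)\<^sup>2 - 2 * (z \<bullet> b) + (norm b)\<^sup>2"
    by (simp add: power2_norm_eq_inner inner_diff_left inner_diff_right inner_commute)
  finally have "(norm (schur F W t u))\<^sup>2 = (norm u)\<^sup>2"
    unfolding zb G_X[OF v z] norm_G[OF v] norm_PQ[of u] v_def[symmetric] b_def[symmetric] by simp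
  then show ?thesis by simp
qed

lemma schur_1: "schur F W 1 = F"
proof (rule blinfun_eqI)
  fix u
  define z where "z = zz 1 u"
  have z: "P z = 0" by (simp add: z_def P_zz)
  have Q: "Q u = r z - YY u" using zz_eq[of u 1] by (simp add: z_def)
  have "u = (P u - YY (P u)) + r z" using Q by (simp add: YY_P Q_apply algebra_simps)
  then have "F u = F ((P u - YY (P u)) + r z)" by (rule arg_cong)
  also have "\<dots> = F (P u - YY (P u)) + F (r z)" by (rule blinfun.add_right)
  also have "\<dots> = (G u + YY u) + (XX z + z - r z)"
    unfolding F_r[OF z] using F_Y[of "P u"] by (simp add: G_P YY_P)
  also have "\<dots> = schur F W 1 u" unfolding schur_apply z_def[symmetric] Q by simp
  finally show "schur F W 1 u = F u" by simp
qed

lemma schur_0: "schur F W 0 u = G u + Q u"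
proof -
  have "Q u = (1/2) *\<^sub>R zz 0 u" using zz_eq[of u 0] by simp
  then have "zz 0 u = 2 *\<^sub>R Q u" by simp
  then show ?thesis unfolding schur_apply by (simp add: scaleR_2)
qed

lemma clin_schur_parts: "clin r" "clin XX" "clin YY" "clin G" "clin (RR t)"
proof -
  have Q: "clin Q" unfolding compl_proj_def by (intro clin_intros clin_Proj)
  have "clin MM" unfolding MM_def by (intro clin_intros clin_Proj clinF Q)
  then show r: "clin r" unfolding r_eq by (rule clin_binv[OF _ co_MM])
  show X: "clin XX" unfolding schur_X_def by (intro clin_intros clin_Proj clinF Q r)
  show "clin YY" unfolding schur_Y_def by (intro clin_intros clin_Proj clinF Q r)
  show "clin G" unfolding schur_G_def by (intro clin_intros clin_Proj clinF Q X)
  show "clin (RR t)" unfolding schur_R_def by (intro clin_intros clin_Proj Q r)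
qed

lemma clin_schur: "clin (schur F W t)"
proof -
  have "clin Q" unfolding compl_proj_def by (intro clin_intros clin_Proj)
  moreover have "clin (binv (RR t))" by (rule clin_binv[OF clin_schur_parts(5) co_RR]) simp
  ultimately show ?thesis unfolding schur_def by (simp add: clin_intros clin_schur_parts)
qed

lemma continuous_schur: "continuous_on UNIV (schur F W)"
proof -
  have "continuous_map euclidean euclidean (schur F W)"
    unfolding schur_def[abs_def] schur_R_def
  proof (intro cont_intros)
    have "continuous_map euclidean euclidean (\<lambda>t. binv (RR t))"
    proof (rule cont_binv)
      show "continuous_map euclidean euclidean RR"
        unfolding schur_R_def[abs_def] by (intro cont_intros) (auto intro!: continuous_intros)
      show "\<exists>d>0. coercive d (RR t)" for t using co_RR[of t] by (intro exI[of _ "1/2"]) simp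
    qed
    then show "continuous_map euclidean euclidean (\<lambda>t. binv (P + (1/2) *\<^sub>R Q + t\<^sup>2 *\<^sub>R ((r - (1/2) *\<^sub>R id_blinfun) o\<^sub>L Q)))"
      unfolding schur_R_def .
  qed auto
  then show ?thesis by simp
qed

text \<open>Isometries near a surjective one are surjective and conversely, so surjectivity is an
  open and closed condition on \<open>t\<close>; it holds at \<open>t = 1\<close>, where the
  operator is \<open>F\<close>.\<close>

lemma surj_schur: "surj (blinfun_apply (schur F W t))"
proof -
  define S where "S = {t. surj (blinfun_apply (schur F W t))}"
  have near: "\<exists>e>0. \<forall>s. dist s t < e \<longrightarrow> norm (schur F W s - schur F W t) < 1" for t
    using continuous_schur unfolding continuous_on_iff by (force simp: dist_norm)
  have S_iff: "s \<in> S \<longleftrightarrow> t \<in> S" if "norm (schur F W s - schur F W t) < 1" for s t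
    using near_unitary_surj[OF norm_schur, of s "schur F W t"] near_unitary_surj[OF norm_schur, of t "schur F W s"]
      that unfolding S_def by (auto simp: norm_minus_commute)
  have "open S" "open (- S)"
    unfolding open_dist using near S_iff by (auto; meson)+
  then have "S = UNIV \<or> S = {}" using clopen[of S] by (auto simp: closed_def)
  moreover have "1 \<in> S" using surjF by (simp add: S_def schur_1)
  ultimately show ?thesis unfolding S_def by blast
qed

lemma G_surj: "w \<in> W \<Longrightarrow> \<exists>v\<in>W. G v = w"
proof -
  assume w: "w \<in> W"
  obtain u where u: "schur F W 0 u = w" using surj_schur[of 0] by (metis surjD)
  then have "P (G u + Q u) = G u + Q u" using Proj_id[OF w] by (simp add: schur_0)
  then have "Q u = 0" by (simp add: blinfun.add_right PG PQ)
  then have "G (P u) = w" using u by (simp add: schur_0 G_P)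
  then show ?thesis using Proj_in by blast
qed

text \<open>On such a vector \<open>F + 1\<close> is 2 and \<open>r\<close> is 1/2, so the scaled
  excess \<open>r - 1/2\<close> and both triangular terms vanish.\<close>

lemma schur_fixes:
  assumes "F a = a" "P a = 0"
  shows "schur F W t a = a"
proof -
  have Qa: "Q a = a" by (simp add: Q_iff assms)
  have "MM ((1/2) *\<^sub>R a) = a"
  proof -
    have "MM a = 2 *\<^sub>R a" by (simp add: MM_apply assms Qa blinfun.add_right scaleR_2)
    then show ?thesis by (simp add: blinfun.scaleR_right)
  qed
  then have ra: "r a = (1/2) *\<^sub>R a" using r_MM by metis
  have Xa: "XX a = 0" by (simp add: schur_X_def ra blinfun.scaleR_right Qa assms)
  have "RR t (2 *\<^sub>R a) = a"
    by (simp add: RR_apply blinfun.scaleR_right Qa assms ra)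
  moreover have Ya: "YY a = 0" using YY_P[of a] assms by simp
  ultimately have "zz t a = 2 *\<^sub>R a"
    unfolding zz_def using binv_coercive(2)[OF co_RR, of t "2 *\<^sub>R a"] by (simp add: Qa)
  moreover have "G a = 0" using G_P[of a] assms by simp
  moreover have "XX (2 *\<^sub>R a) = 0" by (simp only: blinfun.scaleR_right Xa scaleR_zero_right)
  ultimately show ?thesis by (simp add: schur_apply Qa) (simp add: scaleR_2)
qed

text \<open>The outer factors are triangular with bounded inverses, so a lower bound for the
  diagonal block \<open>G + 1\<close> on \<open>W\<close> passes to the product.\<close>

lemma schur_UE:
  assumes B: "finite B" "0 < e" "\<And>v. v \<in> W \<Longrightarrow> v \<in> orth_comp B \<Longrightarrow> e * norm v \<le> norm (G v + v)"
  shows "schur F W t \<in> UE"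
proof -
  \<comment> \<open>The number \<open>a\<close> pays for removing the upper triangular factor in the
    estimate of the \<open>W\<close> part; \<open>c\<close> adds the cost of recovering the
    complementary part as \<open>RR t z - t YY v\<close>.\<close>
  define a where "a = 1 + \<bar>t\<bar> * norm XX"
  define c where "c = a / e + (norm (RR t) + \<bar>t\<bar> * norm YY * (a / e))"
  have a: "1 \<le> a" by (simp add: a_def)
  have ae: "0 < a / e" using a B(2) by simp
  have c: "0 < c" unfolding c_def
    by (intro add_pos_nonneg ae add_nonneg_nonneg mult_nonneg_nonneg) (use ae in auto)
  have "(1 / c) * norm u \<le> norm ((schur F W t + id_blinfun) u)" if u: "u \<in> orth_comp (blinfun_apply P ` B)" for u
  proof -
    define v z k where "v = P u" and "z = zz t u" and "k = norm ((schur F W t + id_blinfun) u)"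
    have "cinner v b = cinner u (P b)" for b
      unfolding v_def using cinner_adj[OF clin_Proj, of u b] by simp
    then have "v \<in> orth_comp B" using u by (auto simp: orth_comp_def)
    then have ev: "e * norm v \<le> norm (G v + v)" using B(3) Proj_in by (simp add: v_def)
    have u_eq: "u = v + Q u" by (simp add: v_def Q_apply)
    have "(schur F W t + id_blinfun) u = (G u + t *\<^sub>R XX z) + (z - Q u) + u"
      by (simp add: plus_blinfun.rep_eq schur_apply z_def)
    also have "\<dots> = (G v + v + t *\<^sub>R XX z) + z"
      using u_eq by (simp add: v_def G_P algebra_simps)
    finally have k2: "k\<^sup>2 = (norm (G v + v + t *\<^sub>R XX z))\<^sup>2 + (norm z)\<^sup>2"
      unfolding k_def by (simp add: PQ_pyth blinfun_rep PG PX v_def P_zz z_def)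
    have k0: "0 \<le> k" by (simp add: k_def)
    have zk: "norm z \<le> k" and gk: "norm (G v + v + t *\<^sub>R XX z) \<le> k"
      by (rule power2_le_imp_le; use k2 k0 in simp)+
    have "norm (G v + v) \<le> norm (G v + v + t *\<^sub>R XX z) + norm (t *\<^sub>R XX z)"
      using norm_triangle_ineq4[of "G v + v + t *\<^sub>R XX z" "t *\<^sub>R XX z"] by simp
    also have "norm (t *\<^sub>R XX z) \<le> (\<bar>t\<bar> * norm XX) * k"
    proof -
      have "norm (XX z) \<le> norm XX * k"
        using norm_blinfun[of XX z] zk by (meson mult_left_mono norm_ge_zero order_trans)
      then have "\<bar>t\<bar> * norm (XX z) \<le> \<bar>t\<bar> * (norm XX * k)" by (intro mult_left_mono) auto
      then show ?thesis by (simp add: mult.assoc)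
    qed
    finally have "norm (G v + v) \<le> a * k" using gk by (simp add: a_def algebra_simps)
    then have "e * norm v \<le> a * k" using ev by linarith
    then have vk: "norm v \<le> (a / e) * k" using B(2) by (simp add: field_simps)
    have "Q u = RR t z - t *\<^sub>R YY v" by (simp add: RR_zz z_def v_def YY_P)
    then have "norm (Q u) \<le> norm (RR t z) + norm (t *\<^sub>R YY v)" by (metis norm_triangle_ineq4)
    also have "norm (RR t z) \<le> norm (RR t) * k"
      using norm_blinfun[of "RR t" z] zk by (meson mult_left_mono norm_ge_zero order_trans)
    also have "norm (t *\<^sub>R YY v) \<le> \<bar>t\<bar> * norm YY * (a / e) * k"
    proof -
      have "norm (YY v) \<le> norm YY * ((a / e) * k)"
        using norm_blinfun[of YY v] vk by (meson mult_left_mono norm_ge_zero order_trans)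
      then have "\<bar>t\<bar> * norm (YY v) \<le> \<bar>t\<bar> * (norm YY * ((a / e) * k))" by (intro mult_left_mono) auto
      then show ?thesis by (simp add: mult.assoc)
    qed
    finally have "norm u \<le> c * k"
      using vk norm_triangle_ineq[of v "Q u"] unfolding u_eq[symmetric] c_def distrib_right by linarith
    then show ?thesis using c by (simp add: k_def field_simps)
  qed
  moreover have "finite (blinfun_apply P ` B)" using B(1) by simp
  ultimately have "ess_below (schur F W t + id_blinfun)"
    unfolding ess_below_def using c by (meson divide_pos_pos zero_less_one)
  then show ?thesis
    unfolding UE_def using clin_schur norm_schur surj_schur by simp
qed

end

lemma cont_schur:
  assumes F: "continuous_map X euclidean F" and W: "continuous_map X euclidean (\<lambda>x. Proj (W x))"
    and s: "\<And>x. x \<in> topspace X \<Longrightarrow> \<exists>d. schur_unitary (W x) (F x) d"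
    and t: "continuous_map X euclidean t"
  shows "continuous_map X euclidean (\<lambda>x. schur (F x) (W x) (t x))"
proof -
  have Q: "continuous_map X euclidean (\<lambda>x. compl_proj (W x))"
    unfolding compl_proj_def by (intro cont_intros W)
  have r: "continuous_map X euclidean (\<lambda>x. schur_r (F x) (W x))"
    unfolding schur_r_def
  proof (rule cont_binv)
    fix x assume "x \<in> topspace X"
    then obtain d where "schur_unitary (W x) (F x) d" using s by blast
    then interpret schur_unitary "W x" "F x" d .
    show "\<exists>d>0. coercive d (Proj (W x) + (compl_proj (W x) o\<^sub>L (id_blinfun + F x) o\<^sub>L compl_proj (W x)))"
      using co_MM unfolding MM_def by blast
  qed (intro cont_intros F W Q)
  have X: "continuous_map X euclidean (\<lambda>x. schur_X (F x) (W x))"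
    and Y: "continuous_map X euclidean (\<lambda>x. schur_Y (F x) (W x))"
    unfolding schur_X_def schur_Y_def by (intro cont_intros F W Q r)+
  have G: "continuous_map X euclidean (\<lambda>x. schur_G (F x) (W x))"
    unfolding schur_G_def by (intro cont_intros F W Q X)
  have R: "continuous_map X euclidean (\<lambda>x. binv (schur_R (F x) (W x) (t x)))"
  proof (rule cont_binv)
    show "continuous_map X euclidean (\<lambda>x. schur_R (F x) (W x) (t x))"
      unfolding schur_R_def
      by (intro cont_intros W Q r cont_real[OF t, where g = "\<lambda>t. t\<^sup>2"] continuous_intros)
    fix x assume "x \<in> topspace X"
    then obtain d where "schur_unitary (W x) (F x) d" using s by blast
    then interpret schur_unitary "W x" "F x" d .
    show "\<exists>d>0. coercive d (schur_R (F x) (W x) (t x))"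
      using co_RR[of "t x"] by (intro exI[of _ "1/2"]) simp
  qed
  show ?thesis unfolding schur_def by (intro cont_intros G X Y R Q t)
qed

section \<open>Lagrangian subspaces as graphs of unitaries\<close>

lemma cinner_diff_left: "cinner (x - y) z = cinner x z - cinner y z"
  by (rule linear_diff[OF bounded_linear.linear[OF bounded_linear_cinner_left]])

lemma cinner_minus_left: "cinner (- x) z = - cinner x z"
  by (rule linear_neg[OF bounded_linear.linear[OF bounded_linear_cinner_left]])

lemma cinner_diff_right: "cinner x (y - z) = cinner x y - cinner x z"
  by (simp add: cinner_commute[of x] cinner_diff_left)

lemma cinner_minus_right: "cinner x (- y) = - cinner x y"
  by (simp add: cinner_commute[of x] cinner_minus_left)

lemmas cinner_simps = cinner_add_left cinner_diff_left cinner_minus_left cinner_scaleC_left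
  cinner_right cinner_diff_right cinner_minus_right

lemma cinner_sym_0: "cinner x y = 0 \<longleftrightarrow> cinner y x = 0"
  using cinner_commute[of x y] cinner_commute[of y x] by auto

text \<open>For a Lagrangian subspace this operator exchanges the two eigenspaces of
  \<open>J\<close> and restricts to the graph unitary on one and to its inverse on the other. Being
  a polynomial in the projection, it makes continuity in families evident.\<close>

definition reflection :: "'a::sep_chilbert set \<Rightarrow> 'a \<Rightarrow>\<^sub>L 'a" where
  "reflection S = 2 *\<^sub>R Proj S - id_blinfun"

lemma reflection_apply: "reflection S x = 2 *\<^sub>R Proj S x - x"
  by (simp add: reflection_def blinfun_rep)

context closed_csubspace
begin

lemma refl_refl: "reflection S (reflection S x) = x"
  by (simp add: reflection_apply blinfun_rep scaleR_2)

lemma norm_refl: "norm (reflection S x) = norm x"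
proof -
  have "x \<bullet> Proj S x = Proj S x \<bullet> Proj S x" using Proj_self[of x "Proj S x"] by simp
  then have "(norm (reflection S x))\<^sup>2 = (norm x)\<^sup>2"
    by (simp add: reflection_apply power2_norm_eq_inner inner_diff_left inner_diff_right inner_commute)
  then show ?thesis by simp
qed

lemma refl_iff: "reflection S x = x \<longleftrightarrow> x \<in> S"
proof -
  have "reflection S x = x \<longleftrightarrow> 2 *\<^sub>R Proj S x = 2 *\<^sub>R x" by (auto simp: reflection_apply scaleR_2 algebra_simps)
  then show ?thesis by (simp add: Proj_iff)
qed

lemma clin_refl: "clin (reflection S)"
  unfolding reflection_def by (intro clin_intros clin_Proj)

end

locale symp_space =
  fixes J :: "'a::sep_chilbert \<Rightarrow>\<^sub>L 'a"
  assumes unitaryJ: "unitary_op J" and skewJ: "skew_adjoint_op J"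
begin

lemma clinJ: "clin J"
  using unitaryJ by (simp add: unitary_op_def linear_iff_clin)

lemma cJ: "cinner (J x) y = - cinner x (J y)"
  using skewJ by (simp add: skew_adjoint_op_def)

lemma JJ [simp]: "J (J x) = - x"
proof (rule inner_ext)
  fix y
  have "cinner (J (J x)) y = - cinner x y"
    unfolding cJ[of "J x"] using unitaryJ by (simp add: unitary_op_def)
  then show "y \<bullet> J (J x) = y \<bullet> - x"
    by (metis Re_cinner inner_commute inner_minus_right uminus_complex.sel(1))
qed

lemma J_scaleC: "J (c *\<^sub>C x) = c *\<^sub>C J x"
  by (rule clin_scaleC[OF clinJ])

definition pos :: "'a \<Rightarrow>\<^sub>L 'a" where
  "pos = (1/2) *\<^sub>R (id_blinfun - (cscale \<i> o\<^sub>L J))"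

lemma pos_apply: "pos x = (1/2) *\<^sub>R (x - \<i> *\<^sub>C J x)"
  by (simp add: pos_def blinfun_rep cscale_apply)

lemma pos_neg_orth:
  assumes "J x = \<i> *\<^sub>C x" "J y = (- \<i>) *\<^sub>C y"
  shows "cinner x y = 0"
  using cJ[of x y] unfolding assms by (simp add: cinner_simps)

lemma J_pos: "J (pos x) = \<i> *\<^sub>C pos x"
proof -
  have "J (pos x) = (1/2) *\<^sub>R (J x + \<i> *\<^sub>C x)"
    by (simp add: pos_apply blinfun_rep J_scaleC cvec.scale_minus_right)
  also have "\<dots> = \<i> *\<^sub>C pos x"
    by (simp add: pos_apply bounded_bilinear.scaleR_right[OF bounded_bilinear_scaleC]
        cvec.scale_right_diff_distrib scaleC_scaleC cvec.scale_minus_left add.commute)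
  finally show ?thesis .
qed

lemma J_minus_pos: "J (x - pos x) = (- \<i>) *\<^sub>C (x - pos x)"
proof -
  have e: "x - pos x = (1/2) *\<^sub>R (x + \<i> *\<^sub>C J x)"
  proof -
    have "(1/2) *\<^sub>R x + (1/2) *\<^sub>R x = x" by (simp add: scaleR_left_distrib[symmetric])
    then have "x - pos x = ((1/2) *\<^sub>R x + (1/2) *\<^sub>R x) - pos x" by (simp only:)
    also have "\<dots> = (1/2) *\<^sub>R (x + \<i> *\<^sub>C J x)"
      unfolding pos_apply scaleR_right_diff_distrib scaleR_right_distrib by (simp only: add_diff_eq diff_diff_eq2 add_diff_cancel_right' add.commute add.left_commute) (simp add: algebra_simps)
    finally show ?thesis .
  qed
  have "J (x - pos x) = (1/2) *\<^sub>R (J x - \<i> *\<^sub>C x)"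
    unfolding e by (simp add: blinfun_rep J_scaleC cvec.scale_minus_right)
  also have "\<dots> = (- \<i>) *\<^sub>C (x - pos x)"
    unfolding e by (simp add: bounded_bilinear.scaleR_right[OF bounded_bilinear_scaleC]
        cvec.scale_right_distrib scaleC_scaleC cvec.scale_minus_left)
  finally show ?thesis .
qed

lemma closed_csubspace_pos_part:
  assumes "closed_csubspace \<Lambda>"
  shows "closed_csubspace (pos_part J \<Lambda>)"
proof -
  interpret closed_csubspace \<Lambda> by fact
  have "pos_part J \<Lambda> = \<Lambda> \<inter> {x. J x = \<i> *\<^sub>C x}" by (auto simp: pos_part_def)
  moreover have "closed {x. J x = \<i> *\<^sub>C x}"
    using continuous_on_id
    by (intro closed_Collect_eq continuous_intros linear_continuous_on
        bounded_bilinear.bounded_linear_right[OF bounded_bilinear_scaleC])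
  moreover have "cvec.subspace {x. J x = \<i> *\<^sub>C x}"
    by (auto simp: cvec.subspace_def blinfun.add_right scaleC_add_right J_scaleC scaleC_scaleC mult.commute)
  ultimately show ?thesis
    using csub closed by (simp add: closed_csubspace_def cvec.subspace_inter closed_Int)
qed

lemma pos_part_UNIV: "closed_csubspace (pos_part J UNIV)"
  by (rule closed_csubspace_pos_part) (simp add: closed_csubspace_def)

lemma Proj_pos: "Proj (pos_part J UNIV) = pos"
proof (rule blinfun_eqI)
  interpret closed_csubspace "pos_part J UNIV" by (rule pos_part_UNIV)
  fix x
  show "Proj (pos_part J UNIV) x = pos x"
  proof (rule Proj_unique)
    show "pos x \<in> pos_part J UNIV" by (simp add: pos_part_def J_pos)
    show "x - pos x \<in> orth_comp (pos_part J UNIV)"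
      using pos_neg_orth J_minus_pos unfolding orth_comp_def pos_part_def
      by (auto simp: cinner_sym_0[of "x - pos x"])
  qed
qed

lemma pos_id: "J x = \<i> *\<^sub>C x \<Longrightarrow> pos x = x"
  using closed_csubspace.Proj_id[OF pos_part_UNIV, of x] unfolding Proj_pos by (simp add: pos_part_def)

lemma pos_zero: "J x = (- \<i>) *\<^sub>C x \<Longrightarrow> pos x = 0"
  using closed_csubspace.Proj_zero[OF pos_part_UNIV, of x] pos_neg_orth unfolding Proj_pos
  by (auto simp: orth_comp_def pos_part_def cinner_sym_0[of x])

lemma pos_in: "cvec.subspace \<Lambda> \<Longrightarrow> (\<And>x. x \<in> \<Lambda> \<Longrightarrow> J x \<in> \<Lambda>) \<Longrightarrow> x \<in> \<Lambda> \<Longrightarrow> pos x \<in> \<Lambda>"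
  using csubspace_imp_subspace[of \<Lambda>]
  by (simp add: pos_apply subspace_scale cvec.subspace_diff cvec.subspace_scale)

text \<open>Two candidates differ by a vector of \<open>N\<close> on which \<open>J\<close> is - i;
  there the form is definite, while \<open>N\<close> is isotropic. The assumptions are those which
  \<open>N_sub\<close> and \<open>N_iso\<close> provide for the reduced subspace.\<close>

lemma graph_unitary_eqI:
  assumes sub: "cvec.subspace N" and iso: "\<And>a b. a \<in> N \<Longrightarrow> b \<in> N \<Longrightarrow> symp J a b = 0"
    and y: "y \<in> neg_part J \<Lambda>" "x + y \<in> N"
  shows "graph_unitary J \<Lambda> N x = y"
  unfolding graph_unitary_def
proof (rule the_equality)
  show "y \<in> neg_part J \<Lambda> \<and> x + y \<in> N" using y by simp
  fix z assume z: "z \<in> neg_part J \<Lambda> \<and> x + z \<in> N"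
  have "(x + z) - (x + y) \<in> N" using z y sub cvec.subspace_diff by blast
  then have "z - y \<in> N" by simp
  then have "cinner (J (z - y)) (z - y) = 0" using iso by (simp add: symp_def)
  moreover have "J (z - y) = (- \<i>) *\<^sub>C (z - y)"
    using y(1) z by (simp add: neg_part_def blinfun.diff_right cvec.scale_right_diff_distrib)
  ultimately have "cinner (z - y) (z - y) = 0" by (simp add: cinner_simps)
  then show "z = y" by (simp add: cinner_self)
qed

lemma closed_csubspace_annihilator: "closed_csubspace (annihilator J UNIV S)"
proof -
  have eq: "annihilator J UNIV S = blinfun_apply J -` orth_comp S"
    by (auto simp: annihilator_def symp_def orth_comp_def)
  have "closed (blinfun_apply J -` orth_comp S)"
    by (intro continuous_closed_vimage closed_orth_comp continuous_intros)
  moreover have "cvec.subspace (blinfun_apply J -` orth_comp S)"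
    using csubspace_orth_comp[of S] by (auto simp: cvec.subspace_def blinfun.add_right J_scaleC)
  ultimately show ?thesis unfolding eq by (simp add: closed_csubspace_def)
qed

lemma closed_csubspace_Int:
  "closed_csubspace S \<Longrightarrow> closed_csubspace T \<Longrightarrow> closed_csubspace (S \<inter> T)"
  by (simp add: closed_csubspace_def cvec.subspace_inter closed_Int)

context
  fixes \<Lambda> L :: "'a set"
  assumes \<Lambda>: "closed_csubspace \<Lambda>" and inv\<Lambda>: "\<And>x. x \<in> \<Lambda> \<Longrightarrow> J x \<in> \<Lambda>"
    and L: "lagrangian J \<Lambda> L"
begin

lemma lagrangian_closed: "closed_csubspace L"
proof -
  have "annihilator J \<Lambda> L = \<Lambda> \<inter> annihilator J UNIV L" by (auto simp: annihilator_def)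
  then show ?thesis
    using L closed_csubspace_Int[OF \<Lambda> closed_csubspace_annihilator, of L] by (simp add: lagrangian_def)
qed

lemma lagrangian_isotropic: "a \<in> L \<Longrightarrow> b \<in> L \<Longrightarrow> symp J a b = 0"
  using L unfolding lagrangian_def annihilator_def by blast

lemma lagrangian_sub: "L \<subseteq> \<Lambda>"
  using L unfolding lagrangian_def annihilator_def by blast

text \<open>Within \<open>\<Lambda>\<close>, \<open>J\<close> exchanges \<open>L\<close> and its
  orthogonal complement, hence anticommutes with the reflection.\<close>

lemma refl_lagrangian:
  assumes x: "x \<in> \<Lambda>" "J x = s *\<^sub>C x"
  shows "reflection L x \<in> \<Lambda>" "J (reflection L x) = (- s) *\<^sub>C reflection L x"
proof -
  interpret L: closed_csubspace L by (rule lagrangian_closed)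
  interpret A: closed_csubspace \<Lambda> by (rule \<Lambda>)
  define p where "p = Proj L x"
  have p: "p \<in> L" "x - p \<in> orth_comp L" unfolding p_def by (rule L.Proj_in L.Proj_orth)+
  have p\<Lambda>: "p \<in> \<Lambda>" using p lagrangian_sub by blast
  show "reflection L x \<in> \<Lambda>"
    unfolding reflection_apply p_def[symmetric] using x p\<Lambda> A.sub by (intro subspace_diff subspace_scale)
  have JpL: "J p \<in> orth_comp L"
    using lagrangian_isotropic[OF p(1)] by (simp add: orth_comp_def symp_def)
  have "cinner (p - x) y = 0" if "y \<in> L" for y
    using p(2) that by (simp add: orth_comp_def cinner_diff_left)
  then have "J (x - p) \<in> annihilator J \<Lambda> L"
    unfolding annihilator_def symp_def
    using inv\<Lambda> x(1) p\<Lambda> A.csub by (auto simp: cvec.subspace_diff)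
  then have JxL: "J (x - p) \<in> L" using L by (simp add: lagrangian_def)
  have "s *\<^sub>C x = J p + J (x - p)" using x(2) by (simp add: blinfun.diff_right)
  then have "Proj L (s *\<^sub>C x) = J (x - p)"
    by (simp add: blinfun.add_right L.Proj_id[OF JxL] L.Proj_zero[OF JpL])
  then have "s *\<^sub>C p = s *\<^sub>C x - J p"
    using x(2) by (simp add: p_def clin_scaleC[OF L.clin_Proj] blinfun.diff_right)
  then have "J p = s *\<^sub>C x - s *\<^sub>C p" by simp
  then show "J (reflection L x) = (- s) *\<^sub>C reflection L x"
    unfolding reflection_apply p_def[symmetric]
    by (simp add: blinfun_rep x(2) cvec.scale_right_diff_distrib cvec.scale_minus_left
        bounded_bilinear.scaleR_right[OF bounded_bilinear_scaleC] scaleR_right_diff_distrib scaleR_2 scaleC_add_right)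
qed

lemma add_refl_in: "x + reflection L x \<in> L"
  using closed_csubspace.Proj_in[OF lagrangian_closed] closed_csubspace.sub[OF lagrangian_closed]
  by (simp add: reflection_apply subspace_scale)

lemma graph_unitary_refl:
  assumes "x \<in> pos_part J \<Lambda>"
  shows "graph_unitary J \<Lambda> L x = reflection L x" "reflection L x \<in> neg_part J \<Lambda>"
proof -
  show 1: "reflection L x \<in> neg_part J \<Lambda>"
    using refl_lagrangian[of x \<i>] assms by (simp add: pos_part_def neg_part_def)
  show "graph_unitary J \<Lambda> L x = reflection L x"
    by (rule graph_unitary_eqI[OF _ lagrangian_isotropic 1 add_refl_in])
       (use L in \<open>simp_all add: lagrangian_def\<close>)
qed

lemma graph_unitary_inv:
  assumes "y \<in> neg_part J \<Lambda>"
  shows "inv_into (pos_part J \<Lambda>) (graph_unitary J \<Lambda> L) y = reflection L y"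
proof -
  note rr = closed_csubspace.refl_refl[OF lagrangian_closed]
  have y: "reflection L y \<in> pos_part J \<Lambda>"
    using refl_lagrangian[of y "- \<i>"] assms by (simp add: pos_part_def neg_part_def)
  have "inj_on (graph_unitary J \<Lambda> L) (pos_part J \<Lambda>)"
    by (rule inj_onI) (metis graph_unitary_refl(1) rr)
  moreover have "graph_unitary J \<Lambda> L (reflection L y) = y" using graph_unitary_refl(1)[OF y] rr by simp
  ultimately show ?thesis using y by (metis inv_into_f_f)
qed

end

end

section \<open>Symplectic reduction of one Lagrangian pair\<close>

locale reduction = symp_space +
  fixes \<Gamma> M L :: "'a set"
  assumes \<Gamma>: "closed_csubspace \<Gamma>" "isotropic J UNIV \<Gamma>"
    and M: "lagrangian J UNIV M" "transversal_to J \<Gamma> M"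
    and L: "lagrangian J (reduced_space J \<Gamma>) L"
    and LM: "fredholm_pair (reduced_space J \<Gamma>) L (reduction_image J \<Gamma> M)"
begin

abbreviation "V \<equiv> reduced_space J \<Gamma>"
abbreviation "W \<equiv> pos_part J V"
abbreviation "N \<equiv> reduction_image J \<Gamma> M"
abbreviation "L' \<equiv> reduction_preimage J \<Gamma> L"

lemma UNIV_closed: "closed_csubspace (UNIV :: 'a set)"
  by (simp add: closed_csubspace_def)

sublocale Gam: closed_csubspace \<Gamma> by (rule \<Gamma>)
sublocale Pos: closed_csubspace "pos_part J UNIV" by (rule pos_part_UNIV)

section \<open>Projections onto the spaces of the reduction\<close>

lemma Gam_iso: "a \<in> \<Gamma> \<Longrightarrow> b \<in> \<Gamma> \<Longrightarrow> cinner (J a) b = 0"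
  using \<Gamma>(2) unfolding isotropic_def annihilator_def symp_def by blast

lemma annih_iff: "x \<in> annihilator J UNIV \<Gamma> \<longleftrightarrow> (\<forall>g\<in>\<Gamma>. cinner (J x) g = 0)"
  by (simp add: annihilator_def symp_def)

lemma V_iff: "x \<in> V \<longleftrightarrow> (\<forall>g\<in>\<Gamma>. cinner (J x) g = 0 \<and> cinner x g = 0)"
  by (auto simp: reduced_space_def annih_iff orth_comp_def)

lemma Gam_annih: "\<Gamma> \<subseteq> annihilator J UNIV \<Gamma>"
  using Gam_iso by (auto simp: annih_iff)

lemma V_closed: "closed_csubspace V"
  unfolding reduced_space_def
  by (intro closed_csubspace_Int closed_csubspace_annihilator closed_csubspace_orth_comp)

sublocale V: closed_csubspace V by (rule V_closed)

lemma J_V: "x \<in> V \<Longrightarrow> J x \<in> V"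
  by (simp add: V_iff cinner_minus_left)

sublocale W: closed_csubspace W by (rule closed_csubspace_pos_part[OF V_closed])
sublocale M: closed_csubspace M by (rule lagrangian_closed[OF UNIV_closed _ M(1)]) simp
sublocale L: closed_csubspace L by (rule lagrangian_closed[OF V_closed J_V L])

lemma L_V: "L \<subseteq> V" by (rule lagrangian_sub[OF V_closed J_V L])

text \<open>Isotropy makes \<open>\<Gamma>\<close> and its image under \<open>J\<close> orthogonal,
  and \<open>V\<close> is the complement of their sum. The projection onto the image is - J Proj
  J.\<close>

lemma Proj_V: "Proj V x = x - Proj \<Gamma> x + J (Proj \<Gamma> (J x))"
proof (rule V.Proj_unique)
  have JG: "cinner (J (J (Proj \<Gamma> y))) g = - cinner (Proj \<Gamma> y) g" for y g by (simp add: cinner_minus_left)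
  have o: "cinner (y - Proj \<Gamma> y) g = 0" if "g \<in> \<Gamma>" for y g
    using Gam.Proj_orth that by (simp add: orth_comp_def)
  show "x - Proj \<Gamma> x + J (Proj \<Gamma> (J x)) \<in> V"
    unfolding V_iff
  proof (intro ballI conjI)
    fix g assume g: "g \<in> \<Gamma>"
    have J1: "cinner (J (Proj \<Gamma> y)) g = 0" for y using Gam_iso[OF Gam.Proj_in g] .
    show "cinner (x - Proj \<Gamma> x + J (Proj \<Gamma> (J x))) g = 0"
      using o[OF g, of x] J1 by (simp add: cinner_add_left)
    have "J (x - Proj \<Gamma> x + J (Proj \<Gamma> (J x))) = (J x - Proj \<Gamma> (J x)) - J (Proj \<Gamma> x)"
      by (simp add: blinfun_rep)
    then show "cinner (J (x - Proj \<Gamma> x + J (Proj \<Gamma> (J x)))) g = 0"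
      using o[OF g, of "J x"] J1 by (simp add: cinner_diff_left)
  qed
  show "x - (x - Proj \<Gamma> x + J (Proj \<Gamma> (J x))) \<in> orth_comp V"
    unfolding orth_comp_def
  proof (intro CollectI ballI)
    fix v assume v: "v \<in> V"
    have "cinner (Proj \<Gamma> y) v = 0" "cinner (Proj \<Gamma> y) (J v) = 0" for y
      using v Gam.Proj_in[of y] unfolding V_iff cinner_sym_0[of "Proj \<Gamma> y"] by auto
    then show "cinner (x - (x - Proj \<Gamma> x + J (Proj \<Gamma> (J x)))) v = 0"
      by (simp add: cinner_simps cJ)
  qed
qed

lemma J_Proj_V: "J (Proj V x) = Proj V (J x)"
  by (simp add: Proj_V blinfun_rep)

text \<open>The formula involves the family only through the projection onto
  \<open>\<Gamma>\<close>; this is the source of the continuity of the family of spaces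
  \<open>W\<close>.\<close>

lemma Proj_W: "Proj W = pos o\<^sub>L (id_blinfun - Proj \<Gamma> + (J o\<^sub>L Proj \<Gamma> o\<^sub>L J))"
proof (rule blinfun_eqI)
  fix x
  have "Proj W x = pos (Proj V x)"
  proof (rule W.Proj_unique)
    show "pos (Proj V x) \<in> W"
      using pos_in[OF V.csub J_V V.Proj_in] by (simp add: pos_part_def J_pos)
    have "cinner (Proj V x - pos (Proj V x)) w = 0" if "w \<in> W" for w
      using pos_neg_orth[of w "Proj V x - pos (Proj V x)"] J_minus_pos that
      by (auto simp: pos_part_def cinner_sym_0[of _ w])
    moreover have "cinner (x - Proj V x) w = 0" if "w \<in> W" for w
      using V.Proj_orth[of x] that by (auto simp: orth_comp_def pos_part_def)
    ultimately have "cinner ((x - Proj V x) + (Proj V x - pos (Proj V x))) w = 0" if "w \<in> W" for w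
      unfolding cinner_add_left using that by simp
    then show "x - pos (Proj V x) \<in> orth_comp W" by (simp add: orth_comp_def)
  qed
  then show "Proj W x = (pos o\<^sub>L (id_blinfun - Proj \<Gamma> + (J o\<^sub>L Proj \<Gamma> o\<^sub>L J))) x"
    by (simp add: Proj_V plus_blinfun.rep_eq minus_blinfun.rep_eq)
qed

lemma reduction_map_eqI: "v \<in> V \<Longrightarrow> x - v \<in> \<Gamma> \<Longrightarrow> reduction_map J \<Gamma> x = v"
  unfolding reduction_map_def
proof (rule the_equality)
  assume v: "v \<in> V" "x - v \<in> \<Gamma>"
  show "v \<in> V \<and> x - v \<in> \<Gamma>" using v by simp
  fix u assume u: "u \<in> V \<and> x - u \<in> \<Gamma>"
  have "(x - v) - (x - u) \<in> \<Gamma>" using u v Gam.csub cvec.subspace_diff by blast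
  then have g: "u - v \<in> \<Gamma>" by simp
  have "u - v \<in> V" using u v V.csub cvec.subspace_diff by blast
  then have "cinner (u - v) (u - v) = 0" using g by (simp add: V_iff)
  then show "u = v" by (simp add: cinner_self)
qed

lemma reduction_map_eq:
  assumes "x \<in> annihilator J UNIV \<Gamma>"
  shows "reduction_map J \<Gamma> x = x - Proj \<Gamma> x" "x - Proj \<Gamma> x \<in> V"
proof -
  have "cinner (J (x - Proj \<Gamma> x)) g = 0" "cinner (x - Proj \<Gamma> x) g = 0" if "g \<in> \<Gamma>" for g
    using assms that Gam_iso[OF Gam.Proj_in that, of x] Gam.Proj_orth[of x]
    by (auto simp: annih_iff blinfun.diff_right cinner_diff_left orth_comp_def)
  then show 1: "x - Proj \<Gamma> x \<in> V" by (simp add: V_iff)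
  show "reduction_map J \<Gamma> x = x - Proj \<Gamma> x"
    by (rule reduction_map_eqI[OF 1]) (simp add: Gam.Proj_in)
qed

lemma preimage_iff: "x \<in> L' \<longleftrightarrow> (\<exists>l\<in>L. \<exists>g\<in>\<Gamma>. x = l + g)"
proof
  assume "x \<in> L'"
  then have "x \<in> annihilator J UNIV \<Gamma>" "reduction_map J \<Gamma> x \<in> L" by (auto simp: reduction_preimage_def)
  then show "\<exists>l\<in>L. \<exists>g\<in>\<Gamma>. x = l + g"
    using reduction_map_eq(1) Gam.Proj_in by (metis diff_add_cancel)
next
  assume "\<exists>l\<in>L. \<exists>g\<in>\<Gamma>. x = l + g"
  then obtain l g where lg: "l \<in> L" "g \<in> \<Gamma>" "x = l + g" by blast
  have "l \<in> V" using lg L_V by blast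
  then have "reduction_map J \<Gamma> x = l" by (rule reduction_map_eqI) (simp add: lg)
  moreover have "x \<in> annihilator J UNIV \<Gamma>"
    using \<open>l \<in> V\<close> lg Gam_iso by (simp add: annih_iff V_iff blinfun.add_right cinner_add_left)
  ultimately show "x \<in> L'" using lg by (simp add: reduction_preimage_def)
qed

text \<open>A vector annihilating \<open>L'\<close> annihilates \<open>\<Gamma>\<close>, so it has a
  representative in \<open>V\<close>; that representative annihilates \<open>L\<close> and therefore
  lies in \<open>L\<close>.\<close>

lemma L'_lagrangian: "lagrangian J UNIV L'"
  unfolding lagrangian_def
proof
  show "cvec.subspace L'"
  proof -
    have "L' = {l + g |l g. l \<in> L \<and> g \<in> \<Gamma>}" using preimage_iff by blast
    then show ?thesis using cvec.subspace_sums[OF L.csub Gam.csub] by simp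
  qed
  show "L' = annihilator J UNIV L'"
  proof (intro equalityI subsetI)
    fix x assume "x \<in> L'"
    then obtain l g where x: "l \<in> L" "g \<in> \<Gamma>" "x = l + g" unfolding preimage_iff by blast
    have "cinner (J x) y = 0" if "y \<in> L'" for y
    proof -
      obtain l2 g2 where y: "l2 \<in> L" "g2 \<in> \<Gamma>" "y = l2 + g2" using \<open>y \<in> L'\<close> unfolding preimage_iff by blast
      have "cinner (J l) l2 = 0"
        using lagrangian_isotropic[OF V_closed J_V L x(1) y(1)] by (simp add: symp_def)
      moreover have "cinner (J l) g2 = 0" using x y L_V by (auto simp: V_iff)
      moreover have "cinner (J g) l2 = 0"
      proof -
        have "cinner (J l2) g = 0" using x y L_V by (auto simp: V_iff)
        then show ?thesis unfolding cJ[of g] using cinner_sym_0[of g "J l2"] by simp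
      qed
      moreover have "cinner (J g) g2 = 0" using Gam_iso x y by blast
      ultimately show ?thesis by (simp add: x(3) y(3) blinfun.add_right cinner_simps)
    qed
    then show "x \<in> annihilator J UNIV L'" by (simp add: annihilator_def symp_def)
  next
    fix x assume x: "x \<in> annihilator J UNIV L'"
    have xL: "cinner (J x) (l + g) = 0" if "l \<in> L" "g \<in> \<Gamma>" for l g
      using x that preimage_iff by (auto simp: annihilator_def symp_def)
    have "x \<in> annihilator J UNIV \<Gamma>"
      using xL[of 0] L.csub by (simp add: annih_iff cvec.subspace_0)
    note rm = reduction_map_eq[OF this]
    have "x - Proj \<Gamma> x \<in> annihilator J V L"
      unfolding annihilator_def symp_def
    proof (intro CollectI conjI ballI rm(2))
      fix l assume l: "l \<in> L"
      have "cinner (J x) l = 0" using xL[OF l, of 0] Gam.csub by (simp add: cvec.subspace_0)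
      moreover have "cinner (J (Proj \<Gamma> x)) l = 0"
      proof -
        have "cinner (J l) (Proj \<Gamma> x) = 0" using l L_V Gam.Proj_in by (auto simp: V_iff)
        then show ?thesis unfolding cJ[of "Proj \<Gamma> x"] using cinner_sym_0[of "Proj \<Gamma> x" "J l"] by simp
      qed
      ultimately show "cinner (J (x - Proj \<Gamma> x)) l = 0" by (simp add: blinfun.diff_right cinner_diff_left)
    qed
    then have "x - Proj \<Gamma> x \<in> L" using L by (simp add: lagrangian_def)
    then show "x \<in> L'" unfolding preimage_iff using Gam.Proj_in by (metis diff_add_cancel)
  qed
qed

sublocale L': closed_csubspace L' by (rule lagrangian_closed[OF UNIV_closed _ L'_lagrangian]) simp

lemma Proj_L': "Proj L' = Proj L + Proj \<Gamma>"
proof (rule blinfun_eqI)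
  fix x
  have o: "cinner l g = 0" "cinner g l = 0" if "l \<in> L" "g \<in> \<Gamma>" for l g
    using that L_V cinner_sym_0[of g l] by (auto simp: V_iff)
  have "Proj L' x = Proj L x + Proj \<Gamma> x"
  proof (rule L'.Proj_unique)
    show "Proj L x + Proj \<Gamma> x \<in> L'" unfolding preimage_iff using L.Proj_in Gam.Proj_in by blast
    have "cinner (x - (Proj L x + Proj \<Gamma> x)) (l + g) = 0" if "l \<in> L" "g \<in> \<Gamma>" for l g
    proof -
      have "cinner (x - Proj L x) l = 0" "cinner (x - Proj \<Gamma> x) g = 0"
        using L.Proj_orth Gam.Proj_orth that by (auto simp: orth_comp_def)
      then show ?thesis
        using o[OF that(1) Gam.Proj_in, of x] o[OF L.Proj_in that(2), of x]
        by (simp add: cinner_simps)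
    qed
    then show "x - (Proj L x + Proj \<Gamma> x) \<in> orth_comp L'"
      unfolding orth_comp_def by (intro CollectI ballI) (metis preimage_iff)
  qed
  then show "Proj L' x = (Proj L + Proj \<Gamma>) x" by (simp add: plus_blinfun.rep_eq)
qed

text \<open>The unitary of the pair $(L', M)$ on $\hat H^+$, extended by the identity.\<close>

definition F :: "'a \<Rightarrow>\<^sub>L 'a" where
  "F = id_blinfun - pos - (reflection M o\<^sub>L reflection L' o\<^sub>L pos)"

lemma F_apply: "F x = (x - pos x) - reflection M (reflection L' (pos x))"
  by (simp add: F_def minus_blinfun.rep_eq)

lemmas refl_M = refl_lagrangian[OF UNIV_closed _ M(1), OF UNIV_I UNIV_I]
lemmas refl_L' = refl_lagrangian[OF UNIV_closed _ L'_lagrangian, OF UNIV_I UNIV_I]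

lemma F_pos: "J x = \<i> *\<^sub>C x \<Longrightarrow> F x = - reflection M (reflection L' x)"
  by (simp add: F_apply pos_id)

lemma F_fix: "pos x = 0 \<Longrightarrow> F x = x"
  by (simp add: F_apply)

lemma J_FF: "J x = \<i> *\<^sub>C x \<Longrightarrow> J (reflection M (reflection L' x)) = \<i> *\<^sub>C reflection M (reflection L' x)"
  using refl_M(2)[OF refl_L'(2)] by simp

lemma J_F: "J x = \<i> *\<^sub>C x \<Longrightarrow> J (F x) = \<i> *\<^sub>C F x"
  using J_FF by (simp add: F_pos blinfun.minus_right cvec.scale_minus_right)

lemma norm_pos_split:
  assumes "J x = \<i> *\<^sub>C x" "J y = (- \<i>) *\<^sub>C y"
  shows "(norm (x + y))\<^sup>2 = (norm x)\<^sup>2 + (norm y)\<^sup>2" "x \<bullet> y = 0"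
proof -
  show "x \<bullet> y = 0" using pos_neg_orth[OF assms] Re_cinner[of x y] by simp
  then show "(norm (x + y))\<^sup>2 = (norm x)\<^sup>2 + (norm y)\<^sup>2" by (rule norm_add_orthogonal)
qed

lemma norm_F: "norm (F x) = norm x"
proof -
  have n: "norm (F (pos x)) = norm (pos x)"
    by (simp add: F_pos J_pos M.norm_refl L'.norm_refl)
  have "F x = F (pos x) + (x - pos x)" by (simp add: F_apply pos_id J_pos)
  then have "(norm (F x))\<^sup>2 = (norm (pos x))\<^sup>2 + (norm (x - pos x))\<^sup>2"
    using norm_pos_split(1)[OF J_F[OF J_pos] J_minus_pos, of x x] n by simp
  also have "\<dots> = (norm x)\<^sup>2"
    using norm_pos_split(1)[OF J_pos J_minus_pos, of x x] by simp
  finally show ?thesis by simp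
qed

lemma surj_F: "surj (blinfun_apply F)"
proof (rule surjI)
  fix x
  define a where "a = - reflection L' (reflection M (pos x))"
  have Ja: "J a = \<i> *\<^sub>C a"
    using refl_L'(2)[OF refl_M(2)[OF J_pos, of x]] by (simp add: a_def blinfun.minus_right cvec.scale_minus_right)
  have p: "pos (a + (x - pos x)) = a"
    by (simp only: blinfun.add_right pos_id[OF Ja] pos_zero[OF J_minus_pos] add_0_right)
  have r: "reflection M (reflection L' a) = - pos x"
    by (simp add: a_def blinfun.minus_right M.refl_refl L'.refl_refl)
  show "F (- reflection L' (reflection M (pos x)) + (x - pos x)) = x"
    unfolding F_apply a_def[symmetric] p r by simp
qed

lemma clin_pos: "clin pos"
  using Pos.clin_Proj by (simp add: Proj_pos)

lemma clin_F: "clin F"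
  unfolding F_def by (intro clin_intros clin_pos M.clin_refl L'.clin_refl)

text \<open>A positive angle between \<open>\<Gamma>\<close> and \<open>M\<close>. Projecting
  \<open>\<Gamma>\<close> off \<open>M\<close> has image the part of \<open>M + \<Gamma>\<close>
  orthogonal to \<open>M\<close>, which is closed, and kernel the trivial intersection; the closed
  range bound applies.\<close>

lemma transversal_bound: "\<exists>c>0. \<forall>g\<in>\<Gamma>. c * norm g \<le> norm (g - Proj M g)"
proof -
  define A where "A = id_blinfun - Proj M"
  have A: "A x = x - Proj M x" for x by (simp add: A_def minus_blinfun.rep_eq)
  have "blinfun_apply A ` \<Gamma> = (M + \<Gamma>) \<inter> orth_comp M"
  proof (intro equalityI subsetI)
    fix y assume "y \<in> blinfun_apply A ` \<Gamma>"
    then obtain g where g: "g \<in> \<Gamma>" "y = - Proj M g + g" by (auto simp: A)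
    moreover have "- Proj M g \<in> M" using M.Proj_in M.csub by (simp add: cvec.subspace_neg)
    moreover have "y \<in> orth_comp M" using M.Proj_orth[of g] g by simp
    ultimately show "y \<in> (M + \<Gamma>) \<inter> orth_comp M" by (metis IntI set_plus_intro)
  next
    fix y assume "y \<in> (M + \<Gamma>) \<inter> orth_comp M"
    then obtain m g where mg: "m \<in> M" "g \<in> \<Gamma>" "y = m + g" "y \<in> orth_comp M" by (auto elim: set_plus_elim)
    then have "Proj M y = 0" by (intro M.Proj_zero)
    then have "A g = y" using mg by (simp add: A blinfun.add_right M.Proj_id eq_neg_iff_add_eq_0 add.commute)
      (metis add_eq_0_iff diff_minus_eq_add add.commute)
    then show "y \<in> blinfun_apply A ` \<Gamma>" using mg by blast
  qed
  moreover have "closed (M + \<Gamma>)" using M(2) by (simp add: transversal_to_def)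
  ultimately have "closed (blinfun_apply A ` \<Gamma>)" using closed_Int[OF _ closed_orth_comp] by metis
  from closed_range_bounded_below[OF Gam.sub Gam.closed this]
  obtain c where c: "c > 0" "\<And>v. v \<in> \<Gamma> \<Longrightarrow> (\<And>z. z \<in> \<Gamma> \<Longrightarrow> A z = 0 \<Longrightarrow> v \<bullet> z = 0) \<Longrightarrow> c * norm v \<le> norm (A v)"
    by blast
  have "z = 0" if "z \<in> \<Gamma>" "A z = 0" for z
  proof -
    have "Proj M z = z" using that by (simp add: A)
    then have "z \<in> M \<inter> \<Gamma>" using that M.Proj_iff by simp
    then show ?thesis using M(2) unfolding transversal_to_def by blast
  qed
  then have "c * norm g \<le> norm (g - Proj M g)" if "g \<in> \<Gamma>" for g
    using c(2)[OF that] by (simp add: A) (metis inner_zero_right)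
  then show ?thesis using c(1) by blast
qed

text \<open>This is where transversality becomes coercivity. For positive \<open>b\<close>
  orthogonal to \<open>W\<close>, the vector \<open>g = b + reflection L' b\<close> falls into
  \<open>\<Gamma>\<close>, so its distance from \<open>M\<close> is bounded below, and this distance
  is controlled by \<open>F b + b\<close>.\<close>

lemma schur_unitary: "\<exists>d. schur_unitary W F d"
proof -
  obtain c where c: "c > 0" "\<And>g. g \<in> \<Gamma> \<Longrightarrow> c * norm g \<le> norm (g - Proj M g)"
    using transversal_bound by blast
  \<comment> \<open>The bound 2 is for the negative eigenspace, where \<open>F\<close> is 1; c^2 / 2
    comes from the squared norm of \<open>F b + b\<close> being twice its pairing with
    \<open>b\<close>.\<close>
  define d where "d = min (c\<^sup>2 / 2) 2"
  have "d * (norm a)\<^sup>2 \<le> (F a + a) \<bullet> a" if a: "a \<in> orth_comp W" for a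
  proof -
    define b e where "b = pos a" and "e = a - pos a"
    have Jb: "J b = \<i> *\<^sub>C b" and Je: "J e = (- \<i>) *\<^sub>C e" unfolding b_def e_def by (rule J_pos J_minus_pos)+
    have ab: "a = b + e" by (simp add: b_def e_def)
    have bW: "cinner b w = 0" if "w \<in> W" for w
    proof -
      have "cinner a w = 0" using a that by (simp add: orth_comp_def)
      moreover have "cinner e w = 0" using pos_neg_orth[OF _ Je, of w] that cinner_sym_0[of e w] by (simp add: pos_part_def)
      ultimately show ?thesis by (simp add: ab cinner_add_left)
    qed
    have "Proj V b \<in> W"
      using V.Proj_in J_Proj_V[of b] by (simp add: pos_part_def Jb clin_scaleC[OF V.clin_Proj])
    then have "b \<bullet> Proj V b = 0" using bW Re_cinner[of b] by (metis zero_complex.sel(1))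
    then have "Proj V b = 0" using V.Proj_self[of b "Proj V b"] by simp
    then have "b \<in> orth_comp V" using V.Proj_orth[of b] by simp
    then have "b \<in> orth_comp L" using L_V by (auto simp: orth_comp_def)
    then have "Proj L b = 0" by (rule L.Proj_zero)
    then have g: "b + reflection L' b = 2 *\<^sub>R Proj \<Gamma> b" by (simp add: reflection_apply Proj_L' plus_blinfun.rep_eq)
    define g where "g = b + reflection L' b"
    have gG: "g \<in> \<Gamma>" unfolding g_def g using Gam.Proj_in Gam.sub by (simp add: subspace_scale)
    define h where "h = F b + b"
    \<comment> \<open>Since \<open>reflection M\<close> maps \<open>reflection L' b\<close> to
      \<open>- F b\<close> and back, \<open>g\<close> and \<open>h\<close> have the same part off
      \<open>M\<close>.\<close>
    have "2 *\<^sub>R (g - Proj M g) = g - reflection M g" by (simp add: reflection_apply scaleR_2 algebra_simps)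
    also have "\<dots> = h - reflection M h"
      by (simp add: g_def h_def F_pos[OF Jb] blinfun_rep M.refl_refl)
    finally have "2 * norm (g - Proj M g) \<le> 2 * norm h"
      using norm_triangle_ineq4[of h "reflection M h"] M.norm_refl[of h] by (metis abs_numeral mult_2 norm_scaleR)
    then have 1: "c * norm g \<le> norm h" using c(2)[OF gG] by simp
    have "(norm b)\<^sup>2 \<le> (norm g)\<^sup>2"
      unfolding g_def using norm_pos_split(1)[OF Jb, of "reflection L' b"] refl_L'(2)[OF Jb] by simp
    then have "norm b \<le> norm g" by (rule power2_le_imp_le) simp
    then have "c * norm b \<le> norm h" using 1 c(1) mult_left_mono[of "norm b" "norm g" c] by linarith
    then have "(c * norm b)\<^sup>2 \<le> (norm h)\<^sup>2" using c(1) by (intro power_mono) auto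
    moreover have "(norm h)\<^sup>2 = 2 * (h \<bullet> b)"
    proof -
      have "F b \<bullet> F b = b \<bullet> b" using norm_F[of b] by (simp add: norm_eq_sqrt_inner)
      then show ?thesis
        by (simp add: h_def power2_norm_eq_inner inner_add_left inner_add_right inner_commute)
    qed
    ultimately have 2: "(c\<^sup>2 / 2) * (norm b)\<^sup>2 \<le> h \<bullet> b" by (simp add: power_mult_distrib)
    have he: "h \<bullet> e = 0"
      by (rule norm_pos_split(2)[OF _ Je]) (simp add: h_def blinfun.add_right J_F Jb scaleC_add_right)
    have be: "b \<bullet> e = 0" by (rule norm_pos_split(2)[OF Jb Je])
    have "F a + a = h + 2 *\<^sub>R e"
      using F_fix[OF pos_zero[OF Je]] by (simp add: h_def ab blinfun.add_right scaleR_2)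
    then have "(F a + a) \<bullet> a = h \<bullet> b + 2 * (norm e)\<^sup>2"
      using he be by (simp add: ab inner_add_left inner_add_right power2_norm_eq_inner inner_commute)
    moreover have "(norm a)\<^sup>2 = (norm b)\<^sup>2 + (norm e)\<^sup>2" unfolding ab by (rule norm_pos_split(1)[OF Jb Je])
    moreover have "d * (norm b)\<^sup>2 \<le> (c\<^sup>2 / 2) * (norm b)\<^sup>2" "d * (norm e)\<^sup>2 \<le> 2 * (norm e)\<^sup>2"
      unfolding d_def by (intro mult_right_mono; simp)+
    ultimately show ?thesis using 2 by (simp add: distrib_left)
  qed
  moreover have "0 < d" using c(1) by (simp add: d_def)
  ultimately have "schur_unitary W F d"
    by unfold_locales (use clin_F norm_F surj_F in auto)
  then show ?thesis by blast
qed

text \<open>The coercivity constant is a parameter of \<open>schur_unitary\<close>; fixing a choice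
  allows it to be used as a sublocale.\<close>

definition d where "d = (SOME d. schur_unitary W F d)"

sublocale S: schur_unitary W F d
  unfolding d_def using someI_ex[OF schur_unitary] .

lemma W_D: "w \<in> W \<Longrightarrow> J w = \<i> *\<^sub>C w" "w \<in> W \<Longrightarrow> w \<in> V"
  by (simp_all add: pos_part_def)

lemma refl_L'_V:
  assumes "w \<in> V"
  shows "reflection L' w = reflection L w"
proof -
  have "Proj \<Gamma> w = 0"
    by (rule Gam.Proj_zero) (use assms in \<open>simp add: V_iff orth_comp_def\<close>)
  then show ?thesis by (simp add: reflection_apply Proj_L' plus_blinfun.rep_eq)
qed

lemma refl_L: "w \<in> W \<Longrightarrow> reflection L' w \<in> neg_part J V"
  using graph_unitary_refl(2)[OF V_closed J_V L] refl_L'_V W_D by metis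

lemma add_refl_L: "w \<in> W \<Longrightarrow> w + reflection L' w \<in> L"
  using add_refl_in[OF V_closed J_V L, of w] refl_L'_V W_D by metis

section \<open>The reduced pair has the Schur complement as its unitary\<close>

lemma G_W: "S.G w \<in> W"
  using S.PG W.Proj_iff by metis

text \<open>With \<open>b = - YY w\<close>, the equation \<open>F (w + b) = G w - b\<close> says
  that \<open>m = reflection L' (w + b) + (b - G w)\<close> is fixed by the reflection in
  \<open>M\<close>. Since \<open>b + reflection L' b\<close> lies in \<open>\<Gamma>\<close>, the
  vector \<open>m\<close> reduces to the asserted one.\<close>

lemma graph_N:
  assumes w: "w \<in> W"
  shows "reflection L' w - S.G w \<in> N"
proof -
  define b where "b = - S.YY w"
  have Pw: "Proj W w = w" using w by (rule W.Proj_id)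
  have Fb: "F (w + b) = S.G w - b" using S.F_Y[OF Pw] by (simp add: b_def)
  \<comment> \<open>First, \<open>b\<close> lies in the positive eigenspace: \<open>F\<close> fixes
    its negative part \<open>b1\<close>, while the equation for \<open>F (w + b)\<close> reverses
    it.\<close>
  define b1 where "b1 = b - pos b"
  have "w + b = (w + pos b) + b1" by (simp add: b1_def)
  then have "F (w + b) = F ((w + pos b) + b1)" by (rule arg_cong)
  then have "F (w + b) = F (w + pos b) + b1"
    using F_fix[OF pos_zero[OF J_minus_pos, of b]] unfolding b1_def[symmetric] by (simp only: blinfun.add_right)
  then have eq: "F (w + pos b) + b1 = (S.G w - pos b) - b1" using Fb by (simp add: b1_def)
  have p0: "pos b1 = 0" unfolding b1_def by (rule pos_zero[OF J_minus_pos])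
  have Jwb: "J (w + pos b) = \<i> *\<^sub>C (w + pos b)"
    using W_D(1)[OF w] J_pos[of b] by (simp add: blinfun.add_right scaleC_add_right)
  have "F (w + pos b) = S.G w - pos b"
  proof -
    have "pos (F (w + pos b) + b1) = F (w + pos b)"
      using pos_id[OF J_F[OF Jwb]] p0 by (simp add: blinfun.add_right)
    moreover have "pos ((S.G w - pos b) - b1) = S.G w - pos b"
      using pos_id[OF W_D(1)[OF G_W]] pos_id[OF J_pos] p0 by (simp add: blinfun.diff_right)
    ultimately show ?thesis using eq by simp
  qed
  then have "2 *\<^sub>R b1 = 0" using eq by (simp add: scaleR_2 algebra_simps)
  then have b: "pos b = b" by (simp add: b1_def)
  then have Jb: "J b = \<i> *\<^sub>C b" using J_pos by metis
  have "reflection M (reflection L' (w + b)) = b - S.G w"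
    using Fb F_pos[of "w + b"] Jwb b by (metis minus_diff_eq minus_equation_iff)
  then have M1: "reflection M (b - S.G w) = reflection L' (w + b)" using M.refl_refl by metis
  \<comment> \<open>The reflection in \<open>M\<close> interchanges the two summands.\<close>
  define m where "m = reflection L' (w + b) + (b - S.G w)"
  have "reflection M m = m"
    using M1 \<open>reflection M (reflection L' (w + b)) = b - S.G w\<close> by (simp add: m_def blinfun.add_right[of "reflection M"] add.commute)
  then have mM: "m \<in> M" using M.refl_iff by simp
  define v where "v = reflection L' w - S.G w"
  have vV: "v \<in> V"
    unfolding v_def using refl_L[OF w] G_W W_D(2) V.csub by (intro cvec.subspace_diff) (auto simp: neg_part_def)
  have "b \<in> orth_comp W"
    using S.PY[of w] W.Proj_orth[of b] by (simp add: b_def blinfun.minus_right)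
  then have "Proj V b \<in> orth_comp W"
    using V.Proj_orth[of b] W_D(2) unfolding orth_comp_def by (auto simp: cinner_diff_left) 
  moreover have "Proj V b \<in> W"
    using V.Proj_in J_Proj_V[of b] by (simp add: pos_part_def Jb clin_scaleC[OF V.clin_Proj])
  ultimately have "Proj V b \<bullet> Proj V b = 0" by (rule orth_comp_inner)
  then have "b \<in> orth_comp L" using V.Proj_orth[of b] L_V by (auto simp: orth_comp_def)
  then have "Proj L b = 0" by (rule L.Proj_zero)
  then have "reflection L' b + b = 2 *\<^sub>R Proj \<Gamma> b" by (simp add: reflection_apply Proj_L' plus_blinfun.rep_eq)
  then have "m - v \<in> \<Gamma>"
    using Gam.Proj_in[of b] Gam.sub by (simp add: m_def v_def blinfun.add_right subspace_scale algebra_simps)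
  moreover have "m \<in> annihilator J UNIV \<Gamma>"
  proof -
    have "v \<in> annihilator J UNIV \<Gamma>" using vV by (simp add: reduced_space_def)
    moreover have "m - v \<in> annihilator J UNIV \<Gamma>" using \<open>m - v \<in> \<Gamma>\<close> Gam_annih by blast
    ultimately have "v + (m - v) \<in> annihilator J UNIV \<Gamma>"
      using closed_csubspace_annihilator[of \<Gamma>] unfolding closed_csubspace_def by (blast intro: cvec.subspace_add)
    then show ?thesis by simp
  qed
  ultimately show ?thesis
    unfolding v_def[symmetric] reduction_image_def using mM reduction_map_eqI[OF vV] by (metis IntI imageI)
qed

lemma N_iff: "n \<in> N \<longleftrightarrow> (\<exists>m\<in>M. m \<in> annihilator J UNIV \<Gamma> \<and> n = m - Proj \<Gamma> m)"
  unfolding reduction_image_def using reduction_map_eq(1) by auto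

lemma N_sub: "cvec.subspace N"
proof -
  have A: "cvec.subspace (annihilator J UNIV \<Gamma>)"
    using closed_csubspace_annihilator[of \<Gamma>] by (simp add: closed_csubspace_def)
  have "N = blinfun_apply (id_blinfun - Proj \<Gamma>) ` (M \<inter> annihilator J UNIV \<Gamma>)"
    using N_iff by (auto simp: minus_blinfun.rep_eq)
  then show ?thesis
    using A M.csub by (auto intro!: clin_image_subspace clin_intros Gam.clin_Proj cvec.subspace_inter)
qed

lemma N_V: "N \<subseteq> V"
  using N_iff reduction_map_eq(2) by auto

lemma N_iso: "a \<in> N \<Longrightarrow> b \<in> N \<Longrightarrow> symp J a b = 0"
proof -
  assume "a \<in> N" "b \<in> N"
  then obtain m n where m: "m \<in> M" "m \<in> annihilator J UNIV \<Gamma>" "a = m - Proj \<Gamma> m"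
    and n: "n \<in> M" "n \<in> annihilator J UNIV \<Gamma>" "b = n - Proj \<Gamma> n"
    unfolding N_iff by blast
  have "cinner (J m) n = 0"
    using lagrangian_isotropic[OF UNIV_closed _ M(1) m(1) n(1)] by (simp add: symp_def)
  moreover have "cinner (J m) (Proj \<Gamma> n) = 0" using m(2) Gam.Proj_in by (simp add: annih_iff)
  moreover have "cinner (J (Proj \<Gamma> m)) n = 0"
  proof -
    have "cinner (J n) (Proj \<Gamma> m) = 0" using n(2) Gam.Proj_in by (simp add: annih_iff)
    then show ?thesis unfolding cJ[of "Proj \<Gamma> m"] using cinner_sym_0[of "Proj \<Gamma> m" "J n"] by simp
  qed
  moreover have "cinner (J (Proj \<Gamma> m)) (Proj \<Gamma> n) = 0" using Gam_iso Gam.Proj_in by blast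
  ultimately show ?thesis
    by (simp add: symp_def m(3) n(3) blinfun.diff_right cinner_simps)
qed

lemma graph_unitary_N:
  assumes "w \<in> W"
  shows "graph_unitary J V N (- S.G w) = reflection L' w"
  by (rule graph_unitary_eqI[OF N_sub N_iso refl_L[OF assms]])
     (use graph_N[OF assms] in \<open>simp_all add: algebra_simps\<close>)

lemma neg_G_surj:
  assumes "y \<in> W"
  shows "\<exists>w\<in>W. y = - S.G w"
  using S.G_surj[of "- y"] assms W.csub by (metis cvec.subspace_neg minus_minus)

text \<open>The graph unitary of \<open>N\<close> is known from \<open>graph_unitary_N\<close> on
  vectors \<open>- G w\<close>; by \<open>neg_G_surj\<close> these exhaust \<open>W\<close>, which
  also yields the injectivity needed for \<open>inv_into\<close>.\<close>

lemma pair_unitary_V: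
  assumes w: "w \<in> W"
  shows "- inv_into W (graph_unitary J V N) (graph_unitary J V L w) = S.G w"
proof -
  have gL: "graph_unitary J V L w = reflection L' w"
    using graph_unitary_refl(1)[OF V_closed J_V L w] refl_L'_V W_D(2)[OF w] by simp
  have "inj_on (graph_unitary J V N) W"
  proof (rule inj_onI)
    fix x y assume "x \<in> W" "y \<in> W" "graph_unitary J V N x = graph_unitary J V N y"
    moreover obtain x' y' where "x' \<in> W" "x = - S.G x'" "y' \<in> W" "y = - S.G y'"
      using neg_G_surj calculation by metis
    ultimately have "reflection L' x' = reflection L' y'" using graph_unitary_N by simp
    then have "x' = y'" using L'.refl_refl by metis
    then show "x = y" using \<open>x = _\<close> \<open>y = _\<close> by simp
  qed
  moreover have "- S.G w \<in> W" using G_W W.csub by (simp add: cvec.subspace_neg)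
  ultimately have "inv_into W (graph_unitary J V N) (reflection L' w) = - S.G w"
    using inv_into_f_f graph_unitary_N[OF w] by metis
  then show ?thesis unfolding gL by simp
qed

lemma pair_unitary_UNIV:
  assumes a: "a \<in> pos_part J UNIV"
  shows "- inv_into (pos_part J UNIV) (graph_unitary J UNIV M) (graph_unitary J UNIV L' a) = F a"
proof -
  note g = graph_unitary_refl[OF UNIV_closed _ L'_lagrangian a, OF UNIV_I]
  show ?thesis
    unfolding g(1) graph_unitary_inv[OF UNIV_closed _ M(1) g(2), OF UNIV_I]
    using a by (simp add: F_pos pos_part_def)
qed

lemma pos_in_W: "x \<in> V \<Longrightarrow> pos x \<in> W"
  using pos_in[OF V.csub J_V] by (simp add: pos_part_def J_pos)

lemma minus_pos_in: "x \<in> V \<Longrightarrow> x - pos x \<in> neg_part J V"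
  using pos_in[OF V.csub J_V] V.csub J_minus_pos by (simp add: neg_part_def cvec.subspace_diff)

lemma L_graph: "l \<in> L \<Longrightarrow> l = pos l + reflection L' (pos l)"
proof -
  assume l: "l \<in> L"
  then have lV: "l \<in> V" using L_V by blast
  have "graph_unitary J V L (pos l) = l - pos l"
    by (rule graph_unitary_eqI[OF L.csub lagrangian_isotropic[OF V_closed J_V L] minus_pos_in[OF lV]])
       (simp_all add: l)
  moreover have "graph_unitary J V L (pos l) = reflection L' (pos l)"
    using graph_unitary_refl(1)[OF V_closed J_V L pos_in_W[OF lV]] refl_L'_V W_D(2) pos_in_W[OF lV] by simp
  ultimately show ?thesis by (metis add.commute diff_add_cancel)
qed

lemma N_graph: "n \<in> N \<Longrightarrow> \<exists>w\<in>W. n = reflection L' w - S.G w"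
proof -
  assume n: "n \<in> N"
  then have nV: "n \<in> V" using N_V by blast
  obtain w where w: "w \<in> W" "pos n = - S.G w" using neg_G_surj[OF pos_in_W[OF nV]] by blast
  have "graph_unitary J V N (pos n) = n - pos n"
    by (rule graph_unitary_eqI[OF N_sub N_iso minus_pos_in[OF nV]]) (simp_all add: n)
  then have "n - pos n = reflection L' w" using graph_unitary_N[OF w(1)] w(2) by simp
  then show ?thesis using w by (intro bexI[of _ w]) (simp_all add: algebra_simps)
qed

text \<open>The two halves of the Fredholm condition on the pair become the two ingredients of the
  bound: closedness of \<open>L + N\<close> gives closed range of \<open>G + 1\<close> on
  \<open>W\<close>, and the kernel there is the positive part of vectors in the finite-dimensional
  \<open>L \<inter> N\<close>.\<close>

lemma fredholm_bound:
  "\<exists>B e. finite B \<and> 0 < e \<and> (\<forall>v\<in>W. v \<in> orth_comp B \<longrightarrow> e * norm v \<le> norm (S.G v + v))"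
proof -
  define A where "A = S.G + id_blinfun"
  have A: "A x = S.G x + x" for x by (simp add: A_def plus_blinfun.rep_eq)
  \<comment> \<open>Forwards, the negative parts of \<open>w + reflection L' w\<close> and
    \<open>G w - reflection L' w\<close> cancel. Backwards, they must cancel because the sum is
    positive, which forces the two parameters to be opposite.\<close>
  have "blinfun_apply A ` W = (L + N) \<inter> pos_part J UNIV"
  proof (intro equalityI subsetI)
    fix y assume "y \<in> blinfun_apply A ` W"
    then obtain w where w: "w \<in> W" "y = S.G w + w" by (auto simp: A)
    have "S.G w - reflection L' w \<in> N"
      using graph_N[OF w(1)] N_sub cvec.subspace_neg by (metis minus_diff_eq)
    then have "(w + reflection L' w) + (S.G w - reflection L' w) \<in> L + N"
      using add_refl_L[OF w(1)] by (rule set_plus_intro[rotated])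
    moreover have "y \<in> W" using w G_W W.csub by (simp add: cvec.subspace_add)
    ultimately show "y \<in> (L + N) \<inter> pos_part J UNIV" using w(2) by (simp add: pos_part_def add.commute)
  next
    fix y assume "y \<in> (L + N) \<inter> pos_part J UNIV"
    then obtain l n where y: "l \<in> L" "n \<in> N" "y = l + n" "J y = \<i> *\<^sub>C y"
      by (auto elim: set_plus_elim simp: pos_part_def)
    define a where "a = pos l"
    have a: "a \<in> W" using pos_in_W L_V y(1) by (auto simp: a_def)
    obtain w where w: "w \<in> W" "n = reflection L' w - S.G w" using N_graph[OF y(2)] by blast
    have l: "l = a + reflection L' a" using L_graph[OF y(1)] by (simp add: a_def)
    have z: "pos (reflection L' x) = 0" if "x \<in> W" for x
      by (rule pos_zero) (use refl_L[OF that] in \<open>simp add: neg_part_def\<close>)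
    have "y = pos y" using pos_id[OF y(4)] by simp
    also have "\<dots> = a - S.G w"
      unfolding y(3) l w(2)
      by (simp add: blinfun_rep z a w(1) pos_id[OF W_D(1)[OF a]] pos_id[OF W_D(1)[OF G_W]])
    finally have ya: "y = a - S.G w" .
    then have "reflection L' (a + w) = 0" using y(3) l w(2) by (simp add: blinfun.add_right algebra_simps)
    then have "a + w = 0" using L'.norm_refl[of "a + w"] by simp
    then have "y = A a" using ya by (simp add: A eq_neg_iff_add_eq_0[symmetric] blinfun.minus_right)
    then show "y \<in> blinfun_apply A ` W" using a by blast
  qed
  moreover have "closed (L + N)" using LM by (simp add: fredholm_pair_def)
  ultimately have "closed (blinfun_apply A ` W)" using Pos.closed by (simp add: closed_Int)
  from closed_range_bounded_below[OF W.sub W.closed this]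
  obtain c where c: "c > 0" "\<And>v. v \<in> W \<Longrightarrow> (\<And>z. z \<in> W \<Longrightarrow> A z = 0 \<Longrightarrow> v \<bullet> z = 0) \<Longrightarrow> c * norm v \<le> norm (A v)"
    by blast
  obtain B where B: "finite B" "L \<inter> N \<subseteq> cvec.span B"
    using LM by (auto simp: fredholm_pair_def finite_dim_def)
  have "c * norm v \<le> norm (S.G v + v)" if v: "v \<in> W" "v \<in> orth_comp (blinfun_apply pos ` B)" for v
    unfolding A[symmetric]
  proof (rule c(2)[OF v(1)])
    fix z assume z: "z \<in> W" "A z = 0"
    have "z = - S.G z" using z(2) by (simp add: A eq_neg_iff_add_eq_0 add.commute)
    then have "z + reflection L' z \<in> N" using graph_N[OF z(1)] by (metis add.commute diff_conv_add_uminus)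
    then have "z + reflection L' z \<in> cvec.span B" using B(2) add_refl_L[OF z(1)] by blast
    then have "pos (z + reflection L' z) \<in> cvec.span (blinfun_apply pos ` B)"
      unfolding clin_image_span[OF clin_pos, symmetric] by blast
    moreover have "pos (z + reflection L' z) = z"
      using pos_id[OF W_D(1)[OF z(1)]] pos_zero[of "reflection L' z"] refl_L[OF z(1)]
      by (simp add: blinfun.add_right neg_part_def)
    ultimately show "v \<bullet> z = 0" using v(2) orth_comp_inner unfolding orth_comp_span[symmetric, of "blinfun_apply pos ` B"] by metis
  qed
  then show ?thesis using B(1) c(1) by blast
qed

lemma schur_F_UE: "schur F W t \<in> UE"
  using fredholm_bound S.schur_UE by metis

lemma schur_F_fixes: "a \<in> orth_comp (pos_part J UNIV) \<Longrightarrow> schur F W t a = a"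
proof (rule S.schur_fixes)
  assume a: "a \<in> orth_comp (pos_part J UNIV)"
  then show "F a = a" using Pos.Proj_zero by (simp add: F_fix Proj_pos)
  show "Proj W a = 0" by (rule W.Proj_zero) (use a in \<open>auto simp: orth_comp_def pos_part_def\<close>)
qed

end

section \<open>The index\<close>

definition emb :: "'a::sep_chilbert \<Rightarrow>\<^sub>L ('a \<times> 'h::sep_chilbert)" where
  "emb = Blinfun (\<lambda>a. (a, 0))"

lemma cinner_zero_left: "cinner 0 y = 0"
  by (simp add: cinner_eq_0_iff)

lemma emb_apply: "emb a = (a, 0)"
  unfolding emb_def
  by (simp add: bounded_linear_Blinfun_apply bounded_linear_Pair bounded_linear_ident bounded_linear_zero)

lemma clin_emb: "clin emb"
  by (simp add: clin_def emb_apply scaleC_prod_def)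

context
  fixes W :: "'a::sep_chilbert set" and T :: "('a \<times> 'h::sep_chilbert) \<Rightarrow>\<^sub>L 'k::sep_chilbert"
  assumes W: "closed_csubspace W" and clinT: "clin T"
    and isoT: "\<And>v w. v \<in> W \<times> UNIV \<Longrightarrow> w \<in> W \<times> UNIV \<Longrightarrow> cinner (T v) (T w) = cinner v w"
    and surjT: "T ` (W \<times> UNIV) = UNIV" and zeroT: "\<And>v. v \<in> orth_comp (W \<times> UNIV) \<Longrightarrow> T v = 0"
begin

lemma norm_trivialization: "v \<in> W \<times> UNIV \<Longrightarrow> norm (T v) = norm v"
  using isoT[of v v] unfolding cinner_self of_real_eq_iff by (simp add: power2_eq_iff_nonneg)

lemma part_isom_trivialization: "part_isom W (T o\<^sub>L emb)"
  unfolding part_isom_def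
proof (intro conjI ballI)
  show "closed_csubspace W" by (rule W)
  show "clin (T o\<^sub>L emb)" by (intro clin_intros clinT clin_emb)
  show "norm ((T o\<^sub>L emb) w) = norm w" if "w \<in> W" for w
    using norm_trivialization[of "(w, 0)"] that by (simp add: emb_apply)
  show "(T o\<^sub>L emb) w = 0" if "w \<in> orth_comp W" for w
    using zeroT[of "(w, 0)"] that by (auto simp: emb_apply orth_comp_def cinner_prod_def cinner_zero_left)
qed

text \<open>The auxiliary summand is where the stabilised operator is the identity, and
  \<open>conj_ext\<close> supplies the identity off the range of \<open>T\<close> on
  \<open>W\<close>. This removes \<open>'h\<close> and the inverse of \<open>T\<close> from all
  later arguments.\<close>

lemma stabilize_eq_conj_ext:
  assumes U: "\<And>w. w \<in> W \<Longrightarrow> blinfun_apply U w \<in> W" and f: "\<And>w. w \<in> W \<Longrightarrow> f w = blinfun_apply U w"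
  shows "stabilize T W f = conj_ext (T o\<^sub>L emb) U"
proof -
  interpret closed_csubspace W by (rule W)
  have csub2: "cvec.subspace (W \<times> (UNIV :: 'h set))"
    using csub by (auto simp: cvec.subspace_def scaleC_prod_def zero_prod_def)
  have inj: "inj_on (blinfun_apply T) (W \<times> UNIV)"
  proof (rule inj_onI)
    fix v w assume vw: "v \<in> W \<times> UNIV" "w \<in> W \<times> UNIV" "T v = T w"
    have "v - w \<in> W \<times> UNIV" using csub2 vw cvec.subspace_diff by blast
    then have "norm (v - w) = norm (T (v - w))" using norm_trivialization by simp
    then show "v = w" using vw(3) by (simp add: blinfun.diff_right)
  qed
  have "T (map_prod f id (inv_into (W \<times> UNIV) (blinfun_apply T) k)) = conj_ext (T o\<^sub>L emb) U k" for k
  proof -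
    have "k \<in> T ` (W \<times> UNIV)" using surjT by simp
    then obtain w h where wh: "w \<in> W" "k = T (w, h)" by auto
    have inv: "inv_into (W \<times> UNIV) (blinfun_apply T) k = (w, h)"
      unfolding wh(2) using inj wh(1) by (intro inv_into_f_f) auto
    \<comment> \<open>The adjoint reads off the \<open>W\<close> component of the preimage of
      \<open>k\<close>.\<close>
    have "adj (T o\<^sub>L emb) k = w"
    proof (rule inner_ext)
      fix a
      have split: "T (a, 0) = T (Proj W a, 0) + T (a - Proj W a, 0)"
        unfolding blinfun.add_right[symmetric] by simp
      have "(a - Proj W a, 0) \<in> orth_comp (W \<times> (UNIV :: 'h set))"
        using Proj_orth[of a] by (auto simp: orth_comp_def cinner_prod_def cinner_zero_left)
      then have "T (a, 0) = T (Proj W a, 0)" using split zeroT by simp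
      then have "a \<bullet> adj (T o\<^sub>L emb) k = Re (cinner (T (Proj W a, 0)) (T (w, h)))"
        by (simp add: adj_right[symmetric] emb_apply wh(2) Re_cinner)
      also have "\<dots> = Re (cinner (Proj W a, 0) (w, h))"
        using isoT[of "(Proj W a, 0)" "(w, h)"] wh(1) Proj_in by simp
      also have "\<dots> = Proj W a \<bullet> w" by (simp add: Re_cinner)
      also have "\<dots> = a \<bullet> w" using wh(1) by (simp add: Proj_self Proj_id)
      finally show "a \<bullet> adj (T o\<^sub>L emb) k = a \<bullet> w" .
    qed
    then have "conj_ext (T o\<^sub>L emb) U k = T (w, h) + T (U w - w, 0)"
      by (simp add: conj_ext_apply emb_apply wh(2))
    also have "\<dots> = T (U w, h)" unfolding blinfun.add_right[symmetric] by simp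
    finally show ?thesis using f[OF wh(1)] by (simp add: inv)
  qed
  then show ?thesis
    unfolding stabilize_def by (intro blinfun_eqI) (simp add: bounded_linear_Blinfun_apply blinfun.bounded_linear_right)
qed

end

text \<open>Existence of a trivialization gives the \<open>SOME\<close> in the index a witness,
  about which nothing further is known.\<close>

lemma K1_index_eq:
  fixes H' :: "'h::sep_chilbert itself" and W :: "'x \<Rightarrow> 'a::sep_chilbert set"
  assumes "\<exists>T :: 'x \<Rightarrow> ('a \<times> 'h) \<Rightarrow>\<^sub>L 'k::sep_chilbert. trivialization X W T"
  shows "\<exists>T :: 'x \<Rightarrow> ('a \<times> 'h) \<Rightarrow>\<^sub>L 'k. trivialization X W T \<and>
    K1_index H' X W f = homotopy_rel X `` {\<lambda>x. stabilize (T x) (W x) (f x)}"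
  unfolding K1_index_def by (rule someI_ex) (use assms in blast)

lemma UE_homotopic_imp_U_F:
  assumes "UE_homotopic X f g"
  shows "homotopic_with (\<lambda>_. True) X (top_of_set U_F) f g"
proof -
  obtain h where h: "continuous_map (cyl X) (top_of_set UE) h"
    "\<And>x. h (0, x) = f x" "\<And>x. h (1, x) = g x"
    using assms unfolding UE_homotopic_def homotopic_with_def by auto
  have "continuous_map (cyl X) (top_of_set U_F) h"
    using h(1) UE_subset_U_F by (auto simp: continuous_map_in_subtopology)
  then show ?thesis unfolding homotopic_with_def using h(2,3) by auto
qed

lemma UE_homotopic_K1:
  assumes "UE_homotopic X f g"
  shows "homotopy_rel X `` {f} = homotopy_rel X `` {g}" "homotopy_rel X `` {g} \<in> K1 X"
proof -
  note h = UE_homotopic_imp_U_F[OF assms]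
  show "homotopy_rel X `` {f} = homotopy_rel X `` {g}"
    using h homotopic_with_symD[OF h] unfolding homotopy_rel_def by (auto intro: homotopic_with_trans)
  show "homotopy_rel X `` {g} \<in> K1 X"
    unfolding K1_def using homotopic_with_imp_continuous_maps[OF h] by (intro quotientI) simp
qed

theorem theorem13p3:
  fixes J :: "'a::sep_chilbert \<Rightarrow>\<^sub>L 'a"
    and X :: "'x topology"
    and \<Gamma> M L :: "'x \<Rightarrow> 'a set"
    and H' :: "'h::sep_chilbert itself"
  assumes inf_dim: "\<not> finite_dim (UNIV :: 'a set)"
    and inf_dim_aux: "\<not> finite_dim (UNIV :: 'h set)" "\<not> finite_dim (UNIV :: 'k::sep_chilbert set)"
    and J: "unitary_op J" "skew_adjoint_op J"
    and cont: "continuous_family X \<Gamma>" "continuous_family X M" "continuous_family X L"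
    and \<Gamma>: "\<And>x. x \<in> topspace X \<Longrightarrow> isotropic J UNIV (\<Gamma> x)"
    and M: "\<And>x. x \<in> topspace X \<Longrightarrow> lagrangian J UNIV (M x) \<and> transversal_to J (\<Gamma> x) (M x)"
    and L: "\<And>x. x \<in> topspace X \<Longrightarrow> lagrangian J (reduced_space J (\<Gamma> x)) (L x)"
    and LM: "\<And>x. x \<in> topspace X \<Longrightarrow>
        fredholm_pair (reduced_space J (\<Gamma> x)) (L x) (reduction_image J (\<Gamma> x) (M x))"
  defines "ind_H \<equiv> lagr_index H' X J (\<lambda>_. UNIV) (\<lambda>x. reduction_preimage J (\<Gamma> x) (L x)) M
             :: ('x \<Rightarrow> 'k \<Rightarrow>\<^sub>L 'k) set"
    and "ind_V \<equiv> lagr_index H' X J (\<lambda>x. reduced_space J (\<Gamma> x)) L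
             (\<lambda>x. reduction_image J (\<Gamma> x) (M x)) :: ('x \<Rightarrow> 'k \<Rightarrow>\<^sub>L 'k) set"
  shows "ind_H = ind_V \<and> ind_V \<in> K1 X"
proof -
  interpret symp_space J by unfold_locales (rule J)+
  have red: "reduction J (\<Gamma> x) (M x) (L x)" if x: "x \<in> topspace X" for x
    using cont(1) \<Gamma>[OF x] M[OF x] L[OF x] LM[OF x] x
    by unfold_locales (auto simp: continuous_family_def closed_csubspace_def)
  define Wp where "Wp = pos_part J UNIV"
  define W where "W x = pos_part J (reduced_space J (\<Gamma> x))" for x
  define L' where "L' x = reduction_preimage J (\<Gamma> x) (L x)" for x
  define N where "N x = reduction_image J (\<Gamma> x) (M x)" for x
  define fH where "fH x \<xi> = - inv_into Wp (graph_unitary J UNIV (M x)) (graph_unitary J UNIV (L' x) \<xi>)" for x \<xi>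
  define fV where "fV x \<xi> = - inv_into (W x) (graph_unitary J (reduced_space J (\<Gamma> x)) (N x))
      (graph_unitary J (reduced_space J (\<Gamma> x)) (L x) \<xi>)" for x \<xi>
  \<comment> \<open>The unitary of the large pair, with the projection onto the preimage of
    \<open>L x\<close> replaced by the sum of those onto \<open>L x\<close> and
    \<open>\<Gamma> x\<close>; each projection that varies is then a given continuous one.\<close>
  define Fx where "Fx x = id_blinfun - pos - (reflection (M x) o\<^sub>L (2 *\<^sub>R (Proj (L x) + Proj (\<Gamma> x)) - id_blinfun) o\<^sub>L pos)" for x
  have F_eq: "reduction.F J (\<Gamma> x) (M x) (L x) = Fx x" if "x \<in> topspace X" for x
  proof -
    interpret reduction J "\<Gamma> x" "M x" "L x" by (rule red[OF that])
    show ?thesis unfolding F_def Fx_def reflection_def Proj_L' ..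
  qed
  have contP: "continuous_map X euclidean (\<lambda>x. Proj (\<Gamma> x))" "continuous_map X euclidean (\<lambda>x. Proj (M x))"
    "continuous_map X euclidean (\<lambda>x. Proj (L x))"
    using cont by (simp_all add: continuous_family_def)
  have contF: "continuous_map X euclidean Fx"
    unfolding Fx_def reflection_def by (intro cont_intros contP)
  have contPW: "continuous_map X euclidean (\<lambda>x. Proj (W x))"
  proof (rule continuous_map_eq)
    show "continuous_map X euclidean
        (\<lambda>x. pos o\<^sub>L (id_blinfun - Proj (\<Gamma> x) + (J o\<^sub>L Proj (\<Gamma> x) o\<^sub>L J)))"
      by (intro cont_intros contP)
    show "(pos o\<^sub>L (id_blinfun - Proj (\<Gamma> x) + (J o\<^sub>L Proj (\<Gamma> x) o\<^sub>L J))) = Proj (W x)" if "x \<in> topspace X" for x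
      unfolding W_def using reduction.Proj_W[OF red[OF that]] by simp
  qed
  have Wc: "closed_csubspace (W x)" if "x \<in> topspace X" for x
    unfolding W_def using closed_csubspace_pos_part[OF reduction.V_closed[OF red[OF that]]] .
  have Wpc: "closed_csubspace Wp" unfolding Wp_def by (rule pos_part_UNIV)
  have famW: "continuous_family X W"
    using Wc contPW by (simp add: continuous_family_def closed_csubspace_def)
  have famWp: "continuous_family X (\<lambda>_. Wp)"
    using Wpc by (simp add: continuous_family_def closed_csubspace_def)
  obtain TH :: "'x \<Rightarrow> ('a \<times> 'h) \<Rightarrow>\<^sub>L 'k" where TH: "trivialization X (\<lambda>_. Wp) TH"
    and indH: "ind_H = homotopy_rel X `` {\<lambda>x. stabilize (TH x) Wp (fH x)}"
    using K1_index_eq[OF exists_trivialization[OF inf_dim inf_dim_aux famWp], of H' fH]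
    unfolding ind_H_def lagr_index_def fH_def L'_def Wp_def by blast
  obtain TV :: "'x \<Rightarrow> ('a \<times> 'h) \<Rightarrow>\<^sub>L 'k" where TV: "trivialization X W TV"
    and indV: "ind_V = homotopy_rel X `` {\<lambda>x. stabilize (TV x) (W x) (fV x)}"
    using K1_index_eq[OF exists_trivialization[OF inf_dim inf_dim_aux famW], of H' fV]
    unfolding ind_V_def lagr_index_def fV_def N_def W_def by blast
  define sH where "sH x = TH x o\<^sub>L emb" for x
  define sV where "sV x = TV x o\<^sub>L emb" for x
  have csH: "continuous_map X euclidean sH" and csV: "continuous_map X euclidean sV"
    using TH TV unfolding sH_def sV_def trivialization_def by (auto intro: cont_intros)
  \<comment> \<open>Both sides are conjugates of members of this one path: at 1 it is the unitary of
    the large pair, at 0 the reduced unitary on \<open>W x\<close> plus the identity.\<close>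
  define S where "S t x = schur (Fx x) (W x) t" for t x
  have contS: "continuous_map (cyl X) euclidean (\<lambda>p. S (fst p) (snd p))"
    unfolding S_def
  proof (intro cont_schur cont_cyl_snd contF contPW cont_cyl_fst)
    fix p assume "p \<in> topspace (cyl X)"
    then have p: "snd p \<in> topspace X" by auto
    show "\<exists>d. schur_unitary (W (snd p)) (Fx (snd p)) d"
      using reduction.schur_unitary[OF red[OF p]] unfolding F_eq[OF p] W_def .
  qed
  have contS0: "continuous_map X euclidean (S 0)"
    unfolding S_def
  proof (intro cont_schur contF contPW cont_const)
    fix x assume p: "x \<in> topspace X"
    show "\<exists>d. schur_unitary (W x) (Fx x) d"
      using reduction.schur_unitary[OF red[OF p]] unfolding F_eq[OF p] W_def .
  qed
  have SUE: "S t x \<in> UE" if "x \<in> topspace X" for t x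
    using reduction.schur_F_UE[OF red[OF that], of t] by (simp add: S_def F_eq[OF that] W_def)
  have Sfix: "S t x a = a" if "x \<in> topspace X" "a \<in> orth_comp Wp" for t x a
    using reduction.schur_F_fixes[OF red[OF that(1)], of a t] that by (simp add: S_def F_eq W_def Wp_def)
  have isoH: "part_isom Wp (sH x)" if x: "x \<in> topspace X" for x
    unfolding sH_def by (rule part_isom_trivialization[OF Wpc])
      (use TH x in \<open>auto simp: trivialization_def linear_iff_clin\<close>)
  have isoV: "part_isom (W x) (sV x)" if x: "x \<in> topspace X" for x
    unfolding sV_def by (rule part_isom_trivialization[OF Wc[OF x]])
      (use TV x in \<open>auto simp: trivialization_def linear_iff_clin\<close>)
  have stabH: "stabilize (TH x) Wp (fH x) = conj_ext (sH x) (S 1 x)" if x: "x \<in> topspace X" for x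
  proof -
    interpret R: reduction J "\<Gamma> x" "M x" "L x" by (rule red[OF x])
    have S1: "S 1 x = R.F" unfolding S_def W_def F_eq[OF x, symmetric] by (rule R.S.schur_1)
    show ?thesis
      unfolding sH_def
    proof (rule stabilize_eq_conj_ext[OF Wpc])
      show "S 1 x w \<in> Wp" if "w \<in> Wp" for w
        using that R.J_F by (simp add: S1 Wp_def pos_part_def)
      show "fH x w = S 1 x w" if "w \<in> Wp" for w
        using R.pair_unitary_UNIV[of w] that by (simp add: fH_def Wp_def L'_def S1)
    qed (use TH x in \<open>auto simp: trivialization_def linear_iff_clin\<close>)
  qed
  have S0: "S 0 x w = schur_G (Fx x) (W x) w" "schur_G (Fx x) (W x) w \<in> W x"
    if x: "x \<in> topspace X" "w \<in> W x" for x w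
  proof -
    interpret R: reduction J "\<Gamma> x" "M x" "L x" by (rule red[OF x(1)])
    show "S 0 x w = schur_G (Fx x) (W x) w" "schur_G (Fx x) (W x) w \<in> W x"
      using R.S.schur_0[of w] R.W.Proj_id[of w] R.G_W[of w] x
      by (simp_all add: S_def W_def F_eq R.S.Q_apply)
  qed
  have S0fix: "S 0 x w = w" if x: "x \<in> topspace X" "w \<in> orth_comp (W x)" for x w
  proof -
    interpret R: reduction J "\<Gamma> x" "M x" "L x" by (rule red[OF x(1)])
    have "Proj (W x) w = 0" unfolding W_def by (rule R.W.Proj_zero) (use x in \<open>simp add: W_def\<close>)
    then show ?thesis
      using R.S.schur_0[of w] R.S.G_P[of w] by (simp add: S_def W_def F_eq x R.S.Q_apply)
  qed
  have stabV: "stabilize (TV x) (W x) (fV x) = conj_ext (sV x) (S 0 x)" if x: "x \<in> topspace X" for x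
    unfolding sV_def
  proof (rule stabilize_eq_conj_ext[OF Wc[OF x]])
    show "S 0 x w \<in> W x" if "w \<in> W x" for w using S0[OF x that] by simp
    show "fV x w = S 0 x w" if "w \<in> W x" for w
      using reduction.pair_unitary_V[OF red[OF x], of w] S0[OF x that] that
      by (simp add: fV_def W_def N_def F_eq x)
  qed (use TV x in \<open>auto simp: trivialization_def linear_iff_clin\<close>)
  have "UE_homotopic X (\<lambda>x. conj_ext (sH x) (S 0 x)) (\<lambda>x. stabilize (TH x) Wp (fH x))"
  proof (rule UE_homotopicI)
    show "continuous_map (cyl X) euclidean (\<lambda>p. conj_ext (sH (snd p)) (S (fst p) (snd p)))"
      by (intro cont_intros cont_cyl_snd csH contS)
    show "conj_ext (sH (snd (t, x))) (S (fst (t, x)) (snd (t, x))) \<in> UE"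
      if "t \<in> {0..1}" "x \<in> topspace X" for t x
      using conj_ext_UE[OF isoH SUE Sfix] that by simp
  qed (simp_all add: stabH)
  from UE_homotopic_sym[OF this]
  have "UE_homotopic X (\<lambda>x. stabilize (TH x) Wp (fH x)) (\<lambda>x. conj_ext (sH x) (S 0 x))" .
  \<comment> \<open>At parameter 0 the operator differs from 1 only inside \<open>W x\<close>, so
    cutting the initial space of \<open>sH x\<close> down to \<open>W x\<close> changes
    nothing.\<close>
  also have "UE_homotopic X (\<lambda>x. conj_ext (sH x) (S 0 x)) (\<lambda>x. conj_ext (sH x o\<^sub>L Proj (W x)) (S 0 x))"
  proof (rule UE_homotopic_refl)
    show "continuous_map X euclidean (\<lambda>x. conj_ext (sH x) (S 0 x))"
      by (intro cont_intros csH contS0)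
    fix x assume x: "x \<in> topspace X"
    show "conj_ext (sH x) (S 0 x) \<in> UE" by (rule conj_ext_UE[OF isoH SUE Sfix]) (use x in auto)
    interpret W: closed_csubspace "W x" by (rule Wc[OF x])
    have PS: "S 0 x a - a = Proj (W x) (S 0 x (Proj (W x) a) - Proj (W x) a)" for a
    proof -
      have "S 0 x a = S 0 x (Proj (W x) a) + S 0 x (a - Proj (W x) a)"
        by (simp add: blinfun.diff_right)
      also have "S 0 x (a - Proj (W x) a) = a - Proj (W x) a" by (rule S0fix[OF x W.Proj_orth])
      finally have "S 0 x a - a = S 0 x (Proj (W x) a) - Proj (W x) a" by simp
      moreover have "S 0 x (Proj (W x) a) \<in> W x" using S0[OF x W.Proj_in] by simp
      ultimately show ?thesis by (simp add: blinfun.diff_right W.Proj_id)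
    qed
    show "conj_ext (sH x) (S 0 x) = conj_ext (sH x o\<^sub>L Proj (W x)) (S 0 x)"
      by (rule blinfun_eqI) (simp add: conj_ext_apply adj_compose PS[of "adj (sH x) _"])
  qed
  \<comment> \<open>Now both partial isometries start from \<open>W x\<close>, and the two unrelated
    trivializations can be exchanged.\<close>
  also have "UE_homotopic X (\<lambda>x. conj_ext (sH x o\<^sub>L Proj (W x)) (S 0 x)) (\<lambda>x. conj_ext (sV x) (S 0 x))"
  proof (rule UE_homotopic_conj_ext[OF inf_dim_aux(2), where W = W])
    show "continuous_map X euclidean (\<lambda>x. sH x o\<^sub>L Proj (W x))" by (intro cont_intros csH contPW)
    fix x assume x: "x \<in> topspace X"
    interpret W: closed_csubspace "W x" by (rule Wc[OF x])
    have "W x \<subseteq> Wp" by (auto simp: W_def Wp_def pos_part_def)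
    then show "part_isom (W x) (sH x o\<^sub>L Proj (W x)) \<and> part_isom (W x) (sV x)"
      using isoV[OF x] isoH[OF x] Wc[OF x]
      by (auto simp: part_isom_def W.Proj_id W.Proj_zero intro!: clin_intros W.clin_Proj)
  qed (use csV contS0 SUE S0fix in auto)
  also have "UE_homotopic X (\<lambda>x. conj_ext (sV x) (S 0 x)) (\<lambda>x. stabilize (TV x) (W x) (fV x))"
  proof (rule UE_homotopic_refl)
    show "continuous_map X euclidean (\<lambda>x. conj_ext (sV x) (S 0 x))"
      by (intro cont_intros csV contS0)
    show "conj_ext (sV x) (S 0 x) \<in> UE" if "x \<in> topspace X" for x
      by (rule conj_ext_UE[OF isoV SUE S0fix]) (use that in auto)
  qed (simp add: stabV)
  finally show ?thesis
    unfolding indH indV using UE_homotopic_K1 by blast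
qed

end
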